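(* Let $n\ge1$ and let $\Lambda_0\in\mathbb G(n-1,n+2)$ be such that $\Lambda_0\cap\Sigma$ is a zero-dimensional scheme of length $n$ supported at distinct points $y_1,\dots,y_k\in\Sigma$ with multiplicity $r_i\ge1$ at $y_i$ ($\sum r_i=n$). Let $\Lambda\in O^2_{\Lambda_0}(V)\cap\mathbb G(n-1,n+2)$. Then: (1) If $\dim\langle\Lambda,\Lambda_0\rangle=n+1$, there exist indices $i_1\ne i_2$ such that (a) $\Lambda\cap\Sigma=r_1y_1+\dots+(r_{i_1}-1)y_{i_1}+\dots+(r_{i_2}-1)y_{i_2}+\dots+r_ky_k$ (multiplicities at $y_{i_1},y_{i_2}$ lowered by one, others unchanged) and $\Lambda\cap\Lambda_0=\langle\Lambda\cap\Sigma\rangle$; and (b) there exist points $Q'_1\in O^{r_{i_1}}_{y_{i_1}}(\Sigma)$ and $Q'_2\in O^{r_{i_2}}_{y_{i_2}}(\Sigma)$ such that the subscheme $(r_{i_1}+1)y_{i_1}$ is contained in $\langle\Lambda,Q'_1\rangle$ and $(r_{i_2}+1)y_{i_2}$ is contained in $\langle\Lambda,Q'_2\rangle$. (2) If $\dim\langle\Lambda,\Lambda_0\rangle=n$, then one of the following holds: (a) $\Lambda\in T_{\Lambda_0}(V)$; (b) there exist indices $i_1\ne i_2$ such that $\langle\sum_{j\ne i_1,i_2}r_jy_j\rangle\subset\Lambda$ and $\langle\Lambda,\Lambda_0\rangle=\langle\Lambda_0,(r_{i_1}+2)y_{i_1}\rangle\cap\langle\Lambda_0,(r_{i_2}+2)y_{i_2}\rangle$;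 (c) there exists $i$ such that $\langle\sum_{j\ne i}r_jy_j\rangle\subset\Lambda\subset\langle\Lambda_0,(r_i+2)y_i\rangle$.
   Context: $K$ is an algebraically closed field of characteristic $0$, $R=K[x_0,\dots,x_n]$, $R_3$ its cubic part, $\mathbb P(R_3)$ the projective space of cubic forms up to scalars. Let $z_0,\dots,z_{n+2}$ be coordinates on $\mathbb P^{n+2}$ and $\Sigma=\{[t_0^{n+2}:\dots:t_1^{n+2}]\}$ the standard rational normal curve. $\mathbb G(n-1,n+2)$ has (dual) Plücker coordinates: for $\Lambda$ cut out by independent equations $\sum_j u_{i,j}z_j=0$, $i=1,2,3$, they are the $3\times3$ minors $\det(u_{a,i_b})$. For $0\ne L=u_0x_0+\dots+u_nx_n$ let $\phi(L)$ be the $(n-1)$-space $u_0z_j+\dots+u_nz_{j+n}=0$, $j=0,1,2$; its Plücker coordinates form a basis of $K[u_0,\dots,u_n]_3$, giving a unique linear isomorphism $\mathbb P(R_3)\to\mathbb P^{\binom{n+3}{3}-1}$ with $[L^3]\mapsto$ Plücker point of $\phi(L)$; through it $\mathbb G(n-1,n+2)\subset\mathbb P(R_3)$. $V=\{[L^3]\}$ is the Veronese variety, corresponding to the $(n-1)$-spaces meeting $\Sigma$ in length $n$; $T_{\Lambda_0}(V)$ and $O^2_{\Lambda_0}(V)$ are its tangent and second osculating spaces at $\Lambda_0$ (the latter consists of the classes $[LF]$, $F\in R_2$, if $\Lambda_0=[L^3]$). For distinct $y_j\in\Sigma$ and integers $m_j\ge0$, $m_1y_1+\dots+m_ky_k$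 denotes the subscheme of $\Sigma$ with multiplicity $m_j$ at $y_j$; $\langle\cdots\rangle$ is linear span (of subspaces, points, or subschemes of $\Sigma$); $O^k_y(\Sigma)=\langle(k+1)y\rangle$ is the $k$-th osculating space of $\Sigma$ at $y$. *)

theory Defs
  imports "HOL-Computational_Algebra.Polynomial"
begin

text \<open>Concrete linear-algebraic model.  Projective space P^(n+2) is modelled by
its affine cone: vectors z :: nat => 'a with z i = 0 for i >= n+3.  A projective
subspace is represented by its linear cone (a set of vectors).\<close>

definition amb :: "nat \<Rightarrow> (nat \<Rightarrow> 'a::field) set" where
  "amb n = {z. \<forall>i\<ge>n+3. z i = 0}"

definition dotp :: "nat \<Rightarrow> (nat \<Rightarrow> 'a::field) \<Rightarrow> (nat \<Rightarrow> 'a) \<Rightarrow> 'a" where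
  "dotp n l z = (\<Sum>j<n+3. l j * z j)"

definition lspan :: "('b \<Rightarrow> 'a::field) set \<Rightarrow> ('b \<Rightarrow> 'a) set" where
  "lspan S = {v. \<exists>F c. finite F \<and> F \<subseteq> S \<and> v = (\<lambda>x. \<Sum>f\<in>F. c f * f x)}"

definition lin_indep :: "('b \<Rightarrow> 'a::field) set \<Rightarrow> bool" where
  "lin_indep B \<longleftrightarrow> (\<forall>c. (\<forall>x. (\<Sum>b\<in>B. c b * b x) = 0) \<longrightarrow> (\<forall>b\<in>B. c b = 0))"

definition vdim_eq :: "('b \<Rightarrow> 'a::field) set \<Rightarrow> nat \<Rightarrow> bool" where
  "vdim_eq W d \<longleftrightarrow> (\<exists>B. finite B \<and> card B = d \<and> lin_indep B \<and> lspan B = W)"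

definition in_G :: "nat \<Rightarrow> (nat \<Rightarrow> 'a::field) set \<Rightarrow> bool" where
  "in_G n W \<longleftrightarrow> W \<subseteq> amb n \<and> vdim_eq W n"

definition ann :: "nat \<Rightarrow> (nat \<Rightarrow> 'a::field) set \<Rightarrow> (nat \<Rightarrow> 'a) set" where
  "ann n W = {l \<in> amb n. \<forall>v\<in>W. dotp n l v = 0}"

text \<open>Points of P^1 are nonzero pairs (s,t); the point of Sigma is
  z_j = s^(n+2-j) t^j.  Projective equality: \<close>

definition proj_eq :: "'a::field \<times> 'a \<Rightarrow> 'a \<times> 'a \<Rightarrow> bool" where
  "proj_eq p q \<longleftrightarrow> fst p * snd q = snd p * fst q"

text \<open>Restriction of the linear form l to Sigma, expanded in an affine
  coordinate x around the point (s,t) (direction (s',t') not proportional to (s,t)).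
  The order of vanishing of l|Sigma at (s,t) is the order of x = 0.\<close>

definition dirv :: "'a::field \<times> 'a \<Rightarrow> 'a \<times> 'a" where
  "dirv p = (if fst p = 0 then (1,0) else (0,1))"

definition pullback :: "nat \<Rightarrow> (nat \<Rightarrow> 'a::field) \<Rightarrow> 'a \<times> 'a \<Rightarrow> 'a poly" where
  "pullback n l p = (\<Sum>j<n+3. smult (l j)
      ([:fst p, fst (dirv p):] ^ (n+2-j) * [:snd p, snd (dirv p):] ^ j))"

definition ord_ge :: "nat \<Rightarrow> (nat \<Rightarrow> 'a::field) \<Rightarrow> 'a \<times> 'a \<Rightarrow> nat \<Rightarrow> bool" where
  "ord_ge n l p m \<longleftrightarrow> [:0,1:] ^ m dvd pullback n l p"

text \<open>Subschemes of Sigma supported at finitely many points: lists of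
  (point, multiplicity).  zmult Z y = multiplicity of Z at y.\<close>

definition zmult :: "(('a::field \<times> 'a) \<times> nat) list \<Rightarrow> 'a \<times> 'a \<Rightarrow> nat" where
  "zmult Z y = (\<Sum>q\<leftarrow>Z. if proj_eq (fst q) y then snd q else 0)"

definition hyp_has :: "nat \<Rightarrow> (nat \<Rightarrow> 'a::field) \<Rightarrow> (('a \<times> 'a) \<times> nat) list \<Rightarrow> bool" where
  "hyp_has n l Z \<longleftrightarrow> (\<forall>y. y \<noteq> (0,0) \<longrightarrow> ord_ge n l y (zmult Z y))"

definition sch_in :: "nat \<Rightarrow> (nat \<Rightarrow> 'a::field) set \<Rightarrow> (('a \<times> 'a) \<times> nat) list \<Rightarrow> bool" where
  "sch_in n W Z \<longleftrightarrow> (\<forall>l\<in>ann n W. hyp_has n l Z)"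

definition sch_span :: "nat \<Rightarrow> (('a::field \<times> 'a) \<times> nat) list \<Rightarrow> (nat \<Rightarrow> 'a) set" where
  "sch_span n Z = {v \<in> amb n. \<forall>l\<in>amb n. hyp_has n l Z \<longrightarrow> dotp n l v = 0}"

definition int_is :: "nat \<Rightarrow> (nat \<Rightarrow> 'a::field) set \<Rightarrow> (('a \<times> 'a) \<times> nat) list \<Rightarrow> bool" where
  "int_is n W Z \<longleftrightarrow> (\<forall>y. y \<noteq> (0,0) \<longrightarrow>
      (\<forall>m. (\<forall>l\<in>ann n W. ord_ge n l y m) \<longleftrightarrow> m \<le> zmult Z y))"

text \<open>Linear forms L = u_0 x_0 + ... + u_n x_n as coefficient vectors.\<close>
definition lf :: "nat \<Rightarrow> (nat \<Rightarrow> 'a::field) \<Rightarrow> bool" where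
  "lf n u \<longleftrightarrow> (\<forall>i>n. u i = 0)"

definition phi :: "nat \<Rightarrow> (nat \<Rightarrow> 'a::field) \<Rightarrow> (nat \<Rightarrow> 'a) set" where
  "phi n u = {z \<in> amb n. \<forall>j<3. (\<Sum>i\<le>n. u i * z (i+j)) = 0}"

text \<open>Dual Pluecker coordinates of the space cut out by three equations.\<close>
definition det3 :: "'a::field \<Rightarrow> 'a \<Rightarrow> 'a \<Rightarrow> 'a \<Rightarrow> 'a \<Rightarrow> 'a \<Rightarrow> 'a \<Rightarrow> 'a \<Rightarrow> 'a \<Rightarrow> 'a" where
  "det3 a11 a12 a13 a21 a22 a23 a31 a32 a33 =
     a11*(a22*a33 - a23*a32) - a12*(a21*a33 - a23*a31) + a13*(a21*a32 - a22*a31)"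

definition plk :: "nat \<Rightarrow> (nat \<Rightarrow> 'a::field) \<Rightarrow> (nat \<Rightarrow> 'a) \<Rightarrow> (nat \<Rightarrow> 'a) \<Rightarrow> nat \<times> nat \<times> nat \<Rightarrow> 'a" where
  "plk n u1 u2 u3 = (\<lambda>(i,j,k). if i < j \<and> j < k \<and> k < n+3 then
      det3 (u1 i) (u1 j) (u1 k) (u2 i) (u2 j) (u2 k) (u3 i) (u3 j) (u3 k) else 0)"

definition cut_by :: "nat \<Rightarrow> (nat \<Rightarrow> 'a::field) \<Rightarrow> (nat \<Rightarrow> 'a) \<Rightarrow> (nat \<Rightarrow> 'a) \<Rightarrow> (nat \<Rightarrow> 'a) set \<Rightarrow> bool" where
  "cut_by n u1 u2 u3 W \<longleftrightarrow> u1 \<in> amb n \<and> u2 \<in> amb n \<and> u3 \<in> amb n \<and>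
     (\<forall>a b c. (\<forall>x. a * u1 x + b * u2 x + c * u3 x = 0) \<longrightarrow> a = 0 \<and> b = 0 \<and> c = 0) \<and>
     W = {v \<in> amb n. dotp n u1 v = 0 \<and> dotp n u2 v = 0 \<and> dotp n u3 v = 0}"

definition shiftrow :: "nat \<Rightarrow> (nat \<Rightarrow> 'a::field) \<Rightarrow> nat \<Rightarrow> nat \<Rightarrow> 'a" where
  "shiftrow n u j = (\<lambda>i. if j \<le> i \<and> i \<le> j + n then u (i - j) else 0)"

text \<open>The linear isomorphism psi : R_3 -> Pluecker space with psi(L^3) = Pluecker
  vector of phi(L), evaluated on products L M N of linear forms: it is the
  polarisation of the cubic map L |-> plk(phi(L)).\<close>
definition psi3 :: "nat \<Rightarrow> (nat \<Rightarrow> 'a::field_char_0) \<Rightarrow> (nat \<Rightarrow> 'a) \<Rightarrow> (nat \<Rightarrow> 'a) \<Rightarrow> nat \<times> nat \<times> nat \<Rightarrow> 'a" where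
  "psi3 n a b c = (\<lambda>p. (1/6) *
     (plk n (shiftrow n a 0) (shiftrow n b 1) (shiftrow n c 2) p
    + plk n (shiftrow n a 0) (shiftrow n c 1) (shiftrow n b 2) p
    + plk n (shiftrow n b 0) (shiftrow n a 1) (shiftrow n c 2) p
    + plk n (shiftrow n b 0) (shiftrow n c 1) (shiftrow n a 2) p
    + plk n (shiftrow n c 0) (shiftrow n a 1) (shiftrow n b 2) p
    + plk n (shiftrow n c 0) (shiftrow n b 1) (shiftrow n a 2) p))"

text \<open>Second osculating space O^2 of V at Lambda0 = [L^3] (span of the [L F]),
  and tangent space (span of the [L^2 M]); membership of W in G means its
  Pluecker point lies in the corresponding projective span.\<close>
definition in_O2 :: "nat \<Rightarrow> (nat \<Rightarrow> 'a::{field_char_0}) set \<Rightarrow> (nat \<Rightarrow> 'a) set \<Rightarrow> bool" where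
  "in_O2 n W0 W \<longleftrightarrow> (\<exists>u. lf n u \<and> (\<exists>i. u i \<noteq> 0) \<and> W0 = phi n u \<and>
     (\<exists>u1 u2 u3. cut_by n u1 u2 u3 W \<and>
        plk n u1 u2 u3 \<in> lspan {psi3 n u v w | v w. lf n v \<and> lf n w}))"

definition in_T :: "nat \<Rightarrow> (nat \<Rightarrow> 'a::{field_char_0}) set \<Rightarrow> (nat \<Rightarrow> 'a) set \<Rightarrow> bool" where
  "in_T n W0 W \<longleftrightarrow> (\<exists>u. lf n u \<and> (\<exists>i. u i \<noteq> 0) \<and> W0 = phi n u \<and>
     (\<exists>u1 u2 u3. cut_by n u1 u2 u3 W \<and>
        plk n u1 u2 u3 \<in> lspan {psi3 n u u w | w. lf n w}))"

definition zsch :: "nat \<Rightarrow> (nat \<Rightarrow> 'a \<times> 'a) \<Rightarrow> (nat \<Rightarrow> nat) \<Rightarrow> (('a \<times> 'a) \<times> nat) list" where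
  "zsch k y r = map (\<lambda>i. (y i, r i)) [0..<k]"

end

theory Submission
  imports Defs "HOL-Library.Function_Algebras"
begin

text \<open>A linear form on \<open>P\<^bsup>n+2\<^esup>\<close> restricts to a binary form of degree \<open>n + 2\<close> on \<open>\<Sigma>\<close>.  On an affine line omitting one
  general point, \<open>\<Lambda>\<^sub>0\<close> becomes the space of multiples \<open>f q\<close>, \<open>deg q \<le> 2\<close>, of a polynomial \<open>f = \<Prod>(x - \<lambda>\<^sub>i)\<^bsup>r\<^sub>i\<^esup>\<close>, and \<open>\<Lambda>\<close> a
  three-dimensional space \<open>U\<close>; membership in the osculating space says that the wedge of a basis of \<open>U\<close> is a sum of
  symmetrised wedges of \<open>f, x v, x\<^sup>2 w\<close>.

  If \<open>\<langle>\<Lambda>,\<Lambda>\<^sub>0\<rangle>\<close> has codimension one, then \<open>U = \<langle>f q, w\<^sub>2, w\<^sub>3\<rangle>\<close>.  Contracting the wedge with coefficients of the quotient and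
  remainder by \<open>f\<close> gives \<open>f | q w\<^sub>2, q w\<^sub>3\<close>, so \<open>q\<close> is a quadratic divisor of \<open>f = q h\<close> and \<open>w\<^sub>i = h m\<^sub>i\<close>.  A local lemma at
  a root of \<open>f\<close>, comparing orders of vanishing, excludes a double root of \<open>q\<close> and yields the extra contact of (1b).  In
  codimension two, \<open>U = \<langle>f q\<^sub>1, f q\<^sub>2, w\<rangle>\<close>, and the same lemma puts \<open>(x - \<lambda>\<^sub>i)\<^sup>2\<close> into \<open>\<langle>q\<^sub>1, q\<^sub>2\<rangle>\<close> at each root where \<open>w\<close> vanishes
  to order less than \<open>r\<^sub>i\<close>.  Three squares being independent, there are one or two such roots, which are the alternatives (c) and
  (b) of (2).\<close>

section \<open>Symmetrised wedges and the local lemma\<close>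

text \<open>The annihilator of a span is the intersection of the annihilators, so the codimension of
  the span of \<Lambda> and \<Lambda>_0 counts the independent multiples of f in U. No exterior
  power is formed: an identity of wedges is an identity for all triples of linear functionals on
  polynomials, and each conclusion comes from a choice of functionals (coefficients of quotients, of
  remainders, of Taylor expansions). Multiple points are the obstacle. At a root of order r of f,
  the local lemma forbids members of U of exact orders s < e1 <= r and e2 with e1 + e2 = 2r + 1. The
  number 2r + 1 is a count of degrees: H[s,r-1,r-1] has total degree s + 2r - 2 and the Vandermonde
  factor has degree 3, so a coefficient of the wedge contributing to it with first index s has its
  other two indices summing to 2r + 1. Three triples of orders occur: (r-2, r-1, r+2) excludes a
  double root of q, (r-1, r, r+1) gives the extra contact in codimension one, and (s, r, r+1) gives
  the squares in codimension two.\<close>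

definition linfun :: "('a::field poly \<Rightarrow> 'a) \<Rightarrow> bool" where
  "linfun \<alpha> \<longleftrightarrow> (\<forall>p q. \<alpha> (p + q) = \<alpha> p + \<alpha> q) \<and> (\<forall>c p. \<alpha> (smult c p) = c * \<alpha> p)"

lemma linfun_add: "linfun \<alpha> \<Longrightarrow> \<alpha> (p + q) = \<alpha> p + \<alpha> q"
  and linfun_smult: "linfun \<alpha> \<Longrightarrow> \<alpha> (smult c p) = c * \<alpha> p"
  by (auto simp: linfun_def)

lemma linfun_zero: "linfun \<alpha> \<Longrightarrow> \<alpha> 0 = 0"
  using linfun_smult[of \<alpha> 0 0] by simp

lemma linfun_sum: "linfun \<alpha> \<Longrightarrow> \<alpha> (\<Sum>i\<in>I. g i) = (\<Sum>i\<in>I. \<alpha> (g i))"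
  by (induction I rule: infinite_finite_induct) (auto simp: linfun_zero linfun_add)

lemma linfun_mult_quadratic:
  assumes "linfun \<alpha>"
  shows "\<alpha> (f * [:a0, a1, a2:]) = a0 * \<alpha> f + a1 * \<alpha> (f * [:0, 1:]) + a2 * \<alpha> (f * [:0, 0, 1:])"
proof -
  have "[:a0, a1, a2:] = smult a0 1 + smult a1 [:0, 1:] + smult a2 [:0, 0, 1:]"
    by (simp add: one_pCons)
  then have "f * [:a0, a1, a2:] = smult a0 f + smult a1 (f * [:0, 1:]) + smult a2 (f * [:0, 0, 1:])"
    by (simp only: distrib_left mult_smult_right mult_1_right)
  then show ?thesis
    by (simp only: linfun_add[OF assms] linfun_smult[OF assms])
qed

definition wedge3 ::
  "('b \<Rightarrow> 'a::field) \<Rightarrow> ('b \<Rightarrow> 'a) \<Rightarrow> ('b \<Rightarrow> 'a) \<Rightarrow> 'b \<Rightarrow> 'b \<Rightarrow> 'b \<Rightarrow> 'a" where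
  "wedge3 \<alpha> \<beta> \<gamma> p q r =
    det3 (\<alpha> p) (\<beta> p) (\<gamma> p) (\<alpha> q) (\<beta> q) (\<gamma> q) (\<alpha> r) (\<beta> r) (\<gamma> r)"

text \<open>The six ways of placing f, v, w on the fixed multipliers e1, e2, e3. This is the
  polarisation \<open>psi3\<close> with the shifts of a row read as multiplications; the factor 1/6
  is left out here and put into v later.\<close>

definition symwedge ::
  "('a::field poly \<Rightarrow> 'a) \<Rightarrow> ('a poly \<Rightarrow> 'a) \<Rightarrow> ('a poly \<Rightarrow> 'a) \<Rightarrow>
   'a poly \<Rightarrow> 'a poly \<Rightarrow> 'a poly \<Rightarrow> 'a poly \<Rightarrow> 'a poly \<Rightarrow> 'a poly \<Rightarrow> 'a" where
  "symwedge \<alpha> \<beta> \<gamma> e1 e2 e3 f v w =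
     wedge3 \<alpha> \<beta> \<gamma> (f * e1) (v * e2) (w * e3) + wedge3 \<alpha> \<beta> \<gamma> (f * e1) (w * e2) (v * e3)
   + wedge3 \<alpha> \<beta> \<gamma> (v * e1) (f * e2) (w * e3) + wedge3 \<alpha> \<beta> \<gamma> (v * e1) (w * e2) (f * e3)
   + wedge3 \<alpha> \<beta> \<gamma> (w * e1) (f * e2) (v * e3) + wedge3 \<alpha> \<beta> \<gamma> (w * e1) (v * e2) (f * e3)"

text \<open>Exchanging two multipliers permutes the six summands and exchanges two arguments in each
  wedge.\<close>

lemma symwedge_alternating:
  "symwedge \<alpha> \<beta> \<gamma> e2 e1 e3 f v w = - symwedge \<alpha> \<beta> \<gamma> e1 e2 e3 f v w"
  "symwedge \<alpha> \<beta> \<gamma> e1 e3 e2 f v w = - symwedge \<alpha> \<beta> \<gamma> e1 e2 e3 f v w"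
  by (simp_all add: symwedge_def wedge3_def det3_def algebra_simps)

lemma wedge3_linear_first:
  assumes "\<alpha> p = a0 * \<alpha> p0 + a1 * \<alpha> p1 + a2 * \<alpha> p2"
    "\<beta> p = a0 * \<beta> p0 + a1 * \<beta> p1 + a2 * \<beta> p2"
    "\<gamma> p = a0 * \<gamma> p0 + a1 * \<gamma> p1 + a2 * \<gamma> p2"
  shows "wedge3 \<alpha> \<beta> \<gamma> p q r =
    a0 * wedge3 \<alpha> \<beta> \<gamma> p0 q r + a1 * wedge3 \<alpha> \<beta> \<gamma> p1 q r + a2 * wedge3 \<alpha> \<beta> \<gamma> p2 q r"
  unfolding wedge3_def det3_def assms by (simp add: algebra_simps)

lemma symwedge_linear_first:
  assumes "linfun \<alpha>" "linfun \<beta>" "linfun \<gamma>"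
  shows "symwedge \<alpha> \<beta> \<gamma> [:a0, a1, a2:] e2 e3 f v w =
     a0 * symwedge \<alpha> \<beta> \<gamma> 1 e2 e3 f v w + a1 * symwedge \<alpha> \<beta> \<gamma> [:0, 1:] e2 e3 f v w
   + a2 * symwedge \<alpha> \<beta> \<gamma> [:0, 0, 1:] e2 e3 f v w"
proof -
  have "wedge3 \<alpha> \<beta> \<gamma> (g * [:a0, a1, a2:]) q r = a0 * wedge3 \<alpha> \<beta> \<gamma> (g * 1) q r
      + a1 * wedge3 \<alpha> \<beta> \<gamma> (g * [:0, 1:]) q r + a2 * wedge3 \<alpha> \<beta> \<gamma> (g * [:0, 0, 1:]) q r" for g q r
    using assms by (intro wedge3_linear_first) (simp_all only: linfun_mult_quadratic[of _ _ a0 a1 a2] mult_1_right)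
  then show ?thesis
    unfolding symwedge_def by (simp add: algebra_simps del: mult_pCons_right)
qed

text \<open>The multipliers range over a three-dimensional space, and an alternating trilinear form
  on such a space is a multiple of the determinant. Changes of coordinate on the line therefore
  alter a symmetrised wedge only by a scalar.\<close>

lemma symwedge_quadratics:
  fixes f :: "'a::field_char_0 poly"
  assumes "linfun \<alpha>" "linfun \<beta>" "linfun \<gamma>"
  shows "symwedge \<alpha> \<beta> \<gamma> [:a0, a1, a2:] [:b0, b1, b2:] [:c0, c1, c2:] f v w =
     det3 a0 a1 a2 b0 b1 b2 c0 c1 c2 * symwedge \<alpha> \<beta> \<gamma> 1 [:0, 1:] [:0, 0, 1:] f v w"
proof -
  let ?S = "\<lambda>e1 e2 e3. symwedge \<alpha> \<beta> \<gamma> e1 e2 e3 f v w"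
  have alt: "?S e2 e1 e3 = - ?S e1 e2 e3" "?S e1 e3 e2 = - ?S e1 e2 e3" for e1 e2 e3
    by (rule symwedge_alternating)+
  \<comment> \<open>Alternation is available only as a change of sign; repeated multipliers give
    zero because 2 is invertible.\<close>
  have eq1: "?S e e e' = 0" for e e'
    using alt(1)[of e e e'] by simp
  have eq2: "?S e e' e' = 0" for e e'
    using alt(2)[of e e' e'] by simp
  have eq3: "?S e e' e = 0" for e e'
    using alt(1)[of e e' e] eq2 by simp
  note l1 = symwedge_linear_first[OF assms]
  have l2: "?S e1 [:d0, d1, d2:] e3 = d0 * ?S e1 1 e3 + d1 * ?S e1 [:0, 1:] e3 + d2 * ?S e1 [:0, 0, 1:] e3"
    for e1 e3 d0 d1 d2
    unfolding alt(1)[where ?e1.0 = "[:d0, d1, d2:]" and ?e2.0 = e1] l1[of d0 d1 d2]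
    unfolding alt(1)[where ?e1.0 = 1 and ?e2.0 = e1] alt(1)[where ?e1.0 = "[:0, 1:]" and ?e2.0 = e1]
      alt(1)[where ?e1.0 = "[:0, 0, 1:]" and ?e2.0 = e1] by algebra
  have l3: "?S e1 e2 [:d0, d1, d2:] = d0 * ?S e1 e2 1 + d1 * ?S e1 e2 [:0, 1:] + d2 * ?S e1 e2 [:0, 0, 1:]"
    for e1 e2 d0 d1 d2
    unfolding alt(2)[where ?e2.0 = "[:d0, d1, d2:]" and ?e3.0 = e2] l2[of _ d0 d1 d2]
    unfolding alt(2)[where ?e2.0 = 1 and ?e3.0 = e2] alt(2)[where ?e2.0 = "[:0, 1:]" and ?e3.0 = e2]
      alt(2)[where ?e2.0 = "[:0, 0, 1:]" and ?e3.0 = e2] by algebra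
  let ?x = "[:0, 1::'a:]" and ?y = "[:0, 0, 1::'a:]"
  have p: "?S 1 ?y ?x = - ?S 1 ?x ?y" "?S ?x 1 ?y = - ?S 1 ?x ?y" "?S ?y 1 ?x = ?S 1 ?x ?y"
      "?S ?x ?y 1 = ?S 1 ?x ?y" "?S ?y ?x 1 = - ?S 1 ?x ?y"
    using alt(1)[of 1 ?x ?y] alt(2)[of 1 ?x ?y] alt(1)[of 1 ?y ?x] alt(2)[of ?x 1 ?y] alt(2)[of ?y 1 ?x]
    by (simp_all, metis minus_minus)
  show ?thesis
    unfolding l1[of a0 a1 a2] l2[of _ b0 b1 b2] l3[of _ _ c0 c1 c2] eq1 eq2 eq3 p
    by (simp add: det3_def algebra_simps)
qed

text \<open>Quantifying over all functionals encodes an equality in the third exterior power of the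
  polynomial ring. The sum carries no coefficients, since scalars can be absorbed into v.\<close>

definition osc :: "'a::field poly \<Rightarrow> 'a poly \<Rightarrow> 'a poly \<Rightarrow> 'a poly \<Rightarrow> bool" where
  "osc f w1 w2 w3 \<longleftrightarrow> (\<exists>(N::nat) v w. \<forall>\<alpha> \<beta> \<gamma>. linfun \<alpha> \<longrightarrow> linfun \<beta> \<longrightarrow> linfun \<gamma> \<longrightarrow>
     wedge3 \<alpha> \<beta> \<gamma> w1 w2 w3 = (\<Sum>m<N. symwedge \<alpha> \<beta> \<gamma> 1 [:0, 1:] [:0, 0, 1:] f (v m) (w m)))"

lemma oscI:
  assumes "\<And>\<alpha> \<beta> \<gamma>. linfun \<alpha> \<Longrightarrow> linfun \<beta> \<Longrightarrow> linfun \<gamma> \<Longrightarrow>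
     wedge3 \<alpha> \<beta> \<gamma> w1 w2 w3 = (\<Sum>m<N::nat. symwedge \<alpha> \<beta> \<gamma> 1 [:0, 1:] [:0, 0, 1:] f (v m) (w m))"
  shows "osc f w1 w2 w3"
  unfolding osc_def by (intro exI allI impI) (rule assms)

lemma symwedge_smult:
  assumes "linfun \<alpha>" "linfun \<beta>" "linfun \<gamma>"
  shows "symwedge \<alpha> \<beta> \<gamma> e1 e2 e3 f (smult d v) w = d * symwedge \<alpha> \<beta> \<gamma> e1 e2 e3 f v w"
  by (simp add: symwedge_def wedge3_def det3_def algebra_simps
      linfun_smult[OF assms(1)] linfun_smult[OF assms(2)] linfun_smult[OF assms(3)])

text \<open>The wedge is multiplied by the determinant of the substitution, which is absorbed into
  v. The determinant may vanish, so any three members of the spanned space can be inserted.\<close>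

lemma osc_combination:
  assumes "osc f w1 w2 w3"
    and "u1 = smult a1 w1 + smult a2 w2 + smult a3 w3"
    and "u2 = smult b1 w1 + smult b2 w2 + smult b3 w3"
    and "u3 = smult c1 w1 + smult c2 w2 + smult c3 w3"
  shows "osc f u1 u2 u3"
proof -
  obtain N v w where *: "\<And>\<alpha> \<beta> \<gamma>. linfun \<alpha> \<Longrightarrow> linfun \<beta> \<Longrightarrow> linfun \<gamma> \<Longrightarrow>
     wedge3 \<alpha> \<beta> \<gamma> w1 w2 w3 = (\<Sum>m<N::nat. symwedge \<alpha> \<beta> \<gamma> 1 [:0, 1:] [:0, 0, 1:] f (v m) (w m))"
    using assms(1) unfolding osc_def by blast
  let ?D = "det3 a1 a2 a3 b1 b2 b3 c1 c2 c3"
  have "wedge3 \<alpha> \<beta> \<gamma> u1 u2 u3 =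
      (\<Sum>m<N. symwedge \<alpha> \<beta> \<gamma> 1 [:0, 1:] [:0, 0, 1:] f (smult ?D (v m)) (w m))"
    if l: "linfun \<alpha>" "linfun \<beta>" "linfun \<gamma>" for \<alpha> \<beta> \<gamma>
  proof -
    have "wedge3 \<alpha> \<beta> \<gamma> u1 u2 u3 = ?D * wedge3 \<alpha> \<beta> \<gamma> w1 w2 w3"
      unfolding assms(2-4) wedge3_def det3_def
        linfun_add[OF l(1)] linfun_add[OF l(2)] linfun_add[OF l(3)]
        linfun_smult[OF l(1)] linfun_smult[OF l(2)] linfun_smult[OF l(3)]
      by (simp add: algebra_simps)
    then show ?thesis
      using *[OF l] by (simp add: symwedge_smult[OF l] sum_distrib_left)
  qed
  then show ?thesis
    by (rule oscI)
qed

text \<open>A functional composed with a translation is again a functional, and 1, x, x^2 are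
  translated by a unitriangular matrix. Questions at a point t thus move to 0.\<close>

lemma osc_translate:
  fixes f :: "'a::field_char_0 poly"
  assumes "osc f w1 w2 w3"
  shows "osc (f \<circ>\<^sub>p [:t, 1:]) (w1 \<circ>\<^sub>p [:t, 1:]) (w2 \<circ>\<^sub>p [:t, 1:]) (w3 \<circ>\<^sub>p [:t, 1:])"
proof -
  obtain N v w where *: "\<And>\<alpha> \<beta> \<gamma>. linfun \<alpha> \<Longrightarrow> linfun \<beta> \<Longrightarrow> linfun \<gamma> \<Longrightarrow>
     wedge3 \<alpha> \<beta> \<gamma> w1 w2 w3 = (\<Sum>m<N::nat. symwedge \<alpha> \<beta> \<gamma> 1 [:0, 1:] [:0, 0, 1:] f (v m) (w m))"
    using assms unfolding osc_def by blast
  let ?c = "\<lambda>p. p \<circ>\<^sub>p [:t, 1:]"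
  have "wedge3 \<alpha> \<beta> \<gamma> (?c w1) (?c w2) (?c w3) =
      (\<Sum>m<N. symwedge \<alpha> \<beta> \<gamma> 1 [:0, 1:] [:0, 0, 1:] (?c f) (?c (v m)) (?c (w m)))"
    if l: "linfun \<alpha>" "linfun \<beta>" "linfun \<gamma>" for \<alpha> \<beta> \<gamma>
  proof -
    have l': "linfun (\<lambda>p. \<alpha> (?c p))" "linfun (\<lambda>p. \<beta> (?c p))" "linfun (\<lambda>p. \<gamma> (?c p))"
      using l by (simp_all add: linfun_def pcompose_add pcompose_smult)
    have e: "?c 1 = [:1, 0, 0:]" "?c [:0, 1:] = [:t, 1, 0:]" "?c [:0, 0, 1:] = [:t^2, 2 * t, 1:]"
      by (simp_all add: pcompose_pCons one_pCons power2_eq_square)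
    have "symwedge (\<lambda>p. \<alpha> (?c p)) (\<lambda>p. \<beta> (?c p)) (\<lambda>p. \<gamma> (?c p)) 1 [:0, 1:] [:0, 0, 1:] f v w =
       symwedge \<alpha> \<beta> \<gamma> [:1, 0, 0:] [:t, 1, 0:] [:t^2, 2 * t, 1:] (?c f) (?c v) (?c w)" for v w
      unfolding symwedge_def wedge3_def pcompose_mult e ..
    then have "symwedge (\<lambda>p. \<alpha> (?c p)) (\<lambda>p. \<beta> (?c p)) (\<lambda>p. \<gamma> (?c p)) 1 [:0, 1:] [:0, 0, 1:] f v w =
       symwedge \<alpha> \<beta> \<gamma> 1 [:0, 1:] [:0, 0, 1:] (?c f) (?c v) (?c w)" for v w
      unfolding symwedge_quadratics[OF l] by (simp add: det3_def)
    then show ?thesis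
      using *[OF l'] by (simp add: wedge3_def)
  qed
  then show ?thesis
    by (rule oscI)
qed

text \<open>Integer indices with value 0 below 0 make multiplication by x an exact shift, so
  recursions may run past the boundary.\<close>

definition zcoeff :: "'a::zero poly \<Rightarrow> int \<Rightarrow> 'a" where
  "zcoeff p i = (if i < 0 then 0 else coeff p (nat i))"

lemma zcoeff_neg: "i < 0 \<Longrightarrow> zcoeff p i = 0"
  and zcoeff_nat: "zcoeff p (int k) = coeff p k"
  by (simp_all add: zcoeff_def)

lemma X_power_dvd_iff: "[:0, 1:] ^ r dvd p \<longleftrightarrow> (\<forall>i<r. coeff p i = 0)" for p :: "'a::field poly"
  using monom_1_dvd_iff'[of r p] by (simp add: monom_altdef)

lemma zcoeff_below: "[:0, 1:] ^ r dvd p \<Longrightarrow> i < int r \<Longrightarrow> zcoeff p i = 0"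
  for p :: "'a::field poly"
  by (simp add: zcoeff_def X_power_dvd_iff nat_less_iff)

lemma linfun_zcoeff: "linfun (\<lambda>p. zcoeff p i)"
  by (simp add: linfun_def zcoeff_def)

lemma zcoeff_shift:
  fixes p :: "'a::field poly"
  shows "zcoeff (p * [:0, 1:]) i = zcoeff p (i - 1)"
    "zcoeff (p * [:0, 0, 1:]) i = zcoeff p (i - 2)"
proof -
  have x: "p * [:0, 1:] = pCons 0 p" for p :: "'a poly" by simp
  show *: "zcoeff (p * [:0, 1:]) i = zcoeff p (i - 1)" for p :: "'a poly" and i
  proof (cases "i \<le> 0")
    case True
    then show ?thesis by (cases "i = 0") (simp_all add: x zcoeff_def)
  next
    case False
    then have "nat i = Suc (nat (i - 1))" by simp
    with False show ?thesis by (simp add: x zcoeff_def)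
  qed
  have "p * [:0, 0, 1:] = p * [:0, 1:] * [:0, 1:]" by simp
  then show "zcoeff (p * [:0, 0, 1:]) i = zcoeff p (i - 2)"
    by (simp only: *) (simp add: algebra_simps)
qed

text \<open>In generating functions a wedge \<open>\<omega>\<close> with \<^term>\<open>osc\<close> is \<open>V \<cdot> H\<close> with \<open>V\<close> the Vandermonde determinant in
  three variables and \<open>H\<close> symmetric with \<open>H[i,j,k] = 0\<close> whenever \<open>i, j, k < r\<close>.  Expanding \<open>1 / V\<close> expresses
  \<open>H[s,r-1,r-1]\<close> through \<open>\<omega>\<close>, and the orders of vanishing leave exactly one summand.\<close>

lemma osc_local:
  fixes f :: "'a::field poly"
  assumes osc: "osc f w1 w2 w3" and f: "[:0, 1:] ^ r dvd f"
    and w1: "[:0, 1:] ^ s dvd w1" and w2: "[:0, 1:] ^ e1 dvd w2" and w3: "[:0, 1:] ^ e2 dvd w3"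
    and le: "s < e1" "e1 \<le> r" "e1 + e2 = 2 * r + 1"
  shows "coeff w1 s * coeff w2 e1 * coeff w3 e2 = 0"
proof -
  obtain N v w where *: "\<And>\<alpha> \<beta> \<gamma>. linfun \<alpha> \<Longrightarrow> linfun \<beta> \<Longrightarrow> linfun \<gamma> \<Longrightarrow>
     wedge3 \<alpha> \<beta> \<gamma> w1 w2 w3 = (\<Sum>m<N::nat. symwedge \<alpha> \<beta> \<gamma> 1 [:0, 1:] [:0, 0, 1:] f (v m) (w m))"
    using osc unfolding osc_def by blast
  let ?z = "\<lambda>i p. zcoeff p i"
  \<comment> \<open>The permanent of the coefficients of f, v, w: every summand contains a
    coefficient of f, whence the vanishing of \<open>H\<close> when all indices are below r.\<close>
  define h where "h v w i j k =
      ?z i f * ?z j v * ?z k w + ?z i f * ?z j w * ?z k v + ?z i v * ?z j f * ?z k w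
    + ?z i v * ?z j w * ?z k f + ?z i w * ?z j f * ?z k v + ?z i w * ?z j v * ?z k f" for v w i j k
  define H where "H i j k = (\<Sum>m<N. h (v m) (w m) i j k)" for i j k
  define om where "om i j k = wedge3 (?z i) (?z j) (?z k) w1 w2 w3" for i j k
  have sym: "symwedge (?z i) (?z j) (?z k) 1 [:0, 1:] [:0, 0, 1:] f v w =
      h v w i (j-1) (k-2) - h v w i (j-2) (k-1) - h v w (i-1) j (k-2)
    + h v w (i-2) j (k-1) + h v w (i-1) (j-2) k - h v w (i-2) (j-1) k" for i j k v w
    unfolding symwedge_def wedge3_def det3_def h_def zcoeff_shift mult_1_right by (simp add: algebra_simps)
  \<comment> \<open>The six signed shifts are the expansion of (y - x)(z - x)(z - y), with x, y, z
    attached to the three indices.\<close>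
  have om: "om i j k = H i (j-1) (k-2) - H i (j-2) (k-1) - H (i-1) j (k-2)
    + H (i-2) j (k-1) + H (i-1) (j-2) k - H (i-2) (j-1) k" for i j k
    unfolding om_def *[OF linfun_zcoeff linfun_zcoeff linfun_zcoeff] sym H_def
    by (simp add: sum.distrib sum_subtractf)
  have Hneg: "H i j k = 0" if "i < 0 \<or> j < 0 \<or> k < 0" for i j k
    using that by (auto simp: H_def h_def zcoeff_neg)
  have Hlow: "H i j k = 0" if "i < int r" "j < int r" "k < int r" for i j k
    using that by (simp add: H_def h_def zcoeff_below[OF f])
  have om0: "om i j k = 0" if "i < int s" for i j k
    using that le by (simp add: om_def wedge3_def det3_def zcoeff_below[OF w1]
        zcoeff_below[OF w2] zcoeff_below[OF w3])
  \<comment> \<open>In the lowest x-degree the Vandermonde factor is y z (z - y), so what remains is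
    division by z - y: a recursion lowering j and raising k.\<close>
  have step: "H i j k = om i (j+1) (k+2) + H i (j-1) (k+1)"
    if "\<And>i' j k. i' < i \<Longrightarrow> H i' j k = 0" for i j k
    using that[of "i-1"] that[of "i-2"] om[of i "j+1" "k+2"] by (simp add: algebra_simps)
  \<comment> \<open>All three polynomials vanish to order s, so the recursion has no source term and
    runs down to a negative j.\<close>
  have H0: "H (int i) j k = 0" if "i < s" for i j k
    using that
  proof (induction i arbitrary: j k rule: less_induct)
    case (less i)
    have low: "H i' j k = 0" if "i' < int i" for i' j k
    proof (cases "i' < 0")
      case False
      then obtain m where "i' = int m" by (metis nonneg_int_cases not_less)
      with that less show ?thesis by simp
    qed (simp add: Hneg)
    have st: "H (int i) j k = om (int i) (j+1) (k+2) + H (int i) (j-1) (k+1)" for j k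
      by (rule step) (rule low)
    have "H (int i) (int j) k = 0" for j k
    proof (induction j arbitrary: k)
      case 0
      show ?case using st[of 0 k] om0 less by (simp add: Hneg)
    next
      case (Suc j)
      show ?case using st[of "int (Suc j)" k] om0 less Suc by simp
    qed
    then show ?case using Hneg by (cases "j < 0") (auto, metis nonneg_int_cases not_less)
  qed
  have low: "H i' j k = 0" if "i' < int s" for i' j k
  proof (cases "i' < 0")
    case False
    then obtain m where "i' = int m" by (metis nonneg_int_cases not_less)
    with that H0 show ?thesis by simp
  qed (simp add: Hneg)
  \<comment> \<open>The geometric series of 1 / (z - y), truncated after m terms. For m = r the
    remainder has second index -1 and disappears.\<close>
  have tele: "H (int s) (int r - 1) (int r - 1) =
      (\<Sum>c<m. om (int s) (int r - int c) (int r + 1 + int c)) + H (int s) (int r - 1 - int m) (int r - 1 + int m)"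
    for m :: nat
  proof (induction m)
    case (Suc m)
    have "H (int s) j k = om (int s) (j+1) (k+2) + H (int s) (j-1) (k+1)" for j k
      by (rule step) (rule low)
    from Suc this[of "int r - 1 - int m" "int r - 1 + int m"] show ?case
      by (simp add: algebra_simps)
  qed simp
  \<comment> \<open>Only the diagonal product of the determinant survives. It requires r - c >= e1
    and r + 1 + c >= e2 = 2r + 1 - e1, which leaves c = r - e1.\<close>
  have "om (int s) (int r - int c) (int r + 1 + int c) =
      (if c = r - e1 then coeff w1 s * coeff w2 e1 * coeff w3 e2 else 0)" if "c < r" for c
  proof -
    have a: "zcoeff w2 (int s) = 0" "zcoeff w3 (int s) = 0" "zcoeff w3 (int r - int c) = 0"
      using le by (simp_all add: zcoeff_below[OF w2] zcoeff_below[OF w3])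
    have "zcoeff w2 (int r - int c) * zcoeff w3 (int r + 1 + int c) = 0" if "c \<noteq> r - e1"
    proof (cases "c < r - e1")
      case True
      then show ?thesis using le by (simp add: zcoeff_below[OF w3])
    next
      case False
      then show ?thesis using le that by (simp add: zcoeff_below[OF w2])
    qed
    moreover have "int r - int c = int e1" "int r + 1 + int c = int e2" if "c = r - e1"
      using that le by auto
    moreover have "om (int s) (int r - int c) (int r + 1 + int c) =
        zcoeff w1 (int s) * (zcoeff w2 (int r - int c) * zcoeff w3 (int r + 1 + int c))"
      unfolding om_def wedge3_def det3_def a by simp
    ultimately show ?thesis
      by (simp add: zcoeff_nat)
  qed
  then have "(\<Sum>c<r. om (int s) (int r - int c) (int r + 1 + int c)) =
     (\<Sum>c<r. if c = r - e1 then coeff w1 s * coeff w2 e1 * coeff w3 e2 else 0)"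
    by (intro sum.cong) auto
  also have "\<dots> = coeff w1 s * coeff w2 e1 * coeff w3 e2"
    using le by simp
  finally show ?thesis
    using tele[of r] Hlow[of "int s" "int r - 1" "int r - 1"] le by (simp add: Hneg)
qed

section \<open>Osculating triples of polynomials\<close>

lemma pcompose_power: "(p ^ n) \<circ>\<^sub>p q = (p \<circ>\<^sub>p q) ^ n" for p q :: "'a::comm_ring_1 poly"
  by (induction n) (simp_all add: pcompose_mult one_pCons)

text \<open>After translation to 0 the values of the cofactors at t are the leading coefficients in
  the local lemma.\<close>

lemma osc_local_at:
  fixes f :: "'a::field_char_0 poly"
  assumes osc: "osc f ([:-t, 1:] ^ s * g1) ([:-t, 1:] ^ e1 * g2) ([:-t, 1:] ^ e2 * g3)"
    and f: "[:-t, 1:] ^ r dvd f"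
    and le: "s < e1" "e1 \<le> r" "e1 + e2 = 2 * r + 1"
  shows "poly g1 t = 0 \<or> poly g2 t = 0 \<or> poly g3 t = 0"
proof -
  let ?c = "\<lambda>p. p \<circ>\<^sub>p [:t, 1:]"
  have e: "?c ([:-t, 1:] ^ s * g) = [:0, 1:] ^ s * ?c g" for s g
    by (simp add: pcompose_mult pcompose_power pcompose_pCons)
  have d: "[:0, 1:] ^ r dvd ?c f"
    using f e by (auto elim!: dvdE)
  have co: "coeff ([:0, 1:] ^ s * ?c g) s = poly g t" for s g
  proof -
    have "[:0, 1:] ^ s = (monom 1 s :: 'a poly)" by (simp add: monom_altdef)
    then show ?thesis
      by (simp add: coeff_monom_mult flip: poly_0_coeff_0) (simp add: poly_pcompose)
  qed
  show ?thesis
    using osc_local[OF osc_translate[OF osc, of t, unfolded e] d _ _ _ le] unfolding co by simp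
qed

lemma linfun_coeff_div: "linfun (\<lambda>g. coeff (g div f) i)"
  and linfun_coeff_mod: "linfun (\<lambda>g. coeff ((g * h) mod f) i)"
  for f :: "'a::field poly"
  by (simp_all add: linfun_def poly_div_add_left div_smult_left poly_mod_add_left mod_smult_left distrib_right)

text \<open>The wedge is contracted with the sum over i = 0, 1, 2 of \<open>?A i\<close>,
  \<open>?B\<close> at x^i and \<open>?C\<close>. Remainders kill multiples of f, so f has to meet
  \<open>?A i\<close>, which selects the multiplier x^i. Then x^i and the multiplier met by
  \<open>?B\<close> enter only through their product, while exchanging them changes the sign: the
  symmetrised wedges cancel. On the other side \<open>?A i\<close> reads the coefficients of q, and
  the three summands assemble to \<open>?B q\<close>.\<close>

lemma osc_mod_relation:
  fixes f q :: "'a::field poly"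
  assumes osc: "osc f (f * q) w2 w3" and "f \<noteq> 0" and dq: "degree q \<le> 2"
  shows "coeff ((w2 * q) mod f) a * coeff (w3 mod f) b = coeff ((w3 * q) mod f) a * coeff (w2 mod f) b"
proof -
  obtain N v w where *: "\<And>\<alpha> \<beta> \<gamma>. linfun \<alpha> \<Longrightarrow> linfun \<beta> \<Longrightarrow> linfun \<gamma> \<Longrightarrow>
     wedge3 \<alpha> \<beta> \<gamma> (f * q) w2 w3 = (\<Sum>m<N::nat. symwedge \<alpha> \<beta> \<gamma> 1 [:0, 1:] [:0, 0, 1:] f (v m) (w m))"
    using osc unfolding osc_def by blast
  let ?A = "\<lambda>i g. coeff (g div f) i"
  let ?B = "\<lambda>h g. coeff ((g * h) mod f) a"
  let ?C = "\<lambda>g. coeff ((g * 1) mod f) b"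
  let ?x = "[:0, 1::'a:]" and ?y = "[:0, 0, 1::'a:]"
  have S: "symwedge (?A 0) (?B 1) ?C 1 ?x ?y f v w + symwedge (?A 1) (?B ?x) ?C 1 ?x ?y f v w
      + symwedge (?A 2) (?B ?y) ?C 1 ?x ?y f v w = 0" for v w
  proof -
    have A: "(f * e) div f = e" for e using \<open>f \<noteq> 0\<close> by simp
    have M: "(f * e * e') mod f = 0" for e e' by (simp add: mult.assoc)
    have E: "g * 1 * 1 = g" "g * 1 * ?x = g * ?x" "g * 1 * ?y = g * ?y" "g * ?x * 1 = g * ?x"
      "g * ?y * 1 = g * ?y" "g * ?x * ?x = g * ?y" "g * ?y * ?x = g * ?x * ?y" for g
      by simp_all
    have c: "coeff 1 0 = (1::'a)" "coeff 1 1 = (0::'a)" "coeff 1 2 = (0::'a)"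
       "coeff ?x 0 = 0" "coeff ?x 1 = 1" "coeff ?x 2 = 0"
       "coeff ?y 0 = 0" "coeff ?y 1 = 0" "coeff ?y 2 = 1"
      by (simp_all add: numeral_2_eq_2)
    show ?thesis
      unfolding symwedge_def wedge3_def det3_def A M E c coeff_0
      by (simp del: mult_pCons_right mult_pCons_left add: algebra_simps)
  qed
  have l: "linfun (?A i)" "linfun (?B h)" "linfun ?C" for i h
    by (rule linfun_coeff_div linfun_coeff_mod)+
  have W: "wedge3 (?A 0) (?B 1) ?C (f * q) w2 w3 + wedge3 (?A 1) (?B ?x) ?C (f * q) w2 w3
      + wedge3 (?A 2) (?B ?y) ?C (f * q) w2 w3 = 0"
    unfolding *[OF l(1) l(2) l(3)] sum.distrib[symmetric] S by simp
  have q: "q = [:coeff q 0, coeff q 1, coeff q 2:]"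
    using dq by (intro poly_eqI) (auto simp: coeff_pCons coeff_eq_0 numeral_2_eq_2 split: nat.splits)
  have Q: "?B q g = coeff q 0 * ?B 1 g + coeff q 1 * ?B ?x g + coeff q 2 * ?B ?y g" for g
  proof -
    have "g * q = g * [:coeff q 0, coeff q 1, coeff q 2:]" using q by simp
    then show ?thesis
      using linfun_mult_quadratic[OF linfun_coeff_mod[of 1 f a], of g "coeff q 0" "coeff q 1" "coeff q 2"]
      by (simp only: mult_1_right)
  qed
  have w: "wedge3 (?A i) (?B h) ?C (f * q) w2 w3 = coeff q i * (?B h w2 * ?C w3 - ?C w2 * ?B h w3)" for i h
    using \<open>f \<noteq> 0\<close> by (simp add: wedge3_def det3_def mult.assoc)
  have "?B q w2 * ?C w3 - ?C w2 * ?B q w3 = 0"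
    using W unfolding w Q by (simp del: mult_pCons_right add: algebra_simps)
  then show ?thesis by (simp add: mult.commute)
qed

text \<open>If w3 q had a nonzero residue modulo f, the relation would make the residues of w2 and
  w3 proportional, against their independence.\<close>

lemma osc_dvd:
  fixes f q :: "'a::field poly"
  assumes osc: "osc f (f * q) w2 w3" and f: "f \<noteq> 0" and dq: "degree q \<le> 2"
    and ind: "\<And>a b. f dvd smult a w2 + smult b w3 \<Longrightarrow> a = 0 \<and> b = 0"
  shows "f dvd w2 * q" "f dvd w3 * q"
proof -
  note rel = osc_mod_relation[OF osc f dq]
  have "w3 mod f \<noteq> 0" using ind[of 0 1] by auto
  then obtain b where b: "coeff (w3 mod f) b \<noteq> 0" by (auto simp: poly_eq_iff)
  define c where "c = coeff (w2 mod f) b / coeff (w3 mod f) b"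
  have c: "coeff ((w2 * q) mod f) a = c * coeff ((w3 * q) mod f) a" for a
    using rel[of a b] b by (simp add: c_def field_simps)
  have "(w3 * q) mod f = 0"
  proof (rule ccontr)
    assume "(w3 * q) mod f \<noteq> 0"
    then obtain a where a: "coeff ((w3 * q) mod f) a \<noteq> 0" by (auto simp: poly_eq_iff)
    have "coeff (w2 mod f) b = c * coeff (w3 mod f) b" for b
      using rel[of a b] a by (simp add: c)
    then have "w2 mod f = smult c (w3 mod f)" by (simp add: poly_eq_iff)
    then have "(smult 1 w2 + smult (-c) w3) mod f = 0"
      by (simp add: poly_mod_diff_left mod_smult_left)
    then show False using ind[of 1 "-c"] by (simp add: mod_eq_0_iff_dvd)
  qed
  moreover from this have "(w2 * q) mod f = 0" using c by (simp add: poly_eq_iff)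
  ultimately show "f dvd w2 * q" "f dvd w3 * q" by (simp_all add: mod_eq_0_iff_dvd)
qed

lemma solve_two_by_two:
  fixes a0 a1 b0 b1 c0 c1 :: "'a::field"
  assumes "\<And>a b. a * a0 + b * b0 = 0 \<Longrightarrow> a * a1 + b * b1 = 0 \<Longrightarrow> a = 0 \<and> b = 0"
  obtains a b where "a * a0 + b * b0 = c0" "a * a1 + b * b1 = c1"
proof -
  let ?d = "a0 * b1 - a1 * b0"
  have "?d \<noteq> 0"
  proof
    assume d: "?d = 0"
    have "b1 = 0 \<and> -a1 = 0" by (rule assms) (use d in \<open>simp_all add: algebra_simps\<close>)
    moreover have "b0 = 0 \<and> -a0 = 0" by (rule assms) (use d in \<open>simp_all add: algebra_simps\<close>)
    ultimately show False using assms[of 1 0] by simp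
  qed
  then have "(c0 * b1 - c1 * b0) / ?d * a0 + (a0 * c1 - a1 * c0) / ?d * b0 = c0"
    "(c0 * b1 - c1 * b0) / ?d * a1 + (a0 * c1 - a1 * c0) / ?d * b1 = c1"
    by (simp_all add: divide_simps) algebra+
  then show ?thesis by (rule that)
qed

text \<open>K[x]/q has dimension deg q <= 2 and contains two independent residues.\<close>

lemma pencil_mod_quadratic:
  fixes q :: "'a::field poly"
  assumes dq: "degree q \<le> 2" "q \<noteq> 0"
    and ind: "\<And>a b. q dvd smult a m2 + smult b m3 \<Longrightarrow> a = 0 \<and> b = 0"
  shows "degree q = 2" and "\<exists>a b. q dvd smult a m2 + smult b m3 - g"
proof -
  have md: "(smult a m2 + smult b m3 - smult c g) mod q =
      smult a (m2 mod q) + smult b (m3 mod q) - smult c (g mod q)" for a b c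
    by (simp add: poly_mod_add_left poly_mod_diff_left mod_smult_left)
  have dv: "q dvd p \<longleftrightarrow> p mod q = 0" for p by (simp add: mod_eq_0_iff_dvd)
  have deg: "p mod q = [:coeff (p mod q) 0, coeff (p mod q) 1:]" for p
  proof -
    have "degree (p mod q) < 2 \<or> p mod q = 0"
      using degree_mod_less[of q p] dq by auto
    then show ?thesis
      by (intro poly_eqI) (auto simp: coeff_pCons coeff_eq_0 split: nat.splits)
  qed
  show d2: "degree q = 2"
  proof (rule ccontr)
    assume "degree q \<noteq> 2"
    then have "degree (p mod q) = 0" for p
      using degree_mod_less[of q p] dq by auto
    then have c: "p mod q = [:coeff (p mod q) 0:]" for p
      by (metis degree_0_id)
    let ?a = "coeff (m2 mod q) 0" and ?b = "coeff (m3 mod q) 0"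
    have "(smult ?b m2 + smult (-?a) m3) mod q = smult ?b [:?a:] + smult (-?a) [:?b:]"
      using md[of ?b "-?a" 0] c by simp
    then have "?b = 0 \<and> -?a = 0" by (intro ind) (simp add: dv)
    then have "m2 mod q = 0" using c[of m2] by simp
    then show False using ind[of 1 0] by (simp add: dv)
  qed
  obtain a b where ab: "a * coeff (m2 mod q) 0 + b * coeff (m3 mod q) 0 = coeff (g mod q) 0"
    "a * coeff (m2 mod q) 1 + b * coeff (m3 mod q) 1 = coeff (g mod q) 1"
  proof (rule solve_two_by_two)
    fix a b
    assume "a * coeff (m2 mod q) 0 + b * coeff (m3 mod q) 0 = 0"
      "a * coeff (m2 mod q) 1 + b * coeff (m3 mod q) 1 = 0"
    then have "smult a (m2 mod q) + smult b (m3 mod q) = 0"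
      using deg[of m2] deg[of m3]
      by (metis (no_types, lifting) add_pCons add_0 smult_pCons smult_0_right pCons_0_0)
    then show "a = 0 \<and> b = 0" using md[of a b 0] by (intro ind) (simp add: dv)
  qed
  have "(smult a m2 + smult b m3 - g) mod q = smult a (m2 mod q) + smult b (m3 mod q) - g mod q"
    using md[of a b 1] by simp
  also have "\<dots> = 0"
    by (subst (1) deg[of m2], subst (1) deg[of m3], subst (1) deg[of g]) (simp add: ab[unfolded One_nat_def])
  finally show "\<exists>a b. q dvd smult a m2 + smult b m3 - g" unfolding dv by (intro exI)
qed

text \<open>Write w_i q = f m_i. A combination of m2, m3 divisible by q would give one of w2, w3
  divisible by f; so m2, m3 span K[x]/q. That 1 lies in this span modulo q exhibits f as a multiple
  of q.\<close>

lemma osc_structure_divisor: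
  fixes f q :: "'a::field poly"
  assumes osc: "osc f (f * q) w2 w3" and f: "f \<noteq> 0" and dq: "degree q \<le> 2" "q \<noteq> 0"
    and ind: "\<And>a b. f dvd smult a w2 + smult b w3 \<Longrightarrow> a = 0 \<and> b = 0"
  obtains h m2 m3 where "degree q = 2" "f = q * h" "w2 = h * m2" "w3 = h * m3"
    "\<And>g. \<exists>a b. q dvd smult a m2 + smult b m3 - g"
proof -
  obtain m2 m3 where m: "w2 * q = f * m2" "w3 * q = f * m3"
    using osc_dvd[OF osc f dq(1) ind] by (metis dvdE)
  have ind': "a = 0 \<and> b = 0" if "q dvd smult a m2 + smult b m3" for a b
  proof -
    obtain s where s: "smult a m2 + smult b m3 = q * s" using \<open>q dvd _\<close> by (metis dvdE)
    have "q * (smult a w2 + smult b w3) = f * (smult a m2 + smult b m3)"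
      using m by (simp add: algebra_simps)
    also have "\<dots> = q * (f * s)" by (simp add: s)
    finally have "smult a w2 + smult b w3 = f * s" using dq by simp
    then show ?thesis by (intro ind) simp
  qed
  note pm = pencil_mod_quadratic[where ?m2.0 = m2 and ?m3.0 = m3, OF dq ind']
  obtain a b s where ab: "smult a m2 + smult b m3 - 1 = q * s"
    using pm(2)[of 1] by (auto elim: dvdE)
  have "f = f * (smult a m2 + smult b m3) - q * (f * s)"
    using ab by (simp add: algebra_simps)
  also have "f * (smult a m2 + smult b m3) = q * (smult a w2 + smult b w3)"
    using m by (simp add: algebra_simps)
  finally have "f = q * (smult a w2 + smult b w3 - f * s)"
    by (simp add: right_diff_distrib)
  then obtain h where h: "f = q * h" by blast
  have "w2 = h * m2" "w3 = h * m3"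
    using m dq(2) unfolding h by (auto simp: mult.commute mult.left_commute)
  then show ?thesis using that pm h by blast
qed

section \<open>The roots of the quadratic divisor\<close>

lemma quadratic_factors:
  fixes q :: "'a::alg_closed_field poly"
  assumes "degree q = 2"
  obtains c s t where "c \<noteq> 0" "q = smult c ([:-s, 1:] * [:-t, 1:])"
proof -
  obtain s where s: "poly q s = 0"
    using alg_closed_imp_poly_has_root[of q] assms by auto
  then obtain p where p: "q = [:-s, 1:] * p" by (auto simp: poly_eq_0_iff_dvd elim: dvdE)
  have "p \<noteq> 0" using p assms by auto
  then have dp: "degree p = 1" using assms p by (simp add: degree_mult_eq del: mult_pCons_left)
  then obtain t where "poly p t = 0"
    using alg_closed_imp_poly_has_root[of p] by auto
  then obtain k where k: "p = [:-t, 1:] * k" by (auto simp: poly_eq_0_iff_dvd elim: dvdE)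
  have "k \<noteq> 0" using k \<open>p \<noteq> 0\<close> by auto
  then have "degree k = 0" using dp k by (simp add: degree_mult_eq del: mult_pCons_left)
  then obtain c where c: "k = [:c:]" by (metis degree_0_id)
  have "q = smult c ([:-s, 1:] * [:-t, 1:])"
    unfolding p k c by (simp add: algebra_simps)
  moreover have "c \<noteq> 0" using c \<open>k \<noteq> 0\<close> by auto
  ultimately show ?thesis by (intro that)
qed

lemma order_factor:
  fixes f :: "'a::field poly"
  assumes "f \<noteq> 0"
  obtains g where "f = [:-t, 1:] ^ order t f * g" "poly g t \<noteq> 0"
  using order_decomp[OF assms, of t] by (metis poly_eq_0_iff_dvd)

lemma osc_structure:
  fixes f q :: "'a::{alg_closed_field, field_char_0} poly"
  assumes osc: "osc f (f * q) w2 w3" and f: "f \<noteq> 0" and dq: "degree q \<le> 2" "q \<noteq> 0"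
    and ind: "\<And>a b. f dvd smult a w2 + smult b w3 \<Longrightarrow> a = 0 \<and> b = 0"
  obtains h m2 m3 c s t where "s \<noteq> t" "c \<noteq> 0" "q = smult c ([:-s, 1:] * [:-t, 1:])"
    "f = q * h" "w2 = h * m2" "w3 = h * m3"
    "\<And>g. \<exists>a b. q dvd smult a m2 + smult b m3 - g"
    "\<And>a b z. z \<in> {s, t} \<Longrightarrow> poly (smult a m2 + smult b m3) z = 0 \<Longrightarrow>
       [:-z, 1:] ^ 2 dvd smult a m2 + smult b m3"
proof -
  obtain h m2 m3 where h: "degree q = 2" "f = q * h" "w2 = h * m2" "w3 = h * m3"
    and span: "\<And>g. \<exists>a b. q dvd smult a m2 + smult b m3 - g"
    using osc_structure_divisor[OF osc f dq ind] by metis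
  obtain c s t where c: "c \<noteq> 0" and q: "q = smult c ([:-s, 1:] * [:-t, 1:])"
    using quadratic_factors[OF h(1)] by metis
  have osc': "osc f (h * (smult a m2 + smult b m3)) (h * (smult a' m2 + smult b' m3)) (f * q)" for a b a' b'
    by (rule osc_combination[OF osc, of _ 0 a b _ 0 a' b' _ 1 0 0])
      (simp_all add: h algebra_simps)
  have "h \<noteq> 0" using f h by auto
  have qd: "[:-z, 1:] dvd q" if "z \<in> {s, t}" for z
    using that unfolding q by (auto simp del: mult_pCons_left mult_pCons_right intro!: dvd_smult)
  have "s \<noteq> t"
  proof
    assume [simp]: "s = t"
    let ?l = "[:-t, 1:]"
    have q2: "q = ?l ^ 2 * [:c:]" unfolding q by (simp add: power2_eq_square algebra_simps)
    obtain g where g: "h = ?l ^ order t h * g" "poly g t \<noteq> 0" by (rule order_factor[OF \<open>h \<noteq> 0\<close>])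
    \<comment> \<open>Members congruent to 1 and to x - t modulo q. Times h they have orders r and r
      + 1, where r is the order of h, and f q = h q^2 has order r + 4. Since f has order r + 2, the
      balance (r + 1) + (r + 4) = 2 (r + 2) + 1 holds and the local lemma is violated.\<close>
    obtain a b k where 1: "smult a m2 + smult b m3 - 1 = q * k" using span[of 1] by (auto elim: dvdE)
    obtain a' b' k' where 2: "smult a' m2 + smult b' m3 - ?l = q * k'" using span[of ?l] by (auto elim: dvdE)
    let ?r = "order t h"
    have 1: "smult a m2 + smult b m3 = 1 + q * k" and 2: "smult a' m2 + smult b' m3 = ?l + q * k'"
      using 1 2 by (simp_all add: algebra_simps)
    have e1: "h * (1 + q * k) = ?l ^ ?r * (g * (1 + q * k))"
      by (subst (1) g(1)) (simp only: mult.assoc)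
    have e2: "h * (?l + q * k') = ?l ^ (?r + 1) * (g * (1 + ?l * ([:c:] * k')))"
      by (subst (1) g(1), subst q2) (simp add: power2_eq_square algebra_simps del: mult_pCons_left mult_pCons_right)
    have e3: "f * q = ?l ^ (?r + 4) * (g * [:c:] * [:c:])"
      by (subst h(2), subst (1) g(1), subst (1 2) q2)
        (simp add: power_add power2_eq_square power4_eq_xxxx mult_ac del: mult_pCons_left mult_pCons_right)
    have "poly (g * (1 + q * k)) t = 0 \<or> poly (g * (1 + ?l * ([:c:] * k'))) t = 0 \<or> poly (g * [:c:] * [:c:]) t = 0"
    proof (rule osc_local_at)
      show "osc f (?l ^ ?r * (g * (1 + q * k))) (?l ^ (?r + 1) * (g * (1 + ?l * ([:c:] * k'))))
          (?l ^ (?r + 4) * (g * [:c:] * [:c:]))"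
        using osc'[of a b a' b'] unfolding 1 2 e1 e2 e3 .
      have "?l ^ 2 * ?l ^ ?r dvd q * h"
        using q2 by (intro mult_dvd_mono order_1) (rule dvdI)
      then show "?l ^ (?r + 2) dvd f"
        by (simp only: h(2) power_add mult.commute)
    qed auto
    then show False using g(2) c by (auto simp: q2)
  qed
  have local: "[:-z, 1:] ^ 2 dvd smult a m2 + smult b m3"
    if z: "z \<in> {s, t}" and root: "poly (smult a m2 + smult b m3) z = 0" for a b z
  proof -
    let ?l = "[:-z, 1:]"
    obtain p where q1: "q = ?l * p" and p: "poly p z \<noteq> 0"
    proof (cases "z = s")
      case True
      show ?thesis by (rule that[of "smult c [:-t, 1:]"]) (use True q c \<open>s \<noteq> t\<close> in \<open>auto simp: algebra_simps\<close>)
    next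
      case False
      with z have "z = t" by auto
      then show ?thesis by (intro that[of "smult c [:-s, 1:]"]) (use q c \<open>s \<noteq> t\<close> in \<open>auto simp: algebra_simps\<close>)
    qed
    obtain g where g: "h = ?l ^ order z h * g" "poly g z \<noteq> 0" by (rule order_factor[OF \<open>h \<noteq> 0\<close>])
    let ?r = "order z h"
    \<comment> \<open>Here z is a simple root of q, so f has order r + 1 and f q = h q^2 has order r
      + 2, where r is the order of h. The member vanishing at z supplies a factor (x - z)^(r + 1),
      and the balance (r + 1) + (r + 2) = 2 (r + 1) + 1 forces its cofactor to vanish too.\<close>
    obtain a' b' k where "smult a' m2 + smult b' m3 - 1 = q * k" using span[of 1] by (auto elim: dvdE)
    then have 1: "smult a' m2 + smult b' m3 = 1 + q * k" by (simp add: algebra_simps)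
    obtain m where m: "smult a m2 + smult b m3 = ?l * m"
      using root by (auto simp: poly_eq_0_iff_dvd simp del: poly_add poly_smult elim: dvdE)
    have e1: "h * (1 + q * k) = ?l ^ ?r * (g * (1 + q * k))"
      by (subst (1) g(1)) (simp only: mult.assoc)
    have e2: "h * (?l * m) = ?l ^ (?r + 1) * (g * m)"
      by (subst (1) g(1)) (simp add: mult_ac del: mult_pCons_left mult_pCons_right)
    have e3: "f * q = ?l ^ (?r + 2) * (g * p * p)"
      by (subst h(2), subst (1) g(1), subst (1 2) q1)
        (simp add: power_add power2_eq_square mult_ac del: mult_pCons_left mult_pCons_right)
    have "poly (g * (1 + q * k)) z = 0 \<or> poly (g * m) z = 0 \<or> poly (g * p * p) z = 0"
    proof (rule osc_local_at)
      show "osc f (?l ^ ?r * (g * (1 + q * k))) (?l ^ (?r + 1) * (g * m)) (?l ^ (?r + 2) * (g * p * p))"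
        using osc'[of a' b' a b] unfolding 1 m e1 e2 e3 .
      have "?l ^ 1 * ?l ^ ?r dvd q * h"
        using q1 by (intro mult_dvd_mono order_1) (simp only: power_one_right dvd_triv_left)
      then show "?l ^ (?r + 1) dvd f"
        by (simp only: h(2) power_add mult.commute)
    qed auto
    then have "poly m z = 0" using g(2) p by (auto simp: q1)
    then obtain m' where "m = ?l * m'" by (auto simp: poly_eq_0_iff_dvd elim: dvdE)
    then show ?thesis unfolding m by (simp add: power2_eq_square mult.assoc del: mult_pCons_left mult_pCons_right)
  qed
  show ?thesis by (rule that[OF \<open>s \<noteq> t\<close> c q h(2-4) span local])
qed

lemma osc_pencil:
  fixes f u :: "'a::field_char_0 poly"
  assumes osc: "osc f u (f * q1) (f * q2)" and f: "f \<noteq> 0"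
    and u: "\<not> [:-t, 1:] ^ order t f dvd u"
    and dq: "degree q1 \<le> 2" "degree q2 \<le> 2"
    and ind: "\<And>a b. smult a q1 + smult b q2 = 0 \<Longrightarrow> a = 0 \<and> b = 0"
  shows "\<exists>a b. [:-t, 1:] ^ 2 = smult a q1 + smult b q2"
proof (cases "poly q1 t = 0 \<and> poly q2 t = 0")
  case True
  \<comment> \<open>The whole pencil vanishes at t; divided by x - t it is two-dimensional in the
    linear polynomials, hence contains x - t itself.\<close>
  obtain l1 l2 where l: "q1 = [:-t, 1:] * l1" "q2 = [:-t, 1:] * l2"
    using True by (auto simp: poly_eq_0_iff_dvd elim!: dvdE)
  have deg: "degree l \<le> 1" if "degree ([:-t, 1:] * l) \<le> 2" for l
    using that by (cases "l = 0") (simp_all add: degree_mult_eq del: mult_pCons_left)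
  have lc: "l = [:coeff l 0, coeff l 1:]" if "degree l \<le> 1" for l :: "'a poly"
    using that by (intro poly_eqI) (auto simp: coeff_pCons coeff_eq_0 split: nat.splits)
  note l1 = lc[OF deg[OF dq(1)[unfolded l]]] and l2 = lc[OF deg[OF dq(2)[unfolded l]]]
  obtain a b where ab: "a * coeff l1 0 + b * coeff l2 0 = -t" "a * coeff l1 1 + b * coeff l2 1 = 1"
  proof (rule solve_two_by_two)
    fix a b assume *: "a * coeff l1 0 + b * coeff l2 0 = 0" "a * coeff l1 1 + b * coeff l2 1 = 0"
    have "smult a l1 + smult b l2 = 0"
      by (subst l1, subst l2) (simp add: *[unfolded One_nat_def])
    then have "[:-t, 1:] * (smult a l1 + smult b l2) = 0" by (simp only: mult_zero_right)
    then show "a = 0 \<and> b = 0"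
      by (intro ind) (simp add: l distrib_left del: mult_pCons_left)
  qed
  have "smult a l1 + smult b l2 = [:-t, 1:]"
    by (subst l1, subst l2) (simp add: ab[unfolded One_nat_def])
  then have "[:-t, 1:] ^ 2 = [:-t, 1:] * (smult a l1 + smult b l2)"
    by (simp only: power2_eq_square)
  also have "\<dots> = smult a q1 + smult b q2"
    by (simp add: l distrib_left del: mult_pCons_left)
  finally show ?thesis by blast
next
  case False
  let ?l = "[:-t, 1:]"
  define x y where "x = poly q1 t" and "y = poly q2 t"
  obtain a' b' where ab': "poly (smult a' q1 + smult b' q2) t \<noteq> 0"
    using False that[of 1 0] that[of 0 1] by auto
  \<comment> \<open>The member \<open>?qb\<close> vanishes at t and \<open>?qa\<close> does not, so
    f times them has orders r and at least r + 1, against an order below r for u. The local lemma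
    makes t a double root of \<open>?qb\<close>, and the degree bound leaves only a multiple of (x -
    t)^2.\<close>
  let ?qa = "smult a' q1 + smult b' q2" and ?qb = "smult y q1 + smult (-x) q2"
  have "poly ?qb t = 0" by (simp add: x_def y_def)
  then obtain qb where qb: "?qb = ?l * qb"
    unfolding poly_eq_0_iff_dvd dvd_def by blast
  have "?qb \<noteq> 0" using ind[of y "-x"] False by (auto simp: x_def y_def)
  obtain g where g: "f = ?l ^ order t f * g" "poly g t \<noteq> 0" by (rule order_factor[OF f])
  have "u \<noteq> 0" using u by auto
  obtain k where k: "u = ?l ^ order t u * k" "poly k t \<noteq> 0" by (rule order_factor[OF \<open>u \<noteq> 0\<close>])
  have lt: "order t u < order t f"
  proof (rule ccontr)
    assume "\<not> order t u < order t f"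
    then show False using u by (metis dvd_trans le_imp_power_dvd not_less order_1)
  qed
  have "poly k t = 0 \<or> poly (g * ?qa) t = 0 \<or> poly (g * qb) t = 0"
  proof (rule osc_local_at)
    have 1: "?l ^ order t f * (g * ?qa) = f * ?qa"
      by (subst (2) g(1)) (simp only: mult.assoc)
    have 2: "?l ^ (order t f + 1) * (g * qb) = f * ?qb"
      unfolding qb by (subst (2) g(1)) (simp add: mult_ac del: mult_pCons_left mult_pCons_right)
    have "osc f u (f * ?qa) (f * ?qb)"
      by (rule osc_combination[OF osc, of _ 1 0 0 _ 0 a' b' _ 0 y "-x"]) (simp_all add: algebra_simps)
    then show "osc f (?l ^ order t u * k) (?l ^ order t f * (g * ?qa)) (?l ^ (order t f + 1) * (g * qb))"
      unfolding 1 2 k(1)[symmetric] .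
    show "?l ^ order t f dvd f" by (rule order_1)
  qed (use lt in auto)
  then have "poly qb t = 0" using k(2) g(2) ab' by auto
  then obtain m where "qb = ?l * m" by (auto simp: poly_eq_0_iff_dvd elim: dvdE)
  then have m: "?qb = ?l ^ 2 * m" using qb by (simp only: power2_eq_square mult.assoc)
  have "m \<noteq> 0" using m \<open>?qb \<noteq> 0\<close> by auto
  have "degree ?qb \<le> 2" using dq by (intro degree_add_le) (auto intro: order_trans[OF degree_smult_le])
  then have "degree m = 0"
    unfolding m using \<open>m \<noteq> 0\<close> by (simp add: degree_mult_eq degree_power_eq)
  then obtain c where c: "m = [:c:]" by (metis degree_0_id)
  with \<open>m \<noteq> 0\<close> have "c \<noteq> 0" by auto
  have "?l ^ 2 = smult (1 / c) (?l ^ 2 * m)" using \<open>c \<noteq> 0\<close> by (simp add: c)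
  also have "\<dots> = smult (y / c) q1 + smult (- x / c) q2"
    unfolding m[symmetric] by (simp add: smult_diff_right)
  finally show ?thesis by blast
qed

section \<open>Dehomogenisation of binary forms\<close>

text \<open>Substitution of (U, V) into the binary form of degree m with coefficients P. The degree
  m is kept apart from that of P, which drops when the form has a root at infinity.\<close>

definition homog :: "nat \<Rightarrow> 'a::field poly \<Rightarrow> 'a poly \<Rightarrow> 'a poly \<Rightarrow> 'a poly" where
  "homog m P U V = (\<Sum>i\<le>m. smult (coeff P i) (U ^ (m - i) * V ^ i))"

lemma smult_sum_right: "smult c (\<Sum>i\<in>I. f i) = (\<Sum>i\<in>I. smult c (f i))"
  by (induction I rule: infinite_finite_induct) (simp_all add: smult_add_right)

lemma homog_zero [simp]: "homog m 0 U V = 0"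
  and homog_add: "homog m (P + Q) U V = homog m P U V + homog m Q U V"
  and homog_smult: "homog m (smult c P) U V = smult c (homog m P U V)"
  by (simp_all add: homog_def smult_add_left sum.distrib smult_sum_right)

lemma homog_sum: "homog m (\<Sum>i\<in>I. P i) U V = (\<Sum>i\<in>I. homog m (P i) U V)"
  by (induction I rule: infinite_finite_induct) (simp_all add: homog_add)

lemma homog_pCons: "homog (Suc m) (pCons a p) U V = smult a (U ^ Suc m) + V * homog m p U V"
  unfolding homog_def
  by (subst sum.atMost_Suc_shift) (simp add: sum_distrib_left mult_ac)

lemma homog_Suc: "degree p \<le> m \<Longrightarrow> homog (Suc m) p U V = U * homog m p U V"
  by (simp add: homog_def sum_distrib_left coeff_eq_0 Suc_diff_le mult_ac)

lemma homog_mult: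
  assumes "degree P \<le> m" "degree Q \<le> k"
  shows "homog (m + k) (P * Q) U V = homog m P U V * homog k Q U V"
  using assms(1)
proof (induction m arbitrary: P)
  case 0
  then obtain a where "P = [:a:]" by (metis degree_0_id le_zero_eq)
  then show ?case by (simp add: homog_smult) (simp add: homog_def)
next
  case (Suc m)
  obtain a p where P: "P = pCons a p" by (cases P) auto
  have p: "degree p \<le> m" using Suc.prems P by (auto split: if_splits)
  have up: "homog (i + k) Q U V = U ^ i * homog k Q U V" for i
    using assms(2) by (induction i) (simp_all add: homog_Suc)
  have "homog (Suc m + k) (P * Q) U V = homog (Suc m + k) (smult a Q) U V + homog (Suc (m + k)) (pCons 0 (p * Q)) U V"
    by (simp add: P homog_add)
  also have "\<dots> = smult a (U ^ Suc m * homog k Q U V) + V * (homog m p U V * homog k Q U V)"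
    unfolding homog_pCons Suc.IH[OF p] homog_smult up by simp
  also have "\<dots> = homog (Suc m) P U V * homog k Q U V"
    unfolding P homog_pCons by (simp add: algebra_simps)
  finally show ?case .
qed

lemma homog_one: "homog 0 1 U V = 1"
  by (simp add: homog_def)

lemma degree_power_linear: "degree (A ^ k) \<le> k" if "degree A \<le> 1" for A :: "'a::field poly"
proof -
  have "degree (A ^ k) \<le> degree A * k" by (rule degree_power_le)
  also have "\<dots> \<le> 1 * k" using that by (rule mult_le_mono1)
  finally show ?thesis by simp
qed

lemma homog_power: "degree A \<le> 1 \<Longrightarrow> homog k (A ^ k) U V = homog 1 A U V ^ k"
proof (induction k)
  case (Suc k)
  have "degree (A ^ k) \<le> k"
    using Suc.prems by (rule degree_power_linear)
  then have "homog (1 + k) (A * A ^ k) U V = homog 1 A U V * homog k (A ^ k) U V"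
    using Suc.prems by (intro homog_mult)
  then show ?case using Suc by simp
qed (simp add: homog_one)

lemma degree_homog_le:
  assumes "degree U \<le> 1" "degree V \<le> 1"
  shows "degree (homog m P U V) \<le> m"
  unfolding homog_def
proof (intro degree_sum_le)
  fix i assume "i \<in> {..m}"
  have "degree (U ^ (m - i) * V ^ i) \<le> (m - i) + i"
    using degree_mult_le[of "U ^ (m - i)" "V ^ i"] degree_power_linear[OF assms(1), of "m - i"]
      degree_power_linear[OF assms(2), of i] by linarith
  with \<open>i \<in> {..m}\<close> show "degree (smult (coeff P i) (U ^ (m - i) * V ^ i)) \<le> m"
    by (intro order_trans[OF degree_smult_le]) simp
qed simp

text \<open>Linear substitutions compose: \<open>homog 1 A U V\<close> is the linear form A at (U,
  V).\<close>

lemma homog_homog: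
  assumes "degree A \<le> 1" "degree B \<le> 1"
  shows "homog m (homog m P A B) U V = homog m P (homog 1 A U V) (homog 1 B U V)"
proof -
  have "homog m (A ^ (m - i) * B ^ i) U V = homog 1 A U V ^ (m - i) * homog 1 B U V ^ i" if "i \<le> m" for i
    using homog_mult[OF degree_power_linear[OF assms(1)] degree_power_linear[OF assms(2)], of "m - i" i U V]
      homog_power[OF assms(1), of "m - i" U V] homog_power[OF assms(2), of i U V] that by simp
  then show ?thesis
    unfolding homog_def[of m P] homog_sum homog_smult by (intro sum.cong) auto
qed

definition vpoly :: "nat \<Rightarrow> (nat \<Rightarrow> 'a::field) \<Rightarrow> 'a poly" where
  "vpoly m l = (\<Sum>j\<le>m. monom (l j) j)"

lemma coeff_vpoly: "coeff (vpoly m l) i = (if i \<le> m then l i else 0)"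
  by (simp add: vpoly_def coeff_sum)

text \<open>The binary form \<open>\<Sum> l\<^sub>j s\<^bsup>m-j\<^esup> t\<^bsup>j\<^esup>\<close> on the affine line \<open>x \<mapsto> (x, 1 + \<tau> x)\<close>, which omits only the
  point \<open>(1, \<tau>)\<close>.\<close>

definition dehom :: "'a::field \<Rightarrow> nat \<Rightarrow> (nat \<Rightarrow> 'a) \<Rightarrow> 'a poly" where
  "dehom \<tau> m l = homog m (vpoly m l) [:0, 1:] [:1, \<tau>:]"

lemma dehom_sum: "dehom \<tau> m l = (\<Sum>j\<le>m. smult (l j) ([:0, 1:] ^ (m - j) * [:1, \<tau>:] ^ j))"
  by (simp add: dehom_def homog_def coeff_vpoly)

lemma degree_dehom: "degree (dehom \<tau> m l) \<le> m"
  unfolding dehom_def by (intro degree_homog_le) auto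

lemma dehom_combination:
  "dehom \<tau> m (\<lambda>x. a * l x + b * l' x) = smult a (dehom \<tau> m l) + smult b (dehom \<tau> m l')"
  by (simp add: dehom_sum smult_add_left sum.distrib smult_sum_right)

text \<open>The top coefficient is the value of the form at the omitted point, so it decides whether
  the degree drops.\<close>

lemma coeff_dehom_top: "coeff (dehom \<tau> m l) m = poly (vpoly m l) \<tau>"
proof -
  have "coeff ([:0, 1:] ^ (m - j) * [:1, \<tau>:] ^ j) m = \<tau> ^ j" if "j \<le> m" for j
  proof -
    have x: "[:0, 1:] ^ (m - j) = (monom 1 (m - j) :: 'a poly)" by (simp add: monom_altdef)
    have "coeff ([:1, \<tau>:] ^ j) j = \<tau> ^ j"
    proof (induction j)
      case (Suc j)
      have "degree ([:1, \<tau>:] ^ j) \<le> j" by (rule degree_power_linear) simp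
      then show ?case using Suc by (simp add: coeff_eq_0)
    qed simp
    then show ?thesis using that by (simp add: x coeff_monom_mult)
  qed
  then show ?thesis
    by (simp add: dehom_sum coeff_sum vpoly_def poly_sum poly_monom)
qed

lemma homog_dehom:
  "homog m (dehom \<tau> m l) [:u0, u1:] V = homog m (vpoly m l) V ([:u0, u1:] + smult \<tau> V)"
  unfolding dehom_def by (subst homog_homog) (simp_all add: homog_def)

lemma homog_identity: "degree p \<le> m \<Longrightarrow> homog m p 1 [:0, 1:] = p"
  by (rule poly_eqI) (auto simp: homog_def coeff_sum coeff_eq_0 if_distrib cong: if_cong
      simp flip: monom_altdef[of 1, simplified])

text \<open>The substitution U = x - \<tau>, V = 1 undoes the choice of the line, since U + \<tau> V
  = x.\<close>

lemma dehom_inject: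
  assumes "dehom \<tau> m l = dehom \<tau> m l'" "i \<le> m"
  shows "l i = l' i"
proof -
  have "homog m (dehom \<tau> m l) [:-\<tau>, 1:] 1 = homog m (vpoly m l) 1 [:0, 1:]" for l
    by (subst homog_dehom) (simp add: one_pCons)
  moreover have "degree (vpoly m l) \<le> m" for l :: "nat \<Rightarrow> 'a"
    by (rule degree_le) (simp add: coeff_vpoly)
  ultimately have "vpoly m l = vpoly m l'"
    using assms by (metis homog_identity)
  then have "coeff (vpoly m l) i = coeff (vpoly m l') i" by simp
  then show ?thesis using assms(2) by (simp add: coeff_vpoly)
qed

text \<open>Shifting a row by j multiplies its binary form by s^(2-j) t^j. The three equations of
  \<open>phi n u\<close> thus become the form of u times a basis of the binary quadratic
  forms.\<close>

lemma dehom_shiftrow: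
  assumes "lf n a" "j \<le> 2"
  shows "dehom \<tau> (n + 2) (shiftrow n a j) = dehom \<tau> n a * ([:0, 1:] ^ (2 - j) * [:1, \<tau>:] ^ j)"
proof -
  have v: "vpoly (n + 2) (shiftrow n a j) = vpoly n a * monom 1 j"
  proof (rule poly_eqI)
    fix i
    show "coeff (vpoly (n + 2) (shiftrow n a j)) i = coeff (vpoly n a * monom 1 j) i"
      using assms by (auto simp: mult.commute[of _ "monom _ _"] coeff_monom_mult coeff_vpoly shiftrow_def)
  qed
  have "homog 2 (monom 1 j) A B = A ^ (2 - j) * B ^ j" for A B :: "'a poly"
  proof -
    have "homog 2 (monom 1 j) A B = (\<Sum>i\<le>2. if i = j then A ^ (2 - j) * B ^ j else 0)"
      unfolding homog_def by (intro sum.cong) auto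
    then show ?thesis using assms(2) by simp
  qed
  moreover have "degree (vpoly n a) \<le> n" by (rule degree_le) (simp add: coeff_vpoly)
  moreover have "degree (monom (1::'a) j) \<le> 2" using assms(2) by (simp add: degree_monom_eq)
  ultimately show ?thesis unfolding dehom_def v by (simp only: homog_mult)
qed

section \<open>Orders of vanishing in the affine coordinate\<close>

lemma pullback_homog:
  "pullback n l p = homog (n + 2) (vpoly (n + 2) l) [:fst p, fst (dirv p):] [:snd p, snd (dirv p):]"
  unfolding pullback_def homog_def
  by (rule sum.cong) (auto simp: coeff_vpoly)

lemma linear_power_dvd_iff:
  fixes p :: "'a::field poly"
  assumes "p = [:-a, 1:] ^ k * g" "poly g a \<noteq> 0"
  shows "[:-a, 1:] ^ m dvd p \<longleftrightarrow> m \<le> k"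
proof -
  have "g \<noteq> 0" using assms(2) by auto
  then have "order a p = k"
    using assms by (simp add: order_mult order_power_n_n order_root)
  moreover have "p \<noteq> 0" using assms \<open>g \<noteq> 0\<close> by simp
  ultimately show ?thesis by (simp add: order_divides)
qed

text \<open>The x for which (x, 1 + \<tau> x) is proportional to y; the denominator vanishes only at
  the omitted point.\<close>

definition pcoord :: "'a::field \<Rightarrow> 'a \<times> 'a \<Rightarrow> 'a" where
  "pcoord \<tau> y = fst y / (snd y - \<tau> * fst y)"

lemma ord_ge_iff_dehom:
  fixes y :: "'a::field \<times> 'a"
  assumes y: "snd y \<noteq> \<tau> * fst y"
  shows "ord_ge n l y m \<longleftrightarrow> [:- pcoord \<tau> y, 1:] ^ m dvd dehom \<tau> (n + 2) l"
proof -
  define c where "c = snd y - \<tau> * fst y"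
  define e where "e = dirv y"
  define F where "F = dehom \<tau> (n + 2) l"
  let ?z = "pcoord \<tau> y"
  have "c \<noteq> 0" using y by (simp add: c_def)
  have z: "?z = fst y / c" by (simp add: pcoord_def c_def)
  let ?U = "[:c, snd e - \<tau> * fst e:]" and ?V = "[:fst y, fst e:]"
  have pb: "pullback n l y = homog (n + 2) F ?U ?V"
    unfolding F_def homog_dehom pullback_homog by (simp add: c_def e_def)
  show ?thesis
  proof (cases "F = 0")
    case True
    then show ?thesis unfolding ord_ge_def pb F_def[symmetric] by simp
  next
    case False
    obtain g where g: "F = [:-?z, 1:] ^ order ?z F * g" "poly g ?z \<noteq> 0" by (rule order_factor[OF False])
    let ?k = "order ?z F"
    have "g \<noteq> 0" using g(2) by auto
    have "degree F = ?k + degree g"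
      by (subst g(1)) (use \<open>g \<noteq> 0\<close> in \<open>simp add: degree_mult_eq degree_power_eq\<close>)
    moreover have "degree F \<le> n + 2" unfolding F_def by (rule degree_dehom)
    ultimately have dk: "degree g \<le> n + 2 - ?k" "?k + (n + 2 - ?k) = n + 2" by auto
    have "pullback n l y = homog ?k ([:-?z, 1:] ^ ?k) ?U ?V * homog (n + 2 - ?k) g ?U ?V"
      using homog_mult[OF degree_power_linear dk(1), of "[:-?z, 1:]" ?k ?U ?V]
      unfolding pb dk(2) g(1)[symmetric] by simp
    also have "homog ?k ([:-?z, 1:] ^ ?k) ?U ?V = (?V - smult ?z ?U) ^ ?k"
      by (subst homog_power) (simp_all add: homog_def)
    finally have p: "pullback n l y = (?V - smult ?z ?U) ^ ?k * homog (n + 2 - ?k) g ?U ?V" .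
    \<comment> \<open>Under the change of coordinate the factor x - z becomes V - z U. This is
      \<delta> times the local parameter, and \<delta> is nonzero because \<open>dirv y\<close> is
      not proportional to y.\<close>
    define \<delta> where "\<delta> = fst e - ?z * (snd e - \<tau> * fst e)"
    have V: "?V - smult ?z ?U = smult \<delta> [:0, 1:]"
      using \<open>c \<noteq> 0\<close> by (simp add: \<delta>_def z)
    have "c * \<delta> = snd y * fst e - fst y * snd e"
      using \<open>c \<noteq> 0\<close> by (simp add: \<delta>_def z c_def[symmetric] field_simps) (simp add: c_def algebra_simps)
    also have "\<dots> \<noteq> 0" using y by (auto simp: e_def dirv_def)
    finally have "\<delta> \<noteq> 0" by auto
    let ?G = "homog (n + 2 - ?k) g ?U ?V"
    have scale: "c ^ (N - i) * b ^ i = c ^ N * (b / c) ^ i" if "i \<le> N" for N i b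
    proof -
      have "c ^ N = c ^ (N - i) * c ^ i" using that by (simp flip: power_add)
      then show ?thesis using \<open>c \<noteq> 0\<close> by (simp add: power_divide)
    qed
    \<comment> \<open>At 0 the pair (U, V) is (c, fst y) = c (1, z), so the cofactor takes the value
      g(z) up to a power of c.\<close>
    have "poly ?G 0 = (\<Sum>i\<le>n + 2 - ?k. coeff g i * (c ^ (n + 2 - ?k - i) * fst y ^ i))"
      by (simp add: homog_def poly_sum)
    also have "\<dots> = (\<Sum>i\<le>n + 2 - ?k. c ^ (n + 2 - ?k) * (coeff g i * ?z ^ i))"
      unfolding z by (intro sum.cong refl) (simp only: scale atMost_iff mult.left_commute)
    also have "\<dots> = c ^ (n + 2 - ?k) * poly g ?z"
    proof -
      have "poly g ?z = (\<Sum>i\<le>n + 2 - ?k. coeff g i * ?z ^ i)"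
        unfolding poly_altdef using dk(1) by (intro sum.mono_neutral_left) (auto simp: coeff_eq_0)
      then show ?thesis by (simp only: sum_distrib_left)
    qed
    also have "\<dots> \<noteq> 0" using \<open>c \<noteq> 0\<close> g(2) by simp
    finally have "poly ?G 0 \<noteq> 0" .
    then have "poly (smult (\<delta> ^ ?k) ?G) 0 \<noteq> 0" using \<open>\<delta> \<noteq> 0\<close> by simp
    moreover have "pullback n l y = [:-0, 1:] ^ ?k * smult (\<delta> ^ ?k) ?G"
      unfolding p V smult_power minus_zero by (simp only: mult_smult_left mult_smult_right)
    ultimately have "[:-0, 1:] ^ m dvd pullback n l y \<longleftrightarrow> m \<le> ?k"
      by (intro linear_power_dvd_iff)
    then show ?thesis
      using linear_power_dvd_iff[OF g] by (simp add: ord_ge_def F_def)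
  qed
qed

lemma not_ord_ge_at_infinity:
  fixes y :: "'a::field \<times> 'a"
  assumes y: "snd y = \<tau> * fst y" "y \<noteq> (0, 0)" and l: "poly (vpoly (n + 2) l) \<tau> \<noteq> 0" and "m > 0"
  shows "\<not> ord_ge n l y m"
proof
  assume "ord_ge n l y m"
  then have "[:0, 1:] dvd pullback n l y"
    using \<open>m > 0\<close> unfolding ord_ge_def by (metis dvd_power dvd_trans)
  then have "poly (pullback n l y) 0 = 0" by (auto elim: dvdE)
  moreover have "poly (pullback n l y) 0 = (\<Sum>j\<le>n + 2. l j * (fst y ^ (n + 2 - j) * (\<tau> * fst y) ^ j))"
    unfolding pullback_homog by (simp add: homog_def poly_sum coeff_vpoly y(1))
  also have "\<dots> = (\<Sum>j\<le>n + 2. fst y ^ (n + 2) * (l j * \<tau> ^ j))"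
  proof (intro sum.cong refl)
    fix j assume "j \<in> {..n + 2}"
    then have "fst y ^ (n + 2) = fst y ^ (n + 2 - j) * fst y ^ j"
      by (simp flip: power_add)
    then show "l j * (fst y ^ (n + 2 - j) * (\<tau> * fst y) ^ j) = fst y ^ (n + 2) * (l j * \<tau> ^ j)"
      by (simp add: power_mult_distrib mult_ac)
  qed
  also have "\<dots> = fst y ^ (n + 2) * poly (vpoly (n + 2) l) \<tau>"
    unfolding vpoly_def poly_sum poly_monom sum_distrib_left ..
  moreover have "fst y \<noteq> 0" using y by (cases y) auto
  ultimately show False using l by simp
qed

section \<open>From Pluecker coordinates to wedges of polynomials\<close>

lemma det3_triple_sum:
  fixes I :: "nat set"
  shows "det3 (\<Sum>i\<in>I. a i * p i) (\<Sum>i\<in>I. b i * p i) (\<Sum>i\<in>I. c i * p i)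
      (\<Sum>i\<in>I. a i * q i) (\<Sum>i\<in>I. b i * q i) (\<Sum>i\<in>I. c i * q i)
      (\<Sum>i\<in>I. a i * r i) (\<Sum>i\<in>I. b i * r i) (\<Sum>i\<in>I. c i * r i)
    = (\<Sum>i\<in>I. \<Sum>j\<in>I. \<Sum>k\<in>I. a i * b j * c k * det3 (p i) (p j) (p k) (q i) (q j) (q k) (r i) (r j) (r k))"
proof -
  have t: "(\<Sum>i\<in>I. a i * x i) * ((\<Sum>i\<in>I. b i * y i) * (\<Sum>i\<in>I. c i * z i)) =
      (\<Sum>i\<in>I. \<Sum>j\<in>I. \<Sum>k\<in>I. a i * b j * c k * (x i * (y j * z k)))" for x y z :: "nat \<Rightarrow> 'a"
  proof -
    have "(\<Sum>i\<in>I. a i * x i) * ((\<Sum>i\<in>I. b i * y i) * (\<Sum>i\<in>I. c i * z i)) =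
        (\<Sum>i\<in>I. a i * x i * (\<Sum>j\<in>I. \<Sum>k\<in>I. b j * y j * (c k * z k)))"
      by (subst sum_product[of "\<lambda>i. b i * y i" I "\<lambda>i. c i * z i"]) (rule sum_distrib_right)
    then show ?thesis
      unfolding sum_distrib_left by (simp only: mult_ac)
  qed
  have e: "det3 pa pb pc qa qb qc ra rb rc = pa * (qb * rc) - pa * (rb * qc) - qa * (pb * rc)
      + ra * (pb * qc) + qa * (rb * pc) - ra * (qb * pc)" for pa pb pc qa qb qc ra rb rc :: 'a
    by (simp add: det3_def algebra_simps)
  show ?thesis
    unfolding e t by (simp only: sum_subtractf sum.distrib right_diff_distrib distrib_left)
qed

text \<open>Pluecker coordinates are recorded for i < j < k only, whereas the expansion of a wedge
  runs over all triples of indices.\<close>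

lemma antisymmetric_eq_0:
  fixes D :: "nat \<Rightarrow> nat \<Rightarrow> nat \<Rightarrow> 'a::field_char_0"
  assumes s: "\<And>i j k. D j i k = - D i j k" "\<And>i j k. D i k j = - D i j k"
    and z: "\<And>i j k. i < j \<Longrightarrow> j < k \<Longrightarrow> k < N \<Longrightarrow> D i j k = 0"
    and "i < N" "j < N" "k < N"
  shows "D i j k = 0"
proof -
  have e1: "D i i k = 0" for i k using s(1)[of i i k] by simp
  have e2: "D i k k = 0" for i k using s(2)[of i k k] by simp
  have e3: "D i k i = 0" for i k using s(1)[of k i i] e2 by simp
  have p: "D j i k = 0 \<longleftrightarrow> D i j k = 0" "D i k j = 0 \<longleftrightarrow> D i j k = 0" for i j k
    using s by (metis neg_equal_0_iff_equal)+
  consider "i = j" | "j = k" | "i = k" | "i < j \<and> j < k" | "i < k \<and> k < j" | "j < i \<and> i < k"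
    | "j < k \<and> k < i" | "k < i \<and> i < j" | "k < j \<and> j < i" by linarith
  then show ?thesis
    using assms(4-6) by cases (auto simp: e1 e2 e3 z intro: p(1)[THEN iffD1] p(2)[THEN iffD1] dest: z simp: p)
qed

text \<open>Contracting a Pluecker vector with the values of three functionals on the coordinate
  forms gives a wedge of polynomials. The contraction is linear, so a combination of
  \<open>psi3\<close> vectors passes to a combination of symmetrised wedges.\<close>

lemma in_O2_osc:
  fixes u u1 u2 u3 :: "nat \<Rightarrow> 'a::field_char_0"
  assumes u: "lf n u"
    and pl: "plk n u1 u2 u3 \<in> lspan {psi3 n u v w | v w. lf n v \<and> lf n w}"
  shows "osc (dehom \<tau> n u) (dehom \<tau> (n + 2) u1) (dehom \<tau> (n + 2) u2) (dehom \<tau> (n + 2) u3)"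
proof -
  obtain M c where M: "finite M" "M \<subseteq> {psi3 n u v w | v w. lf n v \<and> lf n w}"
    and pM: "plk n u1 u2 u3 = (\<lambda>x. \<Sum>f\<in>M. c f * f x)"
    using pl unfolding lspan_def by blast
  have "\<forall>f\<in>M. \<exists>v w. lf n v \<and> lf n w \<and> f = psi3 n u v w" using M(2) by blast
  then obtain V W where VW: "\<And>f. f \<in> M \<Longrightarrow> lf n (V f)" "\<And>f. f \<in> M \<Longrightarrow> lf n (W f)"
    "\<And>f. f \<in> M \<Longrightarrow> f = psi3 n u (V f) (W f)" by metis
  obtain h where h: "bij_betw h {..<card M} M"
    using ex_bij_betw_nat_finite[OF M(1)] by (auto simp: atLeast0LessThan)
  define D :: "(nat \<Rightarrow> 'a) \<Rightarrow> (nat \<Rightarrow> 'a) \<Rightarrow> (nat \<Rightarrow> 'a) \<Rightarrow> nat \<Rightarrow> nat \<Rightarrow> nat \<Rightarrow> 'a"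
    where "D p q r i j k = det3 (p i) (p j) (p k) (q i) (q j) (q k) (r i) (r j) (r k)" for p q r i j k
  let ?s = "shiftrow n"
  define P where "P v w i j k = D (?s u 0) (?s v 1) (?s w 2) i j k + D (?s u 0) (?s w 1) (?s v 2) i j k
    + D (?s v 0) (?s u 1) (?s w 2) i j k + D (?s v 0) (?s w 1) (?s u 2) i j k
    + D (?s w 0) (?s u 1) (?s v 2) i j k + D (?s w 0) (?s v 1) (?s u 2) i j k" for v w i j k
  have Dalt: "D p q r j i k = - D p q r i j k" "D p q r i k j = - D p q r i j k" for p q r i j k
    by (simp_all add: D_def det3_def algebra_simps)
  have Palt: "P v w j i k = - P v w i j k" "P v w i k j = - P v w i j k" for v w i j k
    unfolding P_def by (simp_all add: Dalt(1)[of _ _ _ j i k] Dalt(2)[of _ _ _ i k j])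
  have rel: "D u1 u2 u3 i j k - (\<Sum>f\<in>M. c f / 6 * P (V f) (W f) i j k) = 0"
    if "i < n + 3" "j < n + 3" "k < n + 3" for i j k
    using _ _ _ that
  proof (rule antisymmetric_eq_0)
    fix i j k assume ijk: "i < j" "j < k" "k < n + 3"
    have pD: "plk n p q r (i, j, k) = D p q r i j k" for p q r
      using ijk by (simp add: plk_def D_def)
    have cf: "c f * f (i, j, k) = c f / 6 * P (V f) (W f) i j k" if "f \<in> M" for f
      by (subst (2) VW(3)[OF that]) (simp add: psi3_def P_def pD)
    then have "(\<Sum>f\<in>M. c f * f (i, j, k)) = (\<Sum>f\<in>M. c f / 6 * P (V f) (W f) i j k)"
      by (intro sum.cong refl)
    then show "D u1 u2 u3 i j k - (\<Sum>f\<in>M. c f / 6 * P (V f) (W f) i j k) = 0"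
      using fun_cong[OF pM, of "(i, j, k)"] unfolding pD by simp
  next
    fix i j k
    show "D u1 u2 u3 j i k - (\<Sum>f\<in>M. c f / 6 * P (V f) (W f) j i k) =
       - (D u1 u2 u3 i j k - (\<Sum>f\<in>M. c f / 6 * P (V f) (W f) i j k))"
      by (simp add: Dalt(1)[of _ _ _ j i k] Palt(1)[of _ _ j i k] sum_negf)
    show "D u1 u2 u3 i k j - (\<Sum>f\<in>M. c f / 6 * P (V f) (W f) i k j) =
       - (D u1 u2 u3 i j k - (\<Sum>f\<in>M. c f / 6 * P (V f) (W f) i j k))"
      by (simp add: Dalt(2)[of _ _ _ i k j] Palt(2)[of _ _ i k j] sum_negf)
  qed
  let ?F = "dehom \<tau> (n + 2)" and ?f = "dehom \<tau> n"
  \<comment> \<open>The 6 comes from \<open>psi3\<close>. The sign is the determinant -1 of x^2, x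
    (1 + \<tau> x), (1 + \<tau> x)^2 in the basis 1, x, x^2.\<close>
  let ?v = "\<lambda>m. smult (- c (h m) / 6) (?f (V (h m)))" and ?w = "\<lambda>m. ?f (W (h m))"
  show ?thesis
  proof (rule oscI)
    fix \<alpha> \<beta> \<gamma> :: "'a poly \<Rightarrow> 'a"
    assume l: "linfun \<alpha>" "linfun \<beta>" "linfun \<gamma>"
    let ?I = "{..n + 2}"
    define e where "e j = [:0, 1:] ^ (n + 2 - j) * [:1, \<tau>:] ^ j" for j
    have ev: "\<phi> (?F p) = (\<Sum>j\<in>?I. \<phi> (e j) * p j)" if "linfun \<phi>" for \<phi> p
      unfolding dehom_sum linfun_sum[OF that] linfun_smult[OF that] e_def by (simp only: mult.commute)
    have wD: "wedge3 \<alpha> \<beta> \<gamma> (?F p) (?F q) (?F r) =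
        (\<Sum>i\<in>?I. \<Sum>j\<in>?I. \<Sum>k\<in>?I. \<alpha> (e i) * \<beta> (e j) * \<gamma> (e k) * D p q r i j k)" for p q r
      unfolding wedge3_def ev[OF l(1)] ev[OF l(2)] ev[OF l(3)] det3_triple_sum D_def ..
    have wP: "(\<Sum>i\<in>?I. \<Sum>j\<in>?I. \<Sum>k\<in>?I. \<alpha> (e i) * \<beta> (e j) * \<gamma> (e k) * P v w i j k) =
        - symwedge \<alpha> \<beta> \<gamma> 1 [:0, 1:] [:0, 0, 1:] (?f u) (?f v) (?f w)" if "lf n v" "lf n w" for v w
    proof -
      have s: "?F (?s a 0) = ?f a * [:0, 0, 1:]" "?F (?s a 1) = ?f a * [:0, 1, \<tau>:]"
        "?F (?s a 2) = ?f a * [:1, 2 * \<tau>, \<tau> ^ 2:]" if "lf n a" for a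
        by (subst dehom_shiftrow[OF that], simp, simp add: power2_eq_square)+
      have "(\<Sum>i\<in>?I. \<Sum>j\<in>?I. \<Sum>k\<in>?I. \<alpha> (e i) * \<beta> (e j) * \<gamma> (e k) * P v w i j k) =
         wedge3 \<alpha> \<beta> \<gamma> (?F (?s u 0)) (?F (?s v 1)) (?F (?s w 2)) + wedge3 \<alpha> \<beta> \<gamma> (?F (?s u 0)) (?F (?s w 1)) (?F (?s v 2))
       + wedge3 \<alpha> \<beta> \<gamma> (?F (?s v 0)) (?F (?s u 1)) (?F (?s w 2)) + wedge3 \<alpha> \<beta> \<gamma> (?F (?s v 0)) (?F (?s w 1)) (?F (?s u 2))
       + wedge3 \<alpha> \<beta> \<gamma> (?F (?s w 0)) (?F (?s u 1)) (?F (?s v 2)) + wedge3 \<alpha> \<beta> \<gamma> (?F (?s w 0)) (?F (?s v 1)) (?F (?s u 2))"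
        unfolding wD P_def by (simp only: distrib_left sum.distrib)
      also have "\<dots> = symwedge \<alpha> \<beta> \<gamma> [:0, 0, 1:] [:0, 1, \<tau>:] [:1, 2 * \<tau>, \<tau> ^ 2:] (?f u) (?f v) (?f w)"
        unfolding symwedge_def s[OF u] s[OF that(1)] s[OF that(2)] ..
      also have "\<dots> = - symwedge \<alpha> \<beta> \<gamma> 1 [:0, 1:] [:0, 0, 1:] (?f u) (?f v) (?f w)"
        unfolding symwedge_quadratics[OF l, of 0 0 1 0 1] by (simp add: det3_def)
      finally show ?thesis .
    qed
    have "wedge3 \<alpha> \<beta> \<gamma> (?F u1) (?F u2) (?F u3) =
        (\<Sum>i\<in>?I. \<Sum>j\<in>?I. \<Sum>k\<in>?I. \<alpha> (e i) * \<beta> (e j) * \<gamma> (e k) * (\<Sum>f\<in>M. c f / 6 * P (V f) (W f) i j k))"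
      unfolding wD by (intro sum.cong refl) (use rel in force)
    also have "\<dots> = (\<Sum>f\<in>M. c f / 6 * (\<Sum>i\<in>?I. \<Sum>j\<in>?I. \<Sum>k\<in>?I. \<alpha> (e i) * \<beta> (e j) * \<gamma> (e k) * P (V f) (W f) i j k))"
      unfolding sum_distrib_left sum.swap[of _ M] by (simp only: mult_ac)
    also have "\<dots> = (\<Sum>f\<in>M. - c f / 6 * symwedge \<alpha> \<beta> \<gamma> 1 [:0, 1:] [:0, 0, 1:] (?f u) (?f (V f)) (?f (W f)))"
      by (intro sum.cong refl) (simp only: wP VW, simp)
    also have "\<dots> = (\<Sum>m<card M. - c (h m) / 6 * symwedge \<alpha> \<beta> \<gamma> 1 [:0, 1:] [:0, 0, 1:] (?f u) (?f (V (h m))) (?f (W (h m))))"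
      by (rule sum.reindex_bij_betw[OF h, symmetric])
    finally show "wedge3 \<alpha> \<beta> \<gamma> (?F u1) (?F u2) (?F u3) =
        (\<Sum>m<card M. symwedge \<alpha> \<beta> \<gamma> 1 [:0, 1:] [:0, 0, 1:] (?f u) (?v m) (?w m))"
      unfolding symwedge_smult[OF l] .
  qed
qed

section \<open>Annihilators\<close>

lemma sum_fun_apply: "(\<Sum>i\<in>I. f i) x = (\<Sum>i\<in>I. f i x)" for f :: "'i \<Rightarrow> 'b \<Rightarrow> 'a::comm_monoid_add"
  by (induction I rule: infinite_finite_induct) auto

text \<open>Translates \<open>lspan\<close> and \<open>lin_indep\<close> into the abstract theory,
  which provides extension of bases and dimension.\<close>

interpretation fn: vector_space "\<lambda>(c::'a::field) (v::'b \<Rightarrow> 'a) x. c * v x"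
  by unfold_locales (auto simp: fun_eq_iff algebra_simps)

lemma lspan_eq_span: "lspan S = fn.span S" for S :: "('b \<Rightarrow> 'a::field) set"
proof -
  have "(\<lambda>x. \<Sum>f\<in>F. c f * f x) = (\<Sum>f\<in>F. (\<lambda>x. c f * f x))" for F and c :: "('b \<Rightarrow> 'a) \<Rightarrow> 'a"
    by (simp add: fun_eq_iff sum_fun_apply)
  then show ?thesis
    unfolding lspan_def fn.span_explicit by auto
qed

lemma lin_indep_iff: "finite B \<Longrightarrow> lin_indep B \<longleftrightarrow> fn.independent B"
  unfolding lin_indep_def fn.dependent_finite by (auto simp: fun_eq_iff sum_fun_apply)

lemma subspace_amb: "fn.subspace (amb n)"
  by (auto simp: fn.subspace_def amb_def)

lemma dotp_commute: "dotp n l v = dotp n v l"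
  by (simp add: dotp_def mult.commute)

lemma dotp_add: "dotp n l (v + w) = dotp n l v + dotp n l w"
  and dotp_scale: "dotp n l (\<lambda>x. c * v x) = c * dotp n l v"
  and dotp_add_pointwise: "dotp n l (\<lambda>x. v x + w x) = dotp n l v + dotp n l w"
  and dotp_zero [simp]: "dotp n l 0 = 0" "dotp n l (\<lambda>_. 0) = 0"
  by (simp_all add: dotp_def distrib_left sum.distrib sum_distrib_left mult_ac)

lemma dotp_sum: "dotp n l (\<Sum>i\<in>I. v i) = (\<Sum>i\<in>I. dotp n l (v i))"
  unfolding dotp_def sum_fun_apply sum_distrib_left by (rule sum.swap)

lemma subspace_ann: "fn.subspace (ann n X)"
  unfolding fn.subspace_def ann_def
  by (auto simp: dotp_commute[of n _ v for v] dotp_add dotp_scale subspace_amb[unfolded fn.subspace_def])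

lemma ann_subset_amb: "ann n X \<subseteq> amb n"
  by (auto simp: ann_def)

lemma ann_antimono: "X \<subseteq> Y \<Longrightarrow> ann n Y \<subseteq> ann n X"
  by (auto simp: ann_def)

lemma ann_span: "ann n (fn.span X) = ann n X"
proof
  show "ann n (fn.span X) \<subseteq> ann n X"
    by (rule ann_antimono) (rule fn.span_superset)
  show "ann n X \<subseteq> ann n (fn.span X)"
  proof
    fix l assume l: "l \<in> ann n X"
    have "dotp n l v = 0" if "v \<in> fn.span X" for v
      using that by (induction rule: fn.span_induct_alt)
        (use l in \<open>auto simp: ann_def dotp_add_pointwise dotp_scale\<close>)
    then show "l \<in> ann n (fn.span X)" using l by (auto simp: ann_def)
  qed
qed

definition unitv :: "nat \<Rightarrow> nat \<Rightarrow> 'a::field" where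
  "unitv j = (\<lambda>i. if i = j then 1 else 0)"

lemma amb_eq_sum: "v \<in> amb n \<Longrightarrow> v = (\<Sum>j<n + 3. (\<lambda>x. v j * unitv j x))"
  by (auto simp: fun_eq_iff sum_fun_apply unitv_def amb_def if_distrib cong: if_cong)

lemma dotp_unitv: "j < n + 3 \<Longrightarrow> dotp n l (unitv j) = l j"
  by (simp add: dotp_def unitv_def if_distrib cong: if_cong)

lemma unitv_in_amb: "j < n + 3 \<Longrightarrow> unitv j \<in> amb n"
  by (auto simp: amb_def unitv_def)

lemma amb_basis:
  "fn.independent (unitv ` {..<n + 3} :: (nat \<Rightarrow> 'a::field) set)"
  "fn.span (unitv ` {..<n + 3}) = (amb n :: (nat \<Rightarrow> 'a) set)"
  "card (unitv ` {..<n + 3} :: (nat \<Rightarrow> 'a) set) = n + 3"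
proof -
  have inj: "inj_on (unitv :: nat \<Rightarrow> nat \<Rightarrow> 'a) A" for A
    by (rule inj_onI) (metis unitv_def zero_neq_one)
  show "card (unitv ` {..<n + 3} :: (nat \<Rightarrow> 'a) set) = n + 3"
    by (simp add: card_image inj)
  show "fn.independent (unitv ` {..<n + 3} :: (nat \<Rightarrow> 'a) set)"
    unfolding fn.dependent_finite[OF finite_imageI[OF finite_lessThan]]
  proof safe
    fix c :: "(nat \<Rightarrow> 'a) \<Rightarrow> 'a" and j
    assume *: "(\<Sum>v\<in>unitv ` {..<n + 3}. (\<lambda>x. c v * v x)) = 0" "c (unitv j) \<noteq> 0" "j < n + 3"
    have "0 = (\<Sum>i<n + 3. c (unitv i) * unitv i j)"
      using fun_cong[OF *(1), of j] by (simp add: sum_fun_apply sum.reindex[OF inj] o_def)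
    also have "\<dots> = c (unitv j)" using *(3) by (simp add: unitv_def if_distrib cong: if_cong)
    finally show False using *(2) by simp
  qed
  show "fn.span (unitv ` {..<n + 3}) = (amb n :: (nat \<Rightarrow> 'a) set)"
  proof
    show "fn.span (unitv ` {..<n + 3}) \<subseteq> (amb n :: (nat \<Rightarrow> 'a) set)"
      by (rule fn.span_minimal) (auto simp: unitv_in_amb subspace_amb)
    show "(amb n :: (nat \<Rightarrow> 'a) set) \<subseteq> fn.span (unitv ` {..<n + 3})"
    proof
      fix v :: "nat \<Rightarrow> 'a" assume "v \<in> amb n"
      show "v \<in> fn.span (unitv ` {..<n + 3})"
        by (subst amb_eq_sum[OF \<open>v \<in> amb n\<close>])
          (intro fn.span_sum fn.span_scale fn.span_base imageI, simp)
    qed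
  qed
qed

text \<open>Complete a basis \<open>B\<close> of \<open>X\<close> to a basis \<open>C\<close> of the ambient space; the coordinate functions of \<open>K = C - B\<close> are a
  basis of the annihilator of \<open>X\<close>.\<close>

lemma dual_basis:
  fixes B :: "(nat \<Rightarrow> 'a::field) set"
  assumes ind: "fn.independent B" and X: "fn.span B = X" "X \<subseteq> amb n"
  obtains K g where "finite K" "card K = n + 3 - card B" "K \<subseteq> amb n"
    "\<And>c. c \<in> K \<Longrightarrow> g c \<in> ann n X"
    "\<And>c c'. c \<in> K \<Longrightarrow> c' \<in> K \<Longrightarrow> dotp n (g c) c' = (if c = c' then 1 else 0)"
    "\<And>l. l \<in> ann n X \<Longrightarrow> l = (\<Sum>c\<in>K. (\<lambda>x. dotp n l c * g c x))"
    "\<And>v. v \<in> amb n \<Longrightarrow> (\<And>c. c \<in> K \<Longrightarrow> dotp n (g c) v = 0) \<Longrightarrow> v \<in> X"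
proof -
  have "B \<subseteq> amb n" using X fn.span_superset[of B] by auto
  then obtain C where C: "B \<subseteq> C" "C \<subseteq> amb n" "fn.independent C" "amb n \<subseteq> fn.span C"
    using fn.maximal_independent_subset_extend[OF _ ind] by metis
  have span: "fn.span C = amb n"
    using C fn.span_minimal[OF C(2) subspace_amb] by auto
  have "finite C" using fn.independent_span_bound[OF _ C(3), of "unitv ` {..<n + 3}"] C(2) amb_basis(2)[where 'a='a]
    by auto
  have "card C = fn.dim (amb n :: (nat \<Rightarrow> 'a) set)" using fn.basis_card_eq_dim[OF C(2,4,3)] .
  also have "\<dots> = n + 3"
    using fn.dim_span_eq_card_independent[OF amb_basis(1)[of n, where 'a='a]] amb_basis(2,3)[of n, where 'a='a] by simp
  finally have cC: "card C = n + 3" .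
  define g :: "(nat \<Rightarrow> 'a) \<Rightarrow> nat \<Rightarrow> 'a"
    where "g c = (\<lambda>j. if j < n + 3 then fn.representation C (unitv j) c else 0)" for c
  have gv: "dotp n (g c) v = fn.representation C v c" if "v \<in> amb n" for c v
  proof -
    have "fn.representation C v = fn.representation C (\<Sum>j<n + 3. (\<lambda>x. v j * unitv j x))"
      using amb_eq_sum[OF that] by simp
    also have "\<dots> = (\<lambda>b. \<Sum>j<n + 3. fn.representation C (\<lambda>x. v j * unitv j x) b)"
      by (rule fn.representation_sum[OF C(3)]) (auto simp: span intro!: fn.subspace_scale[OF subspace_amb] unitv_in_amb)
    also have "\<dots> = (\<lambda>b. \<Sum>j<n + 3. v j * fn.representation C (unitv j) b)"
      by (intro ext sum.cong refl) (simp add: fn.representation_scale[OF C(3)] span unitv_in_amb)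
    finally show ?thesis by (simp add: dotp_def g_def mult.commute)
  qed
  have ga: "g c \<in> amb n" for c by (simp add: amb_def g_def)
  have expand: "v = (\<Sum>c\<in>C. (\<lambda>x. fn.representation C v c * c x))" if "v \<in> amb n" for v
    using fn.sum_representation_eq[OF C(3), of v C] that \<open>finite C\<close> span by simp
  have KX: "v \<in> X" if v: "v \<in> amb n" and z: "\<And>c. c \<in> C - B \<Longrightarrow> dotp n (g c) v = 0" for v
  proof -
    have "v = (\<Sum>c\<in>B. (\<lambda>x. fn.representation C v c * c x))"
      by (subst expand[OF v], rule sum.mono_neutral_right)
        (use \<open>finite C\<close> C z gv[OF v] in \<open>auto simp: fun_eq_iff\<close>)
    also have "\<dots> \<in> fn.span B"
      by (intro fn.span_sum fn.span_scale fn.span_base)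
    finally show ?thesis using X by simp
  qed
  have gX: "g c \<in> ann n X" if "c \<in> C - B" for c
  proof -
    have "fn.representation C v c = 0" if "v \<in> X" for v
      using fn.representation_extend[OF C(3) _ C(1), of v] X that \<open>c \<in> C - B\<close>
        fn.representation_ne_zero[of B v c] by auto
    then show ?thesis using gv X ga by (auto simp: ann_def)
  qed
  show ?thesis
  proof (rule that[of "C - B" g])
    show "card (C - B) = n + 3 - card B"
      using C(1) \<open>finite C\<close> cC by (simp add: card_Diff_subset finite_subset)
    show "dotp n (g c) c' = (if c = c' then 1 else 0)" if "c \<in> C - B" "c' \<in> C - B" for c c'
      using that C(2) by (subst gv) (auto simp: fn.representation_basis[OF C(3)])
    show "l = (\<Sum>c\<in>C - B. (\<lambda>x. dotp n l c * g c x))" if l: "l \<in> ann n X" for l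
    proof
      fix j
      show "l j = (\<Sum>c\<in>C - B. (\<lambda>x. dotp n l c * g c x)) j"
      proof (cases "j < n + 3")
        case True
        then have "l j = dotp n l (unitv j)" by (simp add: dotp_unitv)
        also have "\<dots> = (\<Sum>c\<in>C. fn.representation C (unitv j) c * dotp n l c)"
          by (subst expand[OF unitv_in_amb[OF True]]) (simp only: dotp_sum dotp_scale)
        also have "\<dots> = (\<Sum>c\<in>C - B. fn.representation C (unitv j) c * dotp n l c)"
          by (rule sum.mono_neutral_right)
            (use \<open>finite C\<close> l X fn.span_superset[of B] in \<open>auto simp: ann_def\<close>)
        also have "\<dots> = (\<Sum>c\<in>C - B. dotp n l c * g c j)"
          using True by (simp add: g_def mult.commute)
        finally show ?thesis by (simp add: sum_fun_apply)
      next
        case False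
        then show ?thesis using l by (simp add: sum_fun_apply g_def ann_def amb_def)
      qed
    qed
  qed (use \<open>finite C\<close> C gX KX in auto)
qed

text \<open>The dual basis supplies, for each vector outside X, a form that vanishes on X but not on
  that vector.\<close>

lemma ann_ann:
  fixes X :: "(nat \<Rightarrow> 'a::field) set"
  assumes "fn.subspace X" "X \<subseteq> amb n"
  shows "ann n (ann n X) = X"
proof
  show "X \<subseteq> ann n (ann n X)"
    using assms(2) by (auto simp: ann_def dotp_commute)
  obtain B where B: "B \<subseteq> X" "fn.independent B" "X \<subseteq> fn.span B"
    using fn.maximal_independent_subset[of X] by metis
  have "fn.span B = X" using B fn.span_minimal[OF B(1) assms(1)] by auto
  show "ann n (ann n X) \<subseteq> X"
  proof
    fix v assume v: "v \<in> ann n (ann n X)"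
    obtain K :: "(nat \<Rightarrow> 'a) set" and g where K: "\<And>c. c \<in> K \<Longrightarrow> g c \<in> ann n X"
      "\<And>v. v \<in> amb n \<Longrightarrow> (\<And>c. c \<in> K \<Longrightarrow> dotp n (g c) v = 0) \<Longrightarrow> v \<in> X"
    proof (rule dual_basis[OF B(2) \<open>fn.span B = X\<close> assms(2)])
      fix K :: "(nat \<Rightarrow> 'a) set" and g
      assume "\<And>c. c \<in> K \<Longrightarrow> g c \<in> ann n X"
        "\<And>v. v \<in> amb n \<Longrightarrow> (\<And>c. c \<in> K \<Longrightarrow> dotp n (g c) v = 0) \<Longrightarrow> v \<in> X"
      then show ?thesis by (rule that)
    qed
    show "v \<in> X"
    proof (rule K(2))
      show "v \<in> amb n" using v by (simp add: ann_def)
      show "dotp n (g c) v = 0" if "c \<in> K" for c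
        using v K(1)[OF that] unfolding ann_def[of n "ann n X"] by (subst dotp_commute) blast
    qed
  qed
qed

section \<open>Three-dimensional spaces of equations\<close>

definition comb3 :: "('b \<Rightarrow> 'a::field) \<Rightarrow> ('b \<Rightarrow> 'a) \<Rightarrow> ('b \<Rightarrow> 'a) \<Rightarrow> ('b \<Rightarrow> 'a) set" where
  "comb3 u1 u2 u3 = {l. \<exists>a b c. \<forall>x. l x = a * u1 x + b * u2 x + c * u3 x}"

text \<open>Independence of the triple, as in \<open>cut_by\<close>: a triple with equal entries is
  dependent, while the set of its entries need not be.\<close>

definition ind3 :: "('b \<Rightarrow> 'a::field) \<Rightarrow> ('b \<Rightarrow> 'a) \<Rightarrow> ('b \<Rightarrow> 'a) \<Rightarrow> bool" where
  "ind3 u1 u2 u3 \<longleftrightarrow> (\<forall>a b c. (\<forall>x. a * u1 x + b * u2 x + c * u3 x = 0) \<longrightarrow> a = 0 \<and> b = 0 \<and> c = 0)"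

lemma comb3_eq_span: "comb3 u1 u2 u3 = fn.span {u1, u2, u3}"
proof (rule fn.span_unique[symmetric])
  show "{u1, u2, u3} \<subseteq> comb3 u1 u2 u3"
    unfolding comb3_def
    by (auto intro: exI[of _ 1] exI[of _ 0] exI[where x = "\<lambda>_. 0"]) (metis add_0 add_0_right mult_1 mult_zero_left)+
  show "fn.subspace (comb3 u1 u2 u3)"
    unfolding fn.subspace_def comb3_def
  proof (safe)
    show "\<exists>a b c. \<forall>x. 0 x = a * u1 x + b * u2 x + c * u3 x"
      by (intro exI[of _ 0]) simp
    fix v w a b c a' b' c'
    assume "\<forall>x. v x = a * u1 x + b * u2 x + c * u3 x" "\<forall>x. w x = a' * u1 x + b' * u2 x + c' * u3 x"
    then show "\<exists>a b c. \<forall>x. (v + w) x = a * u1 x + b * u2 x + c * u3 x"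
      by (intro exI[of _ "a + a'"] exI[of _ "b + b'"] exI[of _ "c + c'"]) (simp add: algebra_simps)
  next
    fix d v a b c
    assume "\<forall>x. v x = a * u1 x + b * u2 x + c * u3 x"
    then show "\<exists>a b c. \<forall>x. d * v x = a * u1 x + b * u2 x + c * u3 x"
      by (intro exI[of _ "d * a"] exI[of _ "d * b"] exI[of _ "d * c"]) (simp add: algebra_simps)
  qed
  fix T assume T: "{u1, u2, u3} \<subseteq> T" "fn.subspace T"
  show "comb3 u1 u2 u3 \<subseteq> T"
  proof
    fix l assume "l \<in> comb3 u1 u2 u3"
    then obtain a b c where "l = (\<lambda>x. a * u1 x) + (\<lambda>x. b * u2 x) + (\<lambda>x. c * u3 x)"
      by (auto simp: comb3_def fun_eq_iff)
    then show "l \<in> T" using T by (auto intro!: fn.subspace_add fn.subspace_scale)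
  qed
qed

lemma ann_cut_by:
  assumes "cut_by n u1 u2 u3 W"
  shows "ann n W = comb3 u1 u2 u3" "W = ann n (comb3 u1 u2 u3)" "ind3 u1 u2 u3"
proof -
  have u: "{u1, u2, u3} \<subseteq> amb n" using assms by (auto simp: cut_by_def)
  show "ind3 u1 u2 u3" using assms unfolding cut_by_def ind3_def by blast
  have "W = {v \<in> amb n. dotp n u1 v = 0 \<and> dotp n u2 v = 0 \<and> dotp n u3 v = 0}"
    using assms unfolding cut_by_def by blast
  then show W: "W = ann n (comb3 u1 u2 u3)"
    unfolding comb3_eq_span ann_span unfolding ann_def by (simp add: dotp_commute)
  show "ann n W = comb3 u1 u2 u3"
    unfolding W comb3_eq_span
    by (rule ann_ann) (use u fn.span_minimal[OF u subspace_amb] in \<open>auto simp: fn.subspace_span\<close>)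
qed

text \<open>One step of Steinitz exchange; the permutation lemmas bring whichever coefficient is
  nonzero to the front.\<close>

lemma comb3_exchange:
  assumes ind: "ind3 u1 u2 u3" and g: "\<And>x. g x = a * u1 x + b * u2 x + c * u3 x" and "a \<noteq> 0"
  shows "ind3 g u2 u3" "comb3 g u2 u3 = comb3 u1 u2 u3"
proof -
  show "ind3 g u2 u3"
    unfolding ind3_def
  proof (intro allI impI)
    fix p q s assume "\<forall>x. p * g x + q * u2 x + s * u3 x = 0"
    then have "\<forall>x. (p * a) * u1 x + (p * b + q) * u2 x + (p * c + s) * u3 x = 0"
      by (simp add: g algebra_simps)
    then have "p * a = 0 \<and> p * b + q = 0 \<and> p * c + s = 0"
      using ind unfolding ind3_def by blast
    then show "p = 0 \<and> q = 0 \<and> s = 0" using \<open>a \<noteq> 0\<close> by auto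
  qed
  have u1: "u1 x = (1 / a) * g x + (- b / a) * u2 x + (- c / a) * u3 x" for x
    using \<open>a \<noteq> 0\<close> by (simp add: g field_simps)
  have "l \<in> comb3 g u2 u3 \<longleftrightarrow> l \<in> comb3 u1 u2 u3" for l
  proof
    assume "l \<in> comb3 g u2 u3"
    then obtain p q s where "\<forall>x. l x = p * g x + q * u2 x + s * u3 x" by (auto simp: comb3_def)
    then show "l \<in> comb3 u1 u2 u3" unfolding comb3_def
      by (intro CollectI exI[of _ "p * a"] exI[of _ "p * b + q"] exI[of _ "p * c + s"])
        (simp add: g algebra_simps)
  next
    assume "l \<in> comb3 u1 u2 u3"
    then obtain p q s where *: "\<forall>x. l x = p * u1 x + q * u2 x + s * u3 x" by (auto simp: comb3_def)
    have "l x = (p / a) * g x + (q - p * b / a) * u2 x + (s - p * c / a) * u3 x" for x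
      using * by (simp add: u1[of x] algebra_simps)
    then show "l \<in> comb3 g u2 u3" unfolding comb3_def by blast
  qed
  then show "comb3 g u2 u3 = comb3 u1 u2 u3" by blast
qed

lemma comb3_permute: "comb3 u2 u1 u3 = comb3 u1 u2 u3" "comb3 u1 u3 u2 = comb3 u1 u2 u3"
  by (simp_all add: comb3_eq_span insert_commute)

lemma ind3_permute: "ind3 u2 u1 u3 \<longleftrightarrow> ind3 u1 u2 u3" "ind3 u1 u3 u2 \<longleftrightarrow> ind3 u1 u2 u3"
  for u1 u2 u3 :: "'b \<Rightarrow> 'a::field"
proof -
  have 1: "ind3 v2 v1 v3" if "ind3 v1 v2 v3" for v1 v2 v3 :: "'b \<Rightarrow> 'a"
    unfolding ind3_def
  proof (intro allI impI)
    fix a b c assume "\<forall>x. a * v2 x + b * v1 x + c * v3 x = 0"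
    then have "\<forall>x. b * v1 x + a * v2 x + c * v3 x = 0" by (simp add: add.commute)
    then show "a = 0 \<and> b = 0 \<and> c = 0" using that unfolding ind3_def by blast
  qed
  have 2: "ind3 v1 v3 v2" if "ind3 v1 v2 v3" for v1 v2 v3 :: "'b \<Rightarrow> 'a"
    unfolding ind3_def
  proof (intro allI impI)
    fix a b c assume "\<forall>x. a * v1 x + b * v3 x + c * v2 x = 0"
    then have "\<forall>x. a * v1 x + c * v2 x + b * v3 x = 0" by (simp add: add.assoc add.commute[of "b * _"])
    then show "a = 0 \<and> b = 0 \<and> c = 0" using that unfolding ind3_def by blast
  qed
  show "ind3 u2 u1 u3 \<longleftrightarrow> ind3 u1 u2 u3" "ind3 u1 u3 u2 \<longleftrightarrow> ind3 u1 u2 u3"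
    using 1 2 by blast+
qed

lemma comb3_extend1:
  assumes ind: "ind3 u1 u2 u3" and g: "g \<in> comb3 u1 u2 u3" "g \<noteq> (\<lambda>_. 0)"
  obtains l2 l3 where "ind3 g l2 l3" "comb3 g l2 l3 = comb3 u1 u2 u3"
proof -
  obtain a b c where g': "\<And>x. g x = a * u1 x + b * u2 x + c * u3 x" using g by (auto simp: comb3_def)
  have "a \<noteq> 0 \<or> b \<noteq> 0 \<or> c \<noteq> 0"
  proof (rule ccontr)
    assume "\<not> ?thesis"
    then have "g = (\<lambda>_. 0)" by (intro ext) (simp add: g')
    then show False using g(2) by simp
  qed
  then consider "a \<noteq> 0" | "b \<noteq> 0" | "c \<noteq> 0" by blast
  then show ?thesis
  proof cases
    case 1
    then show ?thesis using that comb3_exchange[OF ind g'] by metis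
  next
    case 2
    have "g x = b * u2 x + a * u1 x + c * u3 x" for x by (simp add: g')
    then show ?thesis
      using that comb3_exchange[of u2 u1 u3 g b a c] 2 ind by (metis comb3_permute ind3_permute)
  next
    case 3
    have "g x = c * u3 x + a * u1 x + b * u2 x" for x by (simp add: g')
    then show ?thesis
      using that comb3_exchange[of u3 u1 u2 g c a b] 3 ind by (metis comb3_permute ind3_permute)
  qed
qed

lemma comb3_extend2:
  assumes ind: "ind3 u1 u2 u3" and g: "g1 \<in> comb3 u1 u2 u3" "g2 \<in> comb3 u1 u2 u3"
    and ind': "\<And>a b. (\<And>x. a * g1 x + b * g2 x = 0) \<Longrightarrow> a = 0 \<and> b = 0"
  obtains u where "ind3 g1 g2 u" "comb3 g1 g2 u = comb3 u1 u2 u3"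
proof -
  have "g1 \<noteq> (\<lambda>_. 0)" using ind'[of 1 0] by auto
  then obtain l2 l3 where l: "ind3 g1 l2 l3" "comb3 g1 l2 l3 = comb3 u1 u2 u3"
    using comb3_extend1[OF ind g(1)] by metis
  obtain a b c where g2: "\<And>x. g2 x = a * g1 x + b * l2 x + c * l3 x"
    using g(2)[folded l(2)] by (auto simp: comb3_def)
  have "b \<noteq> 0 \<or> c \<noteq> 0" using ind'[of a "-1"] by (auto simp: g2)
  then show ?thesis
  proof
    assume "b \<noteq> 0"
    have "g2 x = b * l2 x + a * g1 x + c * l3 x" for x by (simp add: g2)
    then show ?thesis
      using that[of l3] comb3_exchange[of l2 g1 l3 g2 b a c] \<open>b \<noteq> 0\<close> l
      by (metis comb3_permute ind3_permute)
  next
    assume "c \<noteq> 0"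
    have "g2 x = c * l3 x + a * g1 x + b * l2 x" for x by (simp add: g2)
    then show ?thesis
      using that[of l2] comb3_exchange[of l3 g1 l2 g2 c a b] \<open>c \<noteq> 0\<close> l
      by (metis comb3_permute ind3_permute)
  qed
qed

section \<open>Equations of spans\<close>

lemma ann_lspan_Un: "ann n (lspan (X \<union> Y)) = ann n X \<inter> ann n Y"
  unfolding lspan_eq_span ann_span by (auto simp: ann_def)

lemma lspan_eq_ann:
  assumes "X \<subseteq> amb n"
  shows "lspan X = ann n (ann n X)"
  unfolding lspan_eq_span
  by (subst ann_ann[symmetric, OF fn.subspace_span fn.span_minimal[OF assms subspace_amb]]) (simp add: ann_span)

lemma vdim_eq_dual_basis:
  fixes X :: "(nat \<Rightarrow> 'a::field) set"
  assumes "vdim_eq X d" "X \<subseteq> amb n"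
  obtains K g where "finite K" "card K = n + 3 - d" "K \<subseteq> amb n"
    "\<And>c. c \<in> K \<Longrightarrow> g c \<in> ann n X"
    "\<And>c c'. c \<in> K \<Longrightarrow> c' \<in> K \<Longrightarrow> dotp n (g c) c' = (if c = c' then 1 else 0)"
    "\<And>l. l \<in> ann n X \<Longrightarrow> l = (\<Sum>c\<in>K. (\<lambda>x. dotp n l c * g c x))"
proof -
  obtain B where B: "finite B" "card B = d" "lin_indep B" "lspan B = X"
    using assms(1) by (auto simp: vdim_eq_def)
  then have "fn.independent B" "fn.span B = X" by (simp_all add: lin_indep_iff lspan_eq_span)
  then show ?thesis
  proof (rule dual_basis[OF _ _ assms(2)])
    fix K :: "(nat \<Rightarrow> 'a) set" and g
    assume "finite K" "card K = n + 3 - card B" "K \<subseteq> amb n"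
      "\<And>c. c \<in> K \<Longrightarrow> g c \<in> ann n X"
      "\<And>c c'. c \<in> K \<Longrightarrow> c' \<in> K \<Longrightarrow> dotp n (g c) c' = (if c = c' then 1 else 0)"
      "\<And>l. l \<in> ann n X \<Longrightarrow> l = (\<Sum>c\<in>K. (\<lambda>x. dotp n l c * g c x))"
    then show ?thesis unfolding B(2) by (rule that)
  qed
qed

text \<open>Linear dimension n + 2 is projective dimension n + 1: a hyperplane, with one equation up
  to scalars.\<close>

lemma ann_codim_1:
  fixes X :: "(nat \<Rightarrow> 'a::field) set"
  assumes "vdim_eq X (n + 2)" "X \<subseteq> amb n"
  obtains g where "g \<in> ann n X" "g \<noteq> (\<lambda>_. 0)" "\<And>l. l \<in> ann n X \<Longrightarrow> \<exists>a. \<forall>x. l x = a * g x"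
proof -
  obtain K :: "(nat \<Rightarrow> 'a) set" and g where K: "card K = n + 3 - (n + 2)"
    "\<And>c. c \<in> K \<Longrightarrow> g c \<in> ann n X"
    "\<And>c c'. c \<in> K \<Longrightarrow> c' \<in> K \<Longrightarrow> dotp n (g c) c' = (if c = c' then 1 else 0)"
    "\<And>l. l \<in> ann n X \<Longrightarrow> l = (\<Sum>c\<in>K. (\<lambda>x. dotp n l c * g c x))"
  proof (rule vdim_eq_dual_basis[OF assms])
    fix K :: "(nat \<Rightarrow> 'a) set" and g
    assume "card K = n + 3 - (n + 2)"
    "\<And>c. c \<in> K \<Longrightarrow> g c \<in> ann n X"
    "\<And>c c'. c \<in> K \<Longrightarrow> c' \<in> K \<Longrightarrow> dotp n (g c) c' = (if c = c' then 1 else 0)"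
    "\<And>l. l \<in> ann n X \<Longrightarrow> l = (\<Sum>c\<in>K. (\<lambda>x. dotp n l c * g c x))"
    then show ?thesis by (rule that)
  qed
  obtain c where c: "K = {c}" using K(1) by (auto simp: card_1_singleton_iff)
  show ?thesis
  proof (rule that[of "g c"])
    show "g c \<noteq> (\<lambda>_. 0)" using K(3)[of c c] c by (auto simp: dotp_def)
    show "\<exists>a. \<forall>x. l x = a * g c x" if "l \<in> ann n X" for l
      using fun_cong[OF K(4)[OF that]] c by auto
  qed (use K(2) c in auto)
qed

text \<open>Projective dimension n, hence a pencil of equations.\<close>

lemma ann_codim_2:
  fixes X :: "(nat \<Rightarrow> 'a::field) set"
  assumes "vdim_eq X (n + 1)" "X \<subseteq> amb n"
  obtains g1 g2 where "g1 \<in> ann n X" "g2 \<in> ann n X"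
    "\<And>a b. (\<And>x. a * g1 x + b * g2 x = 0) \<Longrightarrow> a = 0 \<and> b = 0"
    "\<And>l. l \<in> ann n X \<Longrightarrow> \<exists>a b. \<forall>x. l x = a * g1 x + b * g2 x"
proof -
  obtain K :: "(nat \<Rightarrow> 'a) set" and g where K: "card K = n + 3 - (n + 1)"
    "\<And>c. c \<in> K \<Longrightarrow> g c \<in> ann n X"
    "\<And>c c'. c \<in> K \<Longrightarrow> c' \<in> K \<Longrightarrow> dotp n (g c) c' = (if c = c' then 1 else 0)"
    "\<And>l. l \<in> ann n X \<Longrightarrow> l = (\<Sum>c\<in>K. (\<lambda>x. dotp n l c * g c x))"
  proof (rule vdim_eq_dual_basis[OF assms])
    fix K :: "(nat \<Rightarrow> 'a) set" and g
    assume "card K = n + 3 - (n + 1)"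
    "\<And>c. c \<in> K \<Longrightarrow> g c \<in> ann n X"
    "\<And>c c'. c \<in> K \<Longrightarrow> c' \<in> K \<Longrightarrow> dotp n (g c) c' = (if c = c' then 1 else 0)"
    "\<And>l. l \<in> ann n X \<Longrightarrow> l = (\<Sum>c\<in>K. (\<lambda>x. dotp n l c * g c x))"
    then show ?thesis by (rule that)
  qed
  obtain c c' where c: "K = {c, c'}" "c \<noteq> c'" using K(1) by (auto simp: card_2_iff)
  show ?thesis
  proof (rule that[of "g c" "g c'"])
    fix a b assume z: "\<And>x. a * g c x + b * g c' x = 0"
    have "a * dotp n (g c) e + b * dotp n (g c') e = 0" for e
    proof -
      have "a * dotp n (g c) e + b * dotp n (g c') e = (\<Sum>j<n + 3. (a * g c j + b * g c' j) * e j)"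
        by (simp add: dotp_def sum_distrib_left sum.distrib distrib_right mult.assoc)
      then show ?thesis by (simp add: z)
    qed
    from this[of c] this[of c'] show "a = 0 \<and> b = 0" using K(3) c by auto
  next
    show "\<exists>a b. \<forall>x. l x = a * g c x + b * g c' x" if "l \<in> ann n X" for l
      using fun_cong[OF K(4)[OF that]] c by auto
  qed (use K(2) c in auto)
qed

section \<open>The divisor on the rational normal curve\<close>

lemma zmult_zsch: "zmult (zsch k y \<rho>) z = (\<Sum>i<k. if proj_eq (y i) z then \<rho> i else 0)"
  by (simp add: zmult_def zsch_def o_def interv_sum_list_conv_sum_set_nat atLeast0LessThan cong: if_cong)

lemma proj_eq_pcoord:
  assumes "snd y \<noteq> \<tau> * fst y" "snd z \<noteq> \<tau> * fst z"
  shows "proj_eq y z \<longleftrightarrow> pcoord \<tau> y = pcoord \<tau> z"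
proof -
  have "pcoord \<tau> y = pcoord \<tau> z \<longleftrightarrow> fst y * (snd z - \<tau> * fst z) = fst z * (snd y - \<tau> * fst y)"
    using assms by (simp add: pcoord_def frac_eq_eq)
  also have "\<dots> \<longleftrightarrow> proj_eq y z"
    by (simp add: proj_eq_def algebra_simps)
  finally show ?thesis ..
qed

lemma proj_eq_infinity:
  assumes "snd z = \<tau> * fst z" "z \<noteq> (0, 0)" "proj_eq y z"
  shows "snd y = \<tau> * fst y"
proof -
  have "fst z \<noteq> 0" using assms(1,2) by (cases z) auto
  moreover have "fst z * (snd y) = fst z * (\<tau> * fst y)"
    using assms(1,3) by (auto simp: proj_eq_def algebra_simps)
  ultimately show ?thesis by simp
qed

lemma dehom_comb3:
  assumes "\<And>x. l x = a * u1 x + b * u2 x + c * u3 x"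
  shows "dehom \<tau> m l = smult a (dehom \<tau> m u1) + smult b (dehom \<tau> m u2) + smult c (dehom \<tau> m u3)"
  unfolding dehom_sum by (simp add: assms smult_add_left sum.distrib smult_sum_right)

lemma amb_dehom_inject:
  assumes "l \<in> amb n" "l' \<in> amb n" "dehom \<tau> (n + 2) l = dehom \<tau> (n + 2) l'"
  shows "l = l'"
proof
  fix i
  show "l i = l' i"
    using dehom_inject[OF assms(3), of i] assms(1,2) by (cases "i \<le> n + 2") (auto simp: amb_def)
qed

lemma shiftrow_in_amb: "j \<le> 2 \<Longrightarrow> shiftrow n u j \<in> amb n"
  by (auto simp: amb_def shiftrow_def)

lemma dotp_shiftrow:
  assumes "j \<le> 2"
  shows "dotp n (shiftrow n u j) z = (\<Sum>i\<le>n. u i * z (i + j))"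
proof -
  have "dotp n (shiftrow n u j) z = (\<Sum>m\<in>{0 + j..n + j}. u (m - j) * z m)"
    unfolding dotp_def using assms
    by (intro sum.mono_neutral_cong_right) (auto simp: shiftrow_def)
  also have "\<dots> = (\<Sum>i=0..n. u (i + j - j) * z (i + j))"
    by (rule sum.shift_bounds_cl_nat_ivl)
  finally show ?thesis by (simp add: atLeast0AtMost)
qed

lemma phi_eq_ann: "phi n u = ann n (comb3 (shiftrow n u 0) (shiftrow n u 1) (shiftrow n u 2))"
proof -
  have 3: "(\<forall>j<3. P j) \<longleftrightarrow> P 0 \<and> P 1 \<and> P 2" for P :: "nat \<Rightarrow> bool"
    by (auto simp: numeral_eq_Suc less_Suc_eq)
  have "phi n u = {z \<in> amb n. \<forall>j<3. dotp n (shiftrow n u j) z = 0}"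
    unfolding phi_def by (intro Collect_cong conj_cong refl all_cong) (simp add: dotp_shiftrow)
  then show ?thesis
    unfolding comb3_eq_span ann_span unfolding ann_def 3 by (simp add: dotp_commute)
qed

text \<open>Over an algebraically closed field divisibility is tested root by root; a common linear
  factor is split off at each step.\<close>

lemma dvd_if_order_le:
  fixes h P :: "'a::alg_closed_field poly"
  assumes "h \<noteq> 0" and "\<And>a. [:-a, 1:] ^ order a h dvd P"
  shows "h dvd P"
proof (cases "P = 0")
  case False
  have "\<And>a. order a h \<le> order a P"
    using assms(2) False by (simp add: order_divides)
  then show ?thesis using \<open>h \<noteq> 0\<close> False
  proof (induction "degree h" arbitrary: h P)
    case 0
    then show ?case by (simp add: is_unit_iff_degree unit_imp_dvd)
  next
    case (Suc d)
    obtain a where a: "poly h a = 0"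
      using alg_closed_imp_poly_has_root[of h] Suc.hyps(2) by auto
    then obtain h' where h': "h = [:-a, 1:] * h'" by (auto simp: poly_eq_0_iff_dvd elim: dvdE)
    have "order a h \<noteq> 0" using a Suc.prems(2) by (simp add: order_root)
    then have "poly P a = 0" using Suc.prems(1)[of a] Suc.prems(3) by (simp add: order_root)
    then obtain P' where P': "P = [:-a, 1:] * P'" by (auto simp: poly_eq_0_iff_dvd elim: dvdE)
    have nz: "h' \<noteq> 0" "P' \<noteq> 0" using h' P' Suc.prems by auto
    have "order b h' \<le> order b P'" for b
      using Suc.prems(1)[of b] Suc.prems(2,3) unfolding h' P' by (simp add: order_mult del: mult_pCons_left)
    moreover have "d = degree h'"
      using Suc.hyps(2) nz unfolding h' by (simp add: degree_mult_eq del: mult_pCons_left)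
    ultimately have "h' dvd P'" using Suc.hyps(1) nz by blast
    then show ?case unfolding h' P' by (rule mult_dvd_mono[OF dvd_refl])
  qed
qed simp

text \<open>By \<open>u_top\<close> the binary form of u does not vanish at the omitted point (1,
  \<tau>). Hence its polynomial keeps degree n, and all points \<open>y i\<close> are visible on the
  affine line.\<close>

locale framed_divisor =
  fixes n k :: nat and y :: "nat \<Rightarrow> 'a::{alg_closed_field, field_char_0} \<times> 'a"
    and r :: "nat \<Rightarrow> nat" and u :: "nat \<Rightarrow> 'a" and W0 :: "(nat \<Rightarrow> 'a) set" and \<tau> :: 'a
  assumes y_nz: "i < k \<Longrightarrow> y i \<noteq> (0, 0)"
    and y_distinct: "i < k \<Longrightarrow> j < k \<Longrightarrow> i \<noteq> j \<Longrightarrow> \<not> proj_eq (y i) (y j)"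
    and r_pos: "i < k \<Longrightarrow> r i \<ge> 1"
    and int: "int_is n W0 (zsch k y r)"
    and lf_u: "lf n u" and W0: "W0 = phi n u"
    and u_top: "poly (vpoly n u) \<tau> \<noteq> 0"
begin

abbreviation D :: "(nat \<Rightarrow> 'a) \<Rightarrow> 'a poly" where "D \<equiv> dehom \<tau> (n + 2)"

definition f :: "'a poly" where "f = dehom \<tau> n u"

definition lam :: "nat \<Rightarrow> 'a" where "lam i = pcoord \<tau> (y i)"

lemma degree_f: "degree f = n" and f_nz: "f \<noteq> 0"
proof -
  have c: "coeff f n \<noteq> 0" using u_top by (simp add: f_def coeff_dehom_top)
  then show "f \<noteq> 0" by auto
  show "degree f = n"
    using le_degree[OF c] degree_dehom[of \<tau> n u] by (simp add: f_def)
qed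

lemma ann_W0_comb3: "ann n W0 = comb3 (shiftrow n u 0) (shiftrow n u 1) (shiftrow n u 2)"
  unfolding W0 phi_eq_ann comb3_eq_span
  by (intro ann_ann fn.subspace_span fn.span_minimal[OF _ subspace_amb]) (auto simp: shiftrow_in_amb)

lemma D_shiftrow:
  "D (shiftrow n u 0) = f * [:0, 0, 1:]" "D (shiftrow n u 1) = f * [:0, 1, \<tau>:]"
  "D (shiftrow n u 2) = f * [:1, 2 * \<tau>, \<tau> ^ 2:]"
  by (subst dehom_shiftrow[OF lf_u], simp, simp add: power2_eq_square f_def)+

lemma quadratic_eq: "degree g \<le> 2 \<Longrightarrow> g = [:coeff g 0, coeff g 1, coeff g 2:]" for g :: "'b::zero poly"
  by (intro poly_eqI) (auto simp: coeff_pCons coeff_eq_0 numeral_2_eq_2 split: nat.splits)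

lemma ann_W0_ex:
  assumes "degree g \<le> 2"
  obtains l where "l \<in> ann n W0" "D l = f * g"
proof -
  \<comment> \<open>The coordinates of g in the basis x^2, x (1 + \<tau> x), (1 + \<tau> x)^2,
    solved from the constant term upwards.\<close>
  define b c where "b = coeff g 1 - 2 * \<tau> * coeff g 0"
    and "c = coeff g 2 - \<tau> * b - \<tau> ^ 2 * coeff g 0"
  define l where "l x = c * shiftrow n u 0 x + b * shiftrow n u 1 x + coeff g 0 * shiftrow n u 2 x" for x
  have "D l = f * (smult c [:0, 0, 1:] + smult b [:0, 1, \<tau>:] + smult (coeff g 0) [:1, 2 * \<tau>, \<tau> ^ 2:])"
    unfolding dehom_comb3[of l, OF l_def] D_shiftrow by (simp only: mult_smult_right distrib_left)
  also have "smult c [:0, 0, 1:] + smult b [:0, 1, \<tau>:] + smult (coeff g 0) [:1, 2 * \<tau>, \<tau> ^ 2:] =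
      [:coeff g 0, coeff g 1, coeff g 2:]"
    by (simp add: b_def c_def algebra_simps)
  finally have "D l = f * g" by (simp only: quadratic_eq[OF assms, symmetric])
  moreover have "l \<in> ann n W0" unfolding ann_W0_comb3 comb3_def using l_def by blast
  ultimately show ?thesis by (rule that[rotated])
qed

lemma degree_cofactor: "degree (f * g) \<le> n + 2 \<Longrightarrow> degree g \<le> 2"
  using f_nz degree_f by (cases "g = 0") (simp_all add: degree_mult_eq)

text \<open>Since f has degree exactly n, a quotient by f has degree at most 2, and the three
  shifted rows reach every such quotient.\<close>

lemma ann_W0_iff: "l \<in> ann n W0 \<longleftrightarrow> l \<in> amb n \<and> f dvd D l"
proof
  assume l: "l \<in> ann n W0"
  then obtain a b c where *: "\<And>x. l x = a * shiftrow n u 0 x + b * shiftrow n u 1 x + c * shiftrow n u 2 x"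
    unfolding ann_W0_comb3 by (auto simp: comb3_def)
  have "f dvd D l" unfolding dehom_comb3[of l, OF *] D_shiftrow
    by (intro dvd_add dvd_smult dvd_triv_left)
  then show "l \<in> amb n \<and> f dvd D l" using l by (auto simp: ann_def)
next
  assume l: "l \<in> amb n \<and> f dvd D l"
  then obtain g where g: "D l = f * g" by (auto elim: dvdE)
  have "degree g \<le> 2" using degree_dehom[of \<tau> "n + 2" l] g degree_cofactor by simp
  then obtain l' where l': "l' \<in> ann n W0" "D l' = f * g" by (rule ann_W0_ex)
  have "l = l'" by (rule amb_dehom_inject[of _ n _ \<tau>]) (use l l' g in \<open>auto simp: ann_def\<close>)
  then show "l \<in> ann n W0" using l' by simp
qed

lemma zmult_at: "i < k \<Longrightarrow> zmult (zsch k y \<rho>) (y i) = \<rho> i"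
proof -
  assume i: "i < k"
  have "zmult (zsch k y \<rho>) (y i) = (\<Sum>j<k. if j = i then \<rho> j else 0)"
    unfolding zmult_zsch using y_distinct i by (intro sum.cong refl) (auto simp: proj_eq_def mult.commute)
  then show ?thesis using i by simp
qed

text \<open>The first row is the form of u times s^2 and does not vanish at the omitted point,
  whereas every equation of \<open>W0\<close> vanishes at \<open>y i\<close>.\<close>

lemma affine: "i < k \<Longrightarrow> snd (y i) \<noteq> \<tau> * fst (y i)"
proof
  assume i: "i < k" and inf: "snd (y i) = \<tau> * fst (y i)"
  have l: "shiftrow n u 0 \<in> ann n W0"
    unfolding ann_W0_comb3 comb3_eq_span by (rule fn.span_base) simp
  have "vpoly (n + 2) (shiftrow n u 0) = vpoly n u"
    by (rule poly_eqI) (auto simp: coeff_vpoly shiftrow_def)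
  then have "\<not> ord_ge n (shiftrow n u 0) (y i) 1"
    using u_top by (intro not_ord_ge_at_infinity[OF inf y_nz[OF i]]) auto
  moreover have "\<forall>l\<in>ann n W0. ord_ge n l (y i) 1"
    using int y_nz[OF i] r_pos[OF i] zmult_at[OF i, of r] unfolding int_is_def by metis
  ultimately show False using l by blast
qed

lemma lam_inj: "i < k \<Longrightarrow> j < k \<Longrightarrow> lam i = lam j \<longleftrightarrow> i = j"
  using y_distinct[of i j] proj_eq_pcoord[OF affine affine, of i j] by (auto simp: lam_def)

lemma zmult_affine:
  assumes "snd z \<noteq> \<tau> * fst z"
  shows "zmult (zsch k y \<rho>) z = (\<Sum>i<k. if lam i = pcoord \<tau> z then \<rho> i else 0)"
  unfolding zmult_zsch lam_def using assms
  by (intro sum.cong refl) (simp add: proj_eq_pcoord[of _ \<tau>] affine)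

lemma zmult_affine_lam:
  assumes "snd z \<noteq> \<tau> * fst z" "i < k" "pcoord \<tau> z = lam i"
  shows "zmult (zsch k y \<rho>) z = \<rho> i"
proof -
  have "zmult (zsch k y \<rho>) z = (\<Sum>j<k. if j = i then \<rho> j else 0)"
    unfolding zmult_affine[OF assms(1)] assms(3) by (intro sum.cong refl) (use assms(2) lam_inj in auto)
  then show ?thesis using assms(2) by simp
qed

lemma zmult_affine_other:
  assumes "snd z \<noteq> \<tau> * fst z" "pcoord \<tau> z \<notin> lam ` {..<k}"
  shows "zmult (zsch k y \<rho>) z = 0"
  unfolding zmult_affine[OF assms(1)] using assms(2) by (intro sum.neutral) (metis imageI)

lemma zmult_infinity:
  assumes "snd z = \<tau> * fst z" "z \<noteq> (0, 0)"
  shows "zmult (zsch k y \<rho>) z = 0"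
  unfolding zmult_zsch using proj_eq_infinity[OF assms] affine by (intro sum.neutral) (metis lessThan_iff)

text \<open>f is itself the polynomial of an equation of \<open>W0\<close> and divides all the
  others, so the intersection multiplicities of \<open>W0\<close> are the orders of f.\<close>

lemma dvd_f_iff:
  fixes a :: 'a
  defines "z \<equiv> (a, 1 + \<tau> * a)"
  shows "[:-a, 1:] ^ m dvd f \<longleftrightarrow> m \<le> zmult (zsch k y r) z"
    and "snd z \<noteq> \<tau> * fst z" "z \<noteq> (0, 0)" "pcoord \<tau> z = a"
proof -
  show z: "snd z \<noteq> \<tau> * fst z" "z \<noteq> (0, 0)" "pcoord \<tau> z = a"
    by (auto simp: z_def pcoord_def)
  obtain l1 where l1: "l1 \<in> ann n W0" "D l1 = f * 1" by (rule ann_W0_ex[of 1]) auto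
  have "m \<le> zmult (zsch k y r) z \<longleftrightarrow> (\<forall>l\<in>ann n W0. ord_ge n l z m)"
    using int z(2) unfolding int_is_def by blast
  also have "\<dots> \<longleftrightarrow> (\<forall>l\<in>ann n W0. [:-a, 1:] ^ m dvd D l)"
    using ord_ge_iff_dehom[OF z(1)] z(3) by simp
  also have "\<dots> \<longleftrightarrow> [:-a, 1:] ^ m dvd f"
  proof
    assume "\<forall>l\<in>ann n W0. [:-a, 1:] ^ m dvd D l"
    then have "[:-a, 1:] ^ m dvd D l1" using l1(1) by (rule bspec)
    then show "[:-a, 1:] ^ m dvd f" unfolding l1(2) by (simp only: mult_1_right)
  next
    assume d: "[:-a, 1:] ^ m dvd f"
    show "\<forall>l\<in>ann n W0. [:-a, 1:] ^ m dvd D l"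
    proof
      fix l assume "l \<in> ann n W0"
      then have "f dvd D l" by (simp only: ann_W0_iff)
      with d show "[:-a, 1:] ^ m dvd D l" by (rule dvd_trans)
    qed
  qed
  finally show "[:-a, 1:] ^ m dvd f \<longleftrightarrow> m \<le> zmult (zsch k y r) z" ..
qed

lemma order_f: "order a f = zmult (zsch k y r) (a, 1 + \<tau> * a)"
proof -
  have "m \<le> order a f \<longleftrightarrow> m \<le> zmult (zsch k y r) (a, 1 + \<tau> * a)" for m
    using dvd_f_iff(1)[of a m] f_nz by (simp add: order_divides)
  then show ?thesis by (meson order.refl antisym)
qed

lemma order_f_lam: "i < k \<Longrightarrow> order (lam i) f = r i"
  unfolding order_f by (rule zmult_affine_lam) (simp_all add: dvd_f_iff)

lemma root_f_is_lam: "poly f a = 0 \<Longrightarrow> \<exists>i<k. a = lam i"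
proof (rule ccontr)
  assume a: "poly f a = 0" "\<not> (\<exists>i<k. a = lam i)"
  then have "order a f = 0"
    unfolding order_f by (intro zmult_affine_other) (auto simp: dvd_f_iff)
  then show False using a f_nz by (simp add: order_root)
qed

lemma hyp_has_iff: "hyp_has n l (zsch k y \<rho>) \<longleftrightarrow> (\<forall>i<k. [:- lam i, 1:] ^ \<rho> i dvd D l)"
proof
  assume h: "hyp_has n l (zsch k y \<rho>)"
  show "\<forall>i<k. [:- lam i, 1:] ^ \<rho> i dvd D l"
  proof (intro allI impI)
    fix i assume i: "i < k"
    have "ord_ge n l (y i) (\<rho> i)" using h y_nz[OF i] zmult_at[OF i, of \<rho>] unfolding hyp_has_def by metis
    then show "[:- lam i, 1:] ^ \<rho> i dvd D l"
      using ord_ge_iff_dehom[OF affine[OF i]] by (simp only: lam_def)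
  qed
next
  assume h: "\<forall>i<k. [:- lam i, 1:] ^ \<rho> i dvd D l"
  show "hyp_has n l (zsch k y \<rho>)"
    unfolding hyp_has_def
  proof (intro allI impI)
    fix z :: "'a \<times> 'a" assume z: "z \<noteq> (0, 0)"
    show "ord_ge n l z (zmult (zsch k y \<rho>) z)"
    proof (cases "snd z = \<tau> * fst z")
      case True
      then show ?thesis using zmult_infinity[OF True z, of \<rho>] by (simp add: ord_ge_def)
    next
      case False
      show ?thesis
      proof (cases "pcoord \<tau> z \<in> lam ` {..<k}")
        case True
        then obtain i where i: "i < k" "pcoord \<tau> z = lam i" by auto
        show ?thesis
          unfolding ord_ge_iff_dehom[OF False] zmult_affine_lam[OF False i] i(2) using h i(1) by blast
      next
        case other: False
        show ?thesis using zmult_affine_other[OF False other, of \<rho>] by (simp add: ord_ge_def)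
      qed
    qed
  qed
qed

lemma hyp_has_single_iff:
  assumes i: "i < k"
  shows "hyp_has n l [(y i, m)] \<longleftrightarrow> [:- lam i, 1:] ^ m dvd D l"
proof -
  let ?\<rho> = "\<lambda>j. if j = i then m else 0"
  have "zmult [(y i, m)] z = zmult (zsch k y ?\<rho>) z" for z
  proof -
    have "zmult (zsch k y ?\<rho>) z = (\<Sum>j<k. if j = i then (if proj_eq (y i) z then m else 0) else 0)"
      unfolding zmult_zsch by (intro sum.cong) auto
    then show ?thesis using i by (simp add: zmult_def)
  qed
  then have "hyp_has n l [(y i, m)] \<longleftrightarrow> hyp_has n l (zsch k y ?\<rho>)" by (simp add: hyp_has_def)
  then show ?thesis using i by (auto simp: hyp_has_iff split: if_splits)
qed

end

section \<open>Codimension one\<close>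

text \<open>Points of the ambient space are functionals on binary forms of degree n + 2, their
  coordinates being the values on the coordinate forms. A point can thus be prescribed by a Taylor
  coefficient.\<close>

lemma dotp_functional:
  fixes \<psi> :: "'a::field poly \<Rightarrow> 'a"
  assumes "linfun \<psi>"
  shows "dotp n l (\<lambda>j. if j < n + 3 then \<psi> (dehom \<tau> (n + 2) (unitv j)) else 0) = \<psi> (dehom \<tau> (n + 2) l)"
proof -
  have e: "dehom \<tau> (n + 2) (unitv j) = [:0, 1:] ^ (n + 2 - j) * [:1, \<tau>:] ^ j" if "j \<le> n + 2" for j
  proof -
    have "dehom \<tau> (n + 2) (unitv j) =
        (\<Sum>i\<le>n + 2. if i = j then [:0, 1:] ^ (n + 2 - j) * [:1, \<tau>:] ^ j else 0)"
      unfolding dehom_sum by (intro sum.cong refl) (simp add: unitv_def)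
    then show ?thesis using that by simp
  qed
  have I: "{..<n + 3} = {..n + 2}" by auto
  have "dotp n l (\<lambda>j. if j < n + 3 then \<psi> (dehom \<tau> (n + 2) (unitv j)) else 0)
      = (\<Sum>j\<le>n + 2. l j * \<psi> ([:0, 1:] ^ (n + 2 - j) * [:1, \<tau>:] ^ j))"
    unfolding dotp_def I by (intro sum.cong refl) (simp add: e del: add_2_eq_Suc')
  also have "\<dots> = \<psi> (dehom \<tau> (n + 2) l)"
    unfolding dehom_sum linfun_sum[OF assms] linfun_smult[OF assms] ..
  finally show ?thesis .
qed

definition taylor :: "'a::field \<Rightarrow> nat \<Rightarrow> 'a poly \<Rightarrow> 'a" where
  "taylor a e P = coeff (P \<circ>\<^sub>p [:a, 1:]) e"

lemma linfun_taylor: "linfun (taylor a e)"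
  by (simp add: linfun_def taylor_def pcompose_add pcompose_smult)

lemma taylor_power_mult: "taylor a e ([:-a, 1:] ^ e * g) = poly g a"
proof -
  have "[:0, 1:] ^ e = (monom 1 e :: 'a poly)" by (simp add: monom_altdef)
  then have "taylor a e ([:-a, 1:] ^ e * g) = coeff (g \<circ>\<^sub>p [:a, 1:]) 0"
    by (simp add: taylor_def pcompose_mult pcompose_power pcompose_pCons coeff_monom_mult)
  then show ?thesis by (simp add: poly_pcompose flip: poly_0_coeff_0)
qed

lemma order_linear: "order a [:-b, 1:] = (if a = b then 1 else 0)" for a :: "'a::field"
proof (cases "a = b")
  case True
  then show ?thesis using order_power_n_n[of a 1] by simp
next
  case False
  then show ?thesis by (simp add: order_0I)
qed

lemma sch_span_eq_ann: "sch_span n Z = ann n {l \<in> amb n. hyp_has n l Z}"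
  unfolding sch_span_def ann_def by (auto simp: dotp_commute)

lemma sch_span_subset_amb: "sch_span n Z \<subseteq> amb n"
  by (auto simp: sch_span_def)

lemma comb3I: "(\<And>x. l x = a * u1 x + b * u2 x + c * u3 x) \<Longrightarrow> l \<in> comb3 u1 u2 u3"
  unfolding comb3_def by blast

text \<open>The condition \<open>u1_top\<close> keeps the omitted point off \<open>W\<close>, so the
  affine line shows the whole intersection of \<open>W\<close> with the curve.\<close>

locale framed_osculation = framed_divisor +
  fixes W :: "(nat \<Rightarrow> 'a) set" and u1 u2 u3 :: "nat \<Rightarrow> 'a"
  assumes cut: "cut_by n u1 u2 u3 W"
    and osc_u: "osc (dehom \<tau> n u) (dehom \<tau> (n + 2) u1) (dehom \<tau> (n + 2) u2) (dehom \<tau> (n + 2) u3)"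
    and u1_top: "poly (vpoly (n + 2) u1) \<tau> \<noteq> 0"
begin

abbreviation U :: "(nat \<Rightarrow> 'a) set" where "U \<equiv> comb3 u1 u2 u3"

lemma ann_W: "ann n W = U" and W_eq: "W = ann n U" and ind3_u: "ind3 u1 u2 u3"
  using ann_cut_by[OF cut] by auto

lemma W_subset_amb: "W \<subseteq> amb n" and W0_subset_amb: "W0 \<subseteq> amb n" and U_subset_amb: "U \<subseteq> amb n"
  using W_eq ann_subset_amb[of n] ann_W by (auto simp: W0 phi_eq_ann)

lemma W0_eq: "W0 = ann n (ann n W0)"
  unfolding W0 phi_eq_ann by (rule ann_ann[symmetric, OF subspace_ann ann_subset_amb])

lemma osc_U:
  assumes "l1 \<in> U" "l2 \<in> U" "l3 \<in> U"
  shows "osc f (D l1) (D l2) (D l3)"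
proof -
  have *: "\<exists>a b c. D l = smult a (D u1) + smult b (D u2) + smult c (D u3)" if "l \<in> U" for l
  proof -
    obtain a b c where "\<And>x. l x = a * u1 x + b * u2 x + c * u3 x"
      using \<open>l \<in> U\<close> by (auto simp: comb3_def)
    from dehom_comb3[of l, OF this] show ?thesis by blast
  qed
  obtain a1 a2 a3 b1 b2 b3 c1 c2 c3 where
    "D l1 = smult a1 (D u1) + smult a2 (D u2) + smult a3 (D u3)"
    "D l2 = smult b1 (D u1) + smult b2 (D u2) + smult b3 (D u3)"
    "D l3 = smult c1 (D u1) + smult c2 (D u2) + smult c3 (D u3)"
    using *[OF assms(1)] *[OF assms(2)] *[OF assms(3)] by blast
  from osc_combination[OF osc_u[folded f_def] this] show ?thesis .
qed

lemma D_add_scaled: "D (\<lambda>x. a * l x + b * l' x) = smult a (D l) + smult b (D l')"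
  by (rule dehom_combination)

lemma amb_add_scaled: "l \<in> amb n \<Longrightarrow> l' \<in> amb n \<Longrightarrow> (\<lambda>x. a * l x + b * l' x) \<in> amb n"
  by (simp add: amb_def)

lemma dotp_add_scaled: "dotp n (\<lambda>x. a * l x + b * l' x) v = a * dotp n l v + b * dotp n l' v"
  by (simp add: dotp_def distrib_right sum.distrib sum_distrib_left mult.assoc)

lemma codim_one:
  assumes "vdim_eq (lspan (W \<union> W0)) (n + 2)"
  shows "\<exists>i1<k. \<exists>i2<k. i1 \<noteq> i2 \<and>
         int_is n W (zsch k y (\<lambda>j. if j = i1 \<or> j = i2 then r j - 1 else r j)) \<and>
         W \<inter> W0 = sch_span n (zsch k y (\<lambda>j. if j = i1 \<or> j = i2 then r j - 1 else r j)) \<and>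
         (\<exists>q1 q2. q1 \<noteq> (\<lambda>_. 0) \<and> q1 \<in> sch_span n [(y i1, r i1 + 1)] \<and>
                  q2 \<noteq> (\<lambda>_. 0) \<and> q2 \<in> sch_span n [(y i2, r i2 + 1)] \<and>
                  sch_in n (lspan (W \<union> {q1})) [(y i1, r i1 + 1)] \<and>
                  sch_in n (lspan (W \<union> {q2})) [(y i2, r i2 + 1)])"
proof -
  have sub: "lspan (W \<union> W0) \<subseteq> amb n"
    unfolding lspan_eq_span using W_subset_amb W0_subset_amb by (intro fn.span_minimal subspace_amb) auto
  have UU0: "ann n (lspan (W \<union> W0)) = U \<inter> ann n W0"
    unfolding ann_lspan_Un ann_W ..
  obtain g where g: "g \<in> U" "g \<in> ann n W0" "g \<noteq> (\<lambda>_. 0)"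
    and g_only: "\<And>l. l \<in> U \<Longrightarrow> l \<in> ann n W0 \<Longrightarrow> \<exists>a. \<forall>x. l x = a * g x"
    using ann_codim_1[OF assms sub] unfolding UU0 by (metis IntD1 IntD2 IntI)
  obtain l2 l3 where l: "ind3 g l2 l3" "comb3 g l2 l3 = U"
    using comb3_extend1[OF ind3_u g(1,3)] by metis
  have lU: "l2 \<in> U" "l3 \<in> U"
    unfolding l(2)[symmetric] unfolding comb3_eq_span by (auto intro: fn.span_base)
  have lamb: "l2 \<in> amb n" "l3 \<in> amb n" "g \<in> amb n" using lU g U_subset_amb by auto
  obtain q where q: "D g = f * q" using g(2) by (auto simp: ann_W0_iff elim: dvdE)
  have dq: "degree q \<le> 2" using degree_dehom[of \<tau> "n + 2" g] degree_cofactor q by simp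
  have q_nz: "q \<noteq> 0"
  proof
    assume "q = 0"
    then have "D g = D (\<lambda>_. 0)" using q by (simp add: dehom_sum)
    then have "g = (\<lambda>_. 0)" using lamb(3) by (intro amb_dehom_inject[of g n _ \<tau>]) (auto simp: amb_def)
    then show False using g(3) by simp
  qed
  \<comment> \<open>A combination divisible by f is an equation of both spaces, hence a multiple of
    g, against the independence of g, l2, l3.\<close>
  have ind: "a = 0 \<and> b = 0" if "f dvd smult a (D l2) + smult b (D l3)" for a b
  proof -
    let ?l = "\<lambda>x. a * l2 x + b * l3 x"
    have "?l \<in> ann n W0"
      unfolding ann_W0_iff D_add_scaled using that amb_add_scaled lamb by simp
    moreover have "?l \<in> U" unfolding l(2)[symmetric]
      by (rule comb3I[where a = 0 and b = a and c = b]) simp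
    ultimately obtain c where "\<forall>x. ?l x = c * g x" using g_only by blast
    then have "\<forall>x. (- c) * g x + a * l2 x + b * l3 x = 0"
      by (simp only: add.assoc) simp
    then show ?thesis using l(1) unfolding ind3_def by blast
  qed
  have "osc f (f * q) (D l2) (D l3)" using osc_U[OF g(1) lU] unfolding q .
  then obtain h m2 m3 c s t where st: "s \<noteq> t" and c: "c \<noteq> 0" and qst: "q = smult c ([:-s, 1:] * [:-t, 1:])"
    and h: "f = q * h" "D l2 = h * m2" "D l3 = h * m3"
    and span: "\<And>g. \<exists>a b. q dvd smult a m2 + smult b m3 - g"
    and loc: "\<And>a b z. z \<in> {s, t} \<Longrightarrow> poly (smult a m2 + smult b m3) z = 0 \<Longrightarrow>
       [:-z, 1:] ^ 2 dvd smult a m2 + smult b m3"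
    using osc_structure[OF _ f_nz dq q_nz ind] by metis
  have h_nz: "h \<noteq> 0" using f_nz h by auto
  have roots: "poly f s = 0" "poly f t = 0"
    unfolding h(1) qst poly_mult poly_smult by simp_all
  obtain i1 where i1: "i1 < k" "lam i1 = s" using root_f_is_lam[OF roots(1)] by auto
  obtain i2 where i2: "i2 < k" "lam i2 = t" using root_f_is_lam[OF roots(2)] by auto
  have "i1 \<noteq> i2" using st i1 i2 by auto
  define \<rho> where "\<rho> = (\<lambda>j. if j = i1 \<or> j = i2 then r j - 1 else r j)"
  have "order a q = (if a = s then 1 else 0) + (if a = t then 1 else 0)" for a
  proof -
    have nz: "[:-s, 1:] * [:-t, 1:] \<noteq> 0" by (simp only: mult_eq_0_iff) simp
    show ?thesis unfolding qst order_smult[OF c] order_mult[OF nz] order_linear ..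
  qed
  then have order_h: "order a f = (if a = s then 1 else 0) + (if a = t then 1 else 0) + order a h" for a
    using f_nz unfolding h(1) by (simp add: order_mult)
  have order_h_lam: "order (lam i) h = \<rho> i" if "i < k" for i
  proof -
    have "lam i = s \<longleftrightarrow> i = i1" "lam i = t \<longleftrightarrow> i = i2"
      using lam_inj[OF that i1(1)] lam_inj[OF that i2(1)] i1(2) i2(2) by auto
    then show ?thesis
      using order_h[of "lam i"] order_f_lam[OF that] \<open>i1 \<noteq> i2\<close> by (auto simp: \<rho>_def split: if_splits)
  qed
  have order_h_other: "order a h = 0" if "a \<notin> lam ` {..<k}" for a
  proof -
    have "poly f a \<noteq> 0" using root_f_is_lam[of a] that by auto
    then show ?thesis using order_h[of a] by (simp add: order_0I)
  qed
  have h_dvd: "h dvd P \<longleftrightarrow> (\<forall>i<k. [:- lam i, 1:] ^ \<rho> i dvd P)" for P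
  proof
    assume "h dvd P"
    then show "\<forall>i<k. [:- lam i, 1:] ^ \<rho> i dvd P"
      using order_1[of _ h] order_h_lam by (metis dvd_trans)
  next
    assume *: "\<forall>i<k. [:- lam i, 1:] ^ \<rho> i dvd P"
    show "h dvd P"
    proof (rule dvd_if_order_le[OF h_nz])
      fix a
      show "[:-a, 1:] ^ order a h dvd P"
        using * order_h_lam order_h_other[of a] by (cases "a \<in> lam ` {..<k}") auto
    qed
  qed
  have Dg: "D g = h * (q * q)" using q h(1) by (simp add: mult_ac)
  have U_form: "\<exists>a b c. D l = h * (smult a (q * q) + (smult b m2 + smult c m3))" if "l \<in> U" for l
  proof -
    obtain a b c where *: "\<And>x. l x = a * g x + b * l2 x + c * l3 x"
      using \<open>l \<in> U\<close>[folded l(2)] by (auto simp: comb3_def)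
    have "D l = h * (smult a (q * q) + (smult b m2 + smult c m3))"
      unfolding dehom_comb3[of l, OF *] Dg h(2,3) by (simp only: distrib_left mult_smult_right add.assoc)
    then show ?thesis by blast
  qed
  have U_dvd: "h dvd D l" if "l \<in> U" for l using U_form[OF that] by auto
  \<comment> \<open>The cofactors of h have no common zero: at a root of q a member congruent to 1
    modulo q serves, elsewhere g with cofactor q^2. So \<open>W\<close> meets the curve exactly in
    the divisor of h.\<close>
  have U_ex: "\<exists>l\<in>U. \<exists>m. D l = h * m \<and> poly m a \<noteq> 0" for a
  proof (cases "poly q a = 0")
    case True
    obtain a' b' p where p: "smult a' m2 + smult b' m3 - 1 = q * p" using span[of 1] by (auto elim: dvdE)
    let ?l = "\<lambda>x. a' * l2 x + b' * l3 x"
    have "?l \<in> U" unfolding l(2)[symmetric]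
      by (rule comb3I[where a = 0 and b = a' and c = b']) simp
    moreover have "D ?l = h * (smult a' m2 + smult b' m3)"
      unfolding D_add_scaled h by (simp add: algebra_simps)
    moreover have "poly (smult a' m2 + smult b' m3) a = 1"
      using arg_cong[OF p, of "\<lambda>p. poly p a"] True by simp
    ultimately show ?thesis by (metis zero_neq_one)
  next
    case False
    have "poly (q * q) a \<noteq> 0" using False by simp
    then show ?thesis using g(1) Dg by blast
  qed
  have order_crit: "(\<forall>l\<in>U. [:-a, 1:] ^ m dvd D l) \<longleftrightarrow> m \<le> order a h" for a m
  proof
    assume *: "\<forall>l\<in>U. [:-a, 1:] ^ m dvd D l"
    obtain l' m' where l': "l' \<in> U" "D l' = h * m'" "poly m' a \<noteq> 0" using U_ex by blast
    obtain h0 where h0: "h = [:-a, 1:] ^ order a h * h0" "poly h0 a \<noteq> 0" by (rule order_factor[OF h_nz])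
    have "D l' = [:-a, 1:] ^ order a h * (h0 * m')"
      unfolding l'(2) by (subst (1) h0(1)) (simp only: mult.assoc)
    moreover have "poly (h0 * m') a \<noteq> 0" using h0(2) l'(3) by simp
    ultimately show "m \<le> order a h" using linear_power_dvd_iff * l'(1) by blast
  next
    assume "m \<le> order a h"
    then have "[:-a, 1:] ^ m dvd h" using h_nz by (simp add: order_divides)
    then show "\<forall>l\<in>U. [:-a, 1:] ^ m dvd D l" using U_dvd dvd_trans by blast
  qed
  have int_W: "int_is n W (zsch k y \<rho>)"
    unfolding int_is_def ann_W
  proof (intro allI impI)
    fix z :: "'a \<times> 'a" and m assume z: "z \<noteq> (0, 0)"
    show "(\<forall>l\<in>U. ord_ge n l z m) \<longleftrightarrow> m \<le> zmult (zsch k y \<rho>) z"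
    proof (cases "snd z = \<tau> * fst z")
      case True
      have u1U: "u1 \<in> U" unfolding comb3_eq_span by (simp add: fn.span_base)
      have "m > 0 \<Longrightarrow> \<not> ord_ge n u1 z m" by (rule not_ord_ge_at_infinity[OF True z u1_top])
      moreover have "ord_ge n l z 0" for l by (simp add: ord_ge_def)
      ultimately show ?thesis
        unfolding zmult_infinity[OF True z] using u1U by (cases "m = 0") auto
    next
      case False
      have "zmult (zsch k y \<rho>) z = order (pcoord \<tau> z) h"
      proof (cases "pcoord \<tau> z \<in> lam ` {..<k}")
        case True
        then obtain i where i: "i < k" "pcoord \<tau> z = lam i" by auto
        show ?thesis unfolding zmult_affine_lam[OF False i] i(2) order_h_lam[OF i(1)] ..
      next
        case other: False
        show ?thesis unfolding zmult_affine_other[OF False other] order_h_other[OF other] ..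
      qed
      then show ?thesis unfolding ord_ge_iff_dehom[OF False] order_crit by simp
    qed
  qed
  have inter: "W \<inter> W0 = sch_span n (zsch k y \<rho>)"
  proof
    show "W \<inter> W0 \<subseteq> sch_span n (zsch k y \<rho>)"
    proof
      fix v assume v: "v \<in> W \<inter> W0"
      then have vU: "dotp n l v = 0" if "l \<in> U" for l
        using that unfolding ann_W[symmetric] by (simp add: ann_def)
      have vU0: "dotp n l v = 0" if "l \<in> ann n W0" for l using v that by (simp add: ann_def)
      have "dotp n l v = 0" if la: "l \<in> amb n" and hl: "hyp_has n l (zsch k y \<rho>)" for l
      proof -
        obtain p where p: "D l = h * p" using hl unfolding hyp_has_iff h_dvd[symmetric] by (auto elim: dvdE)
        \<comment> \<open>Modulo f = q h every multiple of h is a combination of \<open>D l2\<close>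
          and \<open>D l3\<close>. A form vanishing on the scheme is thus an equation of
          \<open>W\<close> plus one of \<open>W0\<close>.\<close>
        obtain a b e where e: "smult a m2 + smult b m3 - p = q * e" using span[of p] by (auto elim: dvdE)
        let ?l' = "\<lambda>x. a * l2 x + b * l3 x"
        let ?l = "\<lambda>x. 1 * ?l' x + (-1) * l x"
        have "D ?l = h * (smult a m2 + smult b m3 - p)"
          unfolding D_add_scaled[of 1 ?l'] D_add_scaled[of a] h p by (simp add: algebra_simps)
        also have "\<dots> = f * e" unfolding e h(1) by (simp only: mult_ac)
        finally have "f dvd D ?l" by simp
        moreover have "?l \<in> amb n" by (intro amb_add_scaled la lamb)
        ultimately have "?l \<in> ann n W0" by (simp only: ann_W0_iff)
        then have "dotp n ?l v = 0" by (rule vU0)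
        then show ?thesis
          unfolding dotp_add_scaled[of 1 ?l'] dotp_add_scaled[of a] using vU lU by simp
      qed
      then show "v \<in> sch_span n (zsch k y \<rho>)" using v W_subset_amb by (auto simp: sch_span_def)
    qed
    show "sch_span n (zsch k y \<rho>) \<subseteq> W \<inter> W0"
    proof
      fix v assume v: "v \<in> sch_span n (zsch k y \<rho>)"
      have *: "dotp n v l = 0" if "l \<in> amb n" "h dvd D l" for l
        using v that unfolding sch_span_def hyp_has_iff h_dvd by (simp add: dotp_commute)
      have "v \<in> amb n" using v by (simp add: sch_span_def)
      have "v \<in> ann n U" using * U_dvd U_subset_amb \<open>v \<in> amb n\<close> by (auto simp: ann_def)
      moreover have "dotp n v l = 0" if "l \<in> ann n W0" for l
      proof (rule *)
        show "l \<in> amb n" using that by (simp only: ann_W0_iff)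
        have "q * h dvd D l" using that unfolding ann_W0_iff h(1) ..
        then show "h dvd D l" by (rule dvd_mult_right)
      qed
      then have "v \<in> ann n (ann n W0)" using \<open>v \<in> amb n\<close> unfolding ann_def[of n "ann n W0"] by blast
      ultimately show "v \<in> W \<inter> W0" using W_eq W0_eq by blast
    qed
  qed
  have Q: "\<exists>p. p \<noteq> (\<lambda>_. 0) \<and> p \<in> sch_span n [(y i, r i + 1)] \<and> sch_in n (lspan (W \<union> {p})) [(y i, r i + 1)]"
    if i: "i < k" "lam i \<in> {s, t}" for i
  proof -
    let ?z = "lam i" and ?e = "r i - 1"
    \<comment> \<open>The point Q' as the Taylor coefficient of order r_i - 1 at
      \<open>lam i\<close>, the order of h there. It kills all multiples of (x - lam i)^(r_i + 1),
      so it lies in the osculating space; on U it reads, up to a nonzero factor, the value of the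
      cofactor of h.\<close>
    define p where "p = (\<lambda>j. if j < n + 3 then taylor ?z ?e (D (unitv j)) else 0)"
    have dp: "dotp n l p = taylor ?z ?e (D l)" for l
      unfolding p_def by (rule dotp_functional[OF linfun_taylor])
    have "i = i1 \<or> i = i2" using i i1 i2 lam_inj by auto
    then have "\<rho> i = ?e" by (auto simp: \<rho>_def)
    then obtain h0 where h0: "h = [:- ?z, 1:] ^ ?e * h0" "poly h0 ?z \<noteq> 0"
      using order_factor[OF h_nz, of ?z] order_h_lam[OF i(1)] by metis
    have th: "taylor ?z ?e (h * m) = poly h0 ?z * poly m ?z" for m
      using taylor_power_mult[of ?z ?e "h0 * m"] by (subst h0(1)) (simp add: mult.assoc)
    obtain l' m' where l': "D l' = h * m'" "poly m' ?z \<noteq> 0" using U_ex by blast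
    have "dotp n l' p \<noteq> 0" unfolding dp l' th using l' h0 by simp
    then have "p \<noteq> (\<lambda>_. 0)" by auto
    moreover have "p \<in> sch_span n [(y i, r i + 1)]"
      unfolding sch_span_def
    proof (intro CollectI conjI ballI impI)
      show "p \<in> amb n" by (simp add: p_def amb_def)
      fix l assume "hyp_has n l [(y i, r i + 1)]"
      then obtain m where m: "D l = [:- ?z, 1:] ^ (r i + 1) * m"
        unfolding hyp_has_single_iff[OF i(1)] by (auto elim: dvdE)
      have "r i + 1 = ?e + 2" using r_pos[OF i(1)] by simp
      then have "D l = [:- ?z, 1:] ^ ?e * ([:- ?z, 1:] ^ 2 * m)"
        unfolding m by (simp only: power_add mult.assoc)
      then show "dotp n l p = 0" unfolding dp by (simp only: taylor_power_mult) simp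
    qed
    moreover have "sch_in n (lspan (W \<union> {p})) [(y i, r i + 1)]"
      unfolding sch_in_def
    proof
      fix l assume "l \<in> ann n (lspan (W \<union> {p}))"
      then have lp: "l \<in> U" "dotp n l p = 0"
        unfolding ann_lspan_Un ann_W by (auto simp: ann_def)
      obtain a b c where abc: "D l = h * (smult a (q * q) + (smult b m2 + smult c m3))"
        using U_form[OF lp(1)] by blast
      have "poly q ?z = 0" unfolding qst poly_mult poly_smult using i(2) by auto
      then obtain q' where q': "q = [:- ?z, 1:] * q'" by (auto simp: poly_eq_0_iff_dvd elim: dvdE)
      have "poly (smult a (q * q) + (smult b m2 + smult c m3)) ?z = 0"
        using lp(2) h0(2) unfolding dp abc th by (simp only: mult_eq_0_iff) blast
      \<comment> \<open>The multiple of q^2 already vanishes doubly at a root of q. The condition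
        falls on the pencil, where \<open>loc\<close> turns a zero into a double one and raises the
        order to r_i - 1 + 2.\<close>
      then have "poly (smult b m2 + smult c m3) ?z = 0" using \<open>poly q ?z = 0\<close> by simp
      then have d1: "[:- ?z, 1:] ^ 2 dvd smult b m2 + smult c m3" by (rule loc[OF i(2)])
      have "q * q = [:- ?z, 1:] ^ 2 * (q' * q')"
        unfolding q' by (simp only: power2_eq_square mult_ac)
      then have d2: "[:- ?z, 1:] ^ 2 dvd smult a (q * q)" by (simp only: dvd_smult dvd_triv_left)
      have "[:- ?z, 1:] ^ ?e * [:- ?z, 1:] ^ 2 dvd D l"
        unfolding abc by (intro mult_dvd_mono dvd_add d1 d2) (rule dvdI[OF h0(1)])
      moreover have "r i + 1 = ?e + 2" using r_pos[OF i(1)] by simp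
      ultimately show "hyp_has n l [(y i, r i + 1)]"
        unfolding hyp_has_single_iff[OF i(1)] by (simp only: power_add)
    qed
    ultimately show ?thesis by blast
  qed
  obtain p1 where "p1 \<noteq> (\<lambda>_. 0)" "p1 \<in> sch_span n [(y i1, r i1 + 1)]" "sch_in n (lspan (W \<union> {p1})) [(y i1, r i1 + 1)]"
    using Q[OF i1(1)] i1(2) by auto
  moreover obtain p2 where "p2 \<noteq> (\<lambda>_. 0)" "p2 \<in> sch_span n [(y i2, r i2 + 1)]" "sch_in n (lspan (W \<union> {p2})) [(y i2, r i2 + 1)]"
    using Q[OF i2(1)] i2(2) by auto
  ultimately show ?thesis
    using int_W inter i1(1) i2(1) \<open>i1 \<noteq> i2\<close> unfolding \<rho>_def by blast
qed

end

section \<open>Codimension two\<close>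

text \<open>Squares with distinct roots are independent, as evaluation at either root shows, so two
  of them in a pencil form a basis.\<close>

lemma pencil_spanned_by_squares:
  fixes q1 q2 :: "'a::field poly"
  assumes "a \<noteq> b" and sq: "[:-a, 1:] ^ 2 = smult a1 q1 + smult b1 q2" "[:-b, 1:] ^ 2 = smult a2 q1 + smult b2 q2"
  shows "\<exists>p s. smult x q1 + smult y q2 = smult p ([:-a, 1:] ^ 2) + smult s ([:-b, 1:] ^ 2)"
proof -
  obtain p s where ps: "p * a1 + s * a2 = x" "p * b1 + s * b2 = y"
  proof (rule solve_two_by_two)
    fix p s assume *: "p * a1 + s * a2 = 0" "p * b1 + s * b2 = 0"
    have "smult p ([:-a, 1:] ^ 2) + smult s ([:-b, 1:] ^ 2) = smult (p * a1 + s * a2) q1 + smult (p * b1 + s * b2) q2"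
      unfolding sq by (simp add: smult_add_left smult_add_right)
    then have "smult p ([:-a, 1:] ^ 2) + smult s ([:-b, 1:] ^ 2) = 0" using * by simp
    then have "poly (smult p ([:-a, 1:] ^ 2) + smult s ([:-b, 1:] ^ 2)) z = 0" for z by simp
    from this[of a] this[of b] show "p = 0 \<and> s = 0" using \<open>a \<noteq> b\<close> by simp
  qed
  have "smult x q1 + smult y q2 = smult p ([:-a, 1:] ^ 2) + smult s ([:-b, 1:] ^ 2)"
    unfolding sq ps[symmetric] by (simp add: smult_add_left smult_add_right)
  then show ?thesis by blast
qed

text \<open>The squares trace a conic in the plane of quadratic polynomials, and a line meets it at
  most twice. Comparing coefficients gives p (1 - p) (a - b)^2 = 0.\<close>

lemma third_square_independent:
  fixes a b c :: "'a::field_char_0"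
  assumes "[:-c, 1:] ^ 2 = smult p ([:-a, 1:] ^ 2) + smult s ([:-b, 1:] ^ 2)" "a \<noteq> b"
  shows "c = a \<or> c = b"
proof -
  have e: "[:-z, 1:] ^ 2 = [:z ^ 2, - (2 * z), 1:]" for z :: 'a
    by (simp add: power2_eq_square)
  have "p + s = 1" "2 * c = 2 * (p * a + s * b)" "c ^ 2 = p * a ^ 2 + s * b ^ 2"
    using assms(1) unfolding e by (simp_all add: algebra_simps)
  then have "s = 1 - p" "c = p * a + s * b" "c ^ 2 = p * a ^ 2 + s * b ^ 2"
    by (simp_all only: mult_cancel_left) (simp_all add: eq_diff_eq add.commute)
  then have "p * (1 - p) * (a - b) ^ 2 = 0" by algebra
  then have "p = 0 \<or> p = 1" using \<open>a \<noteq> b\<close> by auto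
  then show ?thesis using \<open>c = _\<close> \<open>s = _\<close> by auto
qed

context framed_osculation
begin

lemma D_add: "D (v + w) = D v + D w"
  and D_scale: "D (\<lambda>x. c * v x) = smult c (D v)"
  and D_zero: "D 0 = 0"
  unfolding dehom_sum
  by (simp_all add: smult_add_left sum.distrib smult_sum_right del: add_2_eq_Suc')

text \<open>A multiple f g has two extra orders at \<open>lam i\<close> exactly if (x - lam i)^2
  divides g, and g has degree at most 2.\<close>

lemma ann_osculating_sum:
  assumes i: "i < k"
  shows "ann n (lspan (W0 \<union> sch_span n [(y i, r i + 2)])) =
    {l \<in> amb n. \<exists>c. D l = f * smult c ([:- lam i, 1:] ^ 2)}"
proof -
  let ?P = "[:- lam i, 1:]"
  have "fn.subspace {l \<in> amb n. ?P ^ (r i + 2) dvd D l}"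
    using subspace_amb[of n, unfolded fn.subspace_def]
    unfolding fn.subspace_def by (auto simp: D_add D_scale D_zero simp del: add_2_eq_Suc' intro: dvd_add dvd_smult)
  then have S: "ann n (sch_span n [(y i, r i + 2)]) = {l \<in> amb n. ?P ^ (r i + 2) dvd D l}"
    unfolding sch_span_eq_ann hyp_has_single_iff[OF i] by (rule ann_ann) auto
  have "l \<in> ann n W0 \<and> ?P ^ (r i + 2) dvd D l \<longleftrightarrow> (\<exists>c. D l = f * smult c (?P ^ 2))" if l: "l \<in> amb n" for l
  proof
    assume *: "l \<in> ann n W0 \<and> ?P ^ (r i + 2) dvd D l"
    then obtain g where g: "D l = f * g" unfolding ann_W0_iff by (auto elim: dvdE)
    have dg: "degree g \<le> 2" using degree_dehom[of \<tau> "n + 2" l] g degree_cofactor by simp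
    show "\<exists>c. D l = f * smult c (?P ^ 2)"
    proof (cases "g = 0")
      case True
      then show ?thesis using g by (intro exI[of _ 0]) simp
    next
      case False
      then have "r i + 2 \<le> order (lam i) (f * g)"
        using * g f_nz unfolding order_divides by simp
      then have "2 \<le> order (lam i) g"
        using f_nz False by (simp add: order_mult order_f_lam[OF i])
      then have "?P ^ 2 dvd g" unfolding order_divides by simp
      then obtain e where e: "g = ?P ^ 2 * e" by (auto elim: dvdE)
      then have "e \<noteq> 0" using False by auto
      then have "degree e = 0" using dg unfolding e by (simp add: degree_mult_eq degree_power_eq)
      then obtain c where "e = [:c:]" by (metis degree_0_id)
      then show ?thesis using g e by (intro exI[of _ c]) simp
    qed
  next
    assume "\<exists>c. D l = f * smult c (?P ^ 2)"
    then obtain c where c: "D l = f * smult c (?P ^ 2)" by blast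
    have "?P ^ r i dvd f" using order_1[of "lam i" f] order_f_lam[OF i] by simp
    then have "?P ^ (r i + 2) dvd D l" unfolding c power_add by (intro mult_dvd_mono dvd_smult dvd_refl)
    moreover have "f dvd D l" unfolding c by (rule dvd_triv_left)
    ultimately show "l \<in> ann n W0 \<and> ?P ^ (r i + 2) dvd D l" unfolding ann_W0_iff using l by blast
  qed
  then show ?thesis
    unfolding ann_lspan_Un S using ann_subset_amb[of n W0] by blast
qed

lemma codim_two:
  assumes "vdim_eq (lspan (W \<union> W0)) (n + 1)"
  shows "(\<exists>i1<k. \<exists>i2<k. i1 \<noteq> i2 \<and>
           sch_span n (zsch k y (\<lambda>j. if j = i1 \<or> j = i2 then 0 else r j)) \<subseteq> W \<and>
           lspan (W \<union> W0) =
             lspan (W0 \<union> sch_span n [(y i1, r i1 + 2)]) \<inter>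
             lspan (W0 \<union> sch_span n [(y i2, r i2 + 2)]))
      \<or> (\<exists>i<k. sch_span n (zsch k y (\<lambda>j. if j = i then 0 else r j)) \<subseteq> W \<and>
           W \<subseteq> lspan (W0 \<union> sch_span n [(y i, r i + 2)]))"
proof -
  have sub: "lspan (W \<union> W0) \<subseteq> amb n"
    unfolding lspan_eq_span using W_subset_amb W0_subset_amb by (intro fn.span_minimal subspace_amb) auto
  have UU0: "ann n (lspan (W \<union> W0)) = U \<inter> ann n W0"
    unfolding ann_lspan_Un ann_W ..
  have LW: "lspan (W \<union> W0) = ann n (U \<inter> ann n W0)"
    using lspan_eq_ann[of "W \<union> W0" n] W_subset_amb W0_subset_amb UU0[unfolded lspan_eq_span ann_span]
    by simp
  obtain g1 g2 where g: "g1 \<in> U \<inter> ann n W0" "g2 \<in> U \<inter> ann n W0"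
    and g_ind: "\<And>a b. (\<And>x. a * g1 x + b * g2 x = 0) \<Longrightarrow> a = 0 \<and> b = 0"
    and g_span: "\<And>l. l \<in> U \<inter> ann n W0 \<Longrightarrow> \<exists>a b. \<forall>x. l x = a * g1 x + b * g2 x"
    using ann_codim_2[OF assms sub] unfolding UU0 by metis
  have gU: "g1 \<in> U" "g2 \<in> U" using g by auto
  have gamb: "g1 \<in> amb n" "g2 \<in> amb n" using gU U_subset_amb by auto
  obtain w where w: "ind3 g1 g2 w" "comb3 g1 g2 w = U"
    by (rule comb3_extend2[OF ind3_u gU g_ind]) auto
  have wU: "w \<in> U" unfolding w(2)[symmetric] unfolding comb3_eq_span by (simp add: fn.span_base)
  have wamb: "w \<in> amb n" using wU U_subset_amb by auto
  obtain q1 q2 where q: "D g1 = f * q1" "D g2 = f * q2"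
    using g unfolding Int_iff ann_W0_iff by (auto elim!: dvdE)
  have dq: "degree q1 \<le> 2" "degree q2 \<le> 2"
    using degree_dehom[of \<tau> "n + 2" g1] degree_dehom[of \<tau> "n + 2" g2] degree_cofactor q by simp_all
  have comb_amb: "(\<lambda>x. a * g1 x + b * g2 x) \<in> amb n" for a b by (intro amb_add_scaled gamb)
  have comb_U: "(\<lambda>x. a * g1 x + b * g2 x) \<in> U \<inter> ann n W0" for a b
  proof
    show "(\<lambda>x. a * g1 x + b * g2 x) \<in> U"
      unfolding w(2)[symmetric] by (rule comb3I[where a = a and b = b and c = 0]) simp
    have "f dvd D (\<lambda>x. a * g1 x + b * g2 x)"
      unfolding D_add_scaled q by (intro dvd_add dvd_smult dvd_triv_left)
    then show "(\<lambda>x. a * g1 x + b * g2 x) \<in> ann n W0"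
      unfolding ann_W0_iff using comb_amb by blast
  qed
  have comb_D: "D (\<lambda>x. a * g1 x + b * g2 x) = f * (smult a q1 + smult b q2)" for a b
    unfolding D_add_scaled q by (simp only: distrib_left mult_smult_right)
  have q_ind: "a = 0 \<and> b = 0" if "smult a q1 + smult b q2 = 0" for a b
  proof (rule g_ind)
    have "D (\<lambda>x. a * g1 x + b * g2 x) = D 0" unfolding comb_D that D_zero by simp
    then have "(\<lambda>x. a * g1 x + b * g2 x) = 0"
      by (rule amb_dehom_inject[OF comb_amb fn.subspace_0[OF subspace_amb]])
    then show "a * g1 x + b * g2 x = 0" for x by (simp add: fun_eq_iff)
  qed
  have osc: "osc f (D w) (f * q1) (f * q2)" using osc_U[OF wU gU] unfolding q .
  \<comment> \<open>Both \<open>D g1\<close> and \<open>D g2\<close> are multiples of f, so w alone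
    decides whether \<open>W\<close> contains the full r_i-fold point at \<open>y i\<close>.\<close>
  define bad where "bad i \<longleftrightarrow> \<not> [:- lam i, 1:] ^ r i dvd D w" for i
  have bad_square: "\<exists>a b. [:- lam i, 1:] ^ 2 = smult a q1 + smult b q2" if "i < k" "bad i" for i
    by (rule osc_pencil[OF osc f_nz _ dq q_ind])
      (use that order_f_lam[OF that(1)] in \<open>simp_all add: bad_def\<close>)
  define A where "A i = {l \<in> amb n. \<exists>c. D l = f * smult c ([:- lam i, 1:] ^ 2)}" for i
  have A_lspan: "lspan (W0 \<union> sch_span n [(y i, r i + 2)]) = ann n (A i)" if "i < k" for i
    unfolding A_def ann_osculating_sum[OF that, unfolded lspan_eq_span ann_span, symmetric]
    by (rule lspan_eq_ann) (use W0_subset_amb sch_span_subset_amb in blast)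
  have A_sub: "A i \<subseteq> U \<inter> ann n W0" if i: "i < k" "bad i" for i
  proof
    fix l assume "l \<in> A i"
    then obtain c where c: "l \<in> amb n" "D l = f * smult c ([:- lam i, 1:] ^ 2)" by (auto simp: A_def)
    obtain a b where "[:- lam i, 1:] ^ 2 = smult a q1 + smult b q2" using bad_square[OF i] by blast
    then have "D l = D (\<lambda>x. (c * a) * g1 x + (c * b) * g2 x)"
      unfolding c comb_D by (simp only: smult_add_right smult_smult)
    then have "l = (\<lambda>x. (c * a) * g1 x + (c * b) * g2 x)" by (rule amb_dehom_inject[OF c(1) comb_amb])
    then show "l \<in> U \<inter> ann n W0" using comb_U by simp
  qed
  have sch_W: "sch_span n (zsch k y \<rho>) \<subseteq> W"
    if \<rho>: "\<And>j. j < k \<Longrightarrow> \<rho> j = 0 \<or> \<rho> j = r j \<and> \<not> bad j" for \<rho>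
  proof -
    have "hyp_has n l (zsch k y \<rho>)" if "l \<in> U" for l
      unfolding hyp_has_iff
    proof (intro allI impI)
      fix j assume j: "j < k"
      obtain a b c where *: "\<And>x. l x = a * g1 x + b * g2 x + c * w x"
        using \<open>l \<in> U\<close>[folded w(2)] by (auto simp: comb3_def)
      have f: "[:- lam j, 1:] ^ r j dvd f" using order_1[of "lam j" f] order_f_lam[OF j] by simp
      show "[:- lam j, 1:] ^ \<rho> j dvd D l"
      proof (cases "\<rho> j = 0")
        case False
        then have "\<rho> j = r j" "[:- lam j, 1:] ^ r j dvd D w" using \<rho>[OF j] by (auto simp: bad_def)
        then show ?thesis
          unfolding dehom_comb3[of l, OF *] q using f by (intro dvd_add dvd_smult) (auto intro: dvd_mult2)
      qed simp
    qed
    then have "U \<subseteq> {l \<in> amb n. hyp_has n l (zsch k y \<rho>)}" using U_subset_amb by blast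
    then show ?thesis unfolding sch_span_eq_ann by (subst W_eq) (rule ann_antimono)
  qed
  \<comment> \<open>Otherwise f divides \<open>D w\<close>, which puts w into the pencil spanned by
    g1 and g2.\<close>
  have ex_bad: "\<exists>i<k. bad i"
  proof (rule ccontr)
    assume none: "\<not> (\<exists>i<k. bad i)"
    have "f dvd D w"
    proof (rule dvd_if_order_le[OF f_nz])
      fix a
      show "[:- a, 1:] ^ order a f dvd D w"
      proof (cases "poly f a = 0")
        case True
        then obtain i where "i < k" "a = lam i" using root_f_is_lam by blast
        then show ?thesis using none order_f_lam by (auto simp: bad_def)
      next
        case False
        then show ?thesis by (simp add: order_0I)
      qed
    qed
    then have "w \<in> U \<inter> ann n W0" using wU wamb by (simp add: ann_W0_iff)
    then obtain a b where "\<forall>x. w x = a * g1 x + b * g2 x" using g_span by blast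
    then have "\<forall>x. a * g1 x + b * g2 x + (-1) * w x = 0" by simp
    then show False using w(1) unfolding ind3_def by (metis zero_neq_neg_one)
  qed
  show ?thesis
  proof (cases "\<exists>i1<k. \<exists>i2<k. i1 \<noteq> i2 \<and> bad i1 \<and> bad i2")
    case True
    then obtain i1 i2 where i: "i1 < k" "i2 < k" "i1 \<noteq> i2" "bad i1" "bad i2" by blast
    let ?P1 = "[:- lam i1, 1:] ^ 2" and ?P2 = "[:- lam i2, 1:] ^ 2"
    have ne: "lam i1 \<noteq> lam i2" using lam_inj i by blast
    obtain a1 b1 a2 b2 where sq: "?P1 = smult a1 q1 + smult b1 q2" "?P2 = smult a2 q1 + smult b2 q2"
      using bad_square[OF i(1,4)] bad_square[OF i(2,5)] by blast
    note squares = pencil_spanned_by_squares[OF ne sq]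
    have only: "j = i1 \<or> j = i2" if j: "j < k" "bad j" for j
    proof -
      obtain a b where ab: "[:- lam j, 1:] ^ 2 = smult a q1 + smult b q2" using bad_square[OF j] by blast
      obtain p s where "smult a q1 + smult b q2 = smult p ?P1 + smult s ?P2" using squares by blast
      then have "lam j = lam i1 \<or> lam j = lam i2" using third_square_independent[OF _ ne] ab by metis
      then show ?thesis using lam_inj j i by auto
    qed
    have "sch_span n (zsch k y (\<lambda>j. if j = i1 \<or> j = i2 then 0 else r j)) \<subseteq> W"
      by (rule sch_W) (use only in auto)
    \<comment> \<open>The two squares form a basis of the pencil, so the equations of the two larger
      spans together generate those of the span of \<open>W\<close> and \<open>W0\<close>.\<close>
    moreover have "lspan (W \<union> W0) = ann n (A i1) \<inter> ann n (A i2)"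
    proof
      show "lspan (W \<union> W0) \<subseteq> ann n (A i1) \<inter> ann n (A i2)"
        unfolding LW using ann_antimono[OF A_sub[OF i(1,4)]] ann_antimono[OF A_sub[OF i(2,5)]] by blast
      show "ann n (A i1) \<inter> ann n (A i2) \<subseteq> lspan (W \<union> W0)"
      proof
        fix v assume v: "v \<in> ann n (A i1) \<inter> ann n (A i2)"
        have "degree ([:- z, 1:] ^ 2) \<le> 2" for z :: 'a by (simp add: degree_power_eq)
        then obtain lA lB where lA: "lA \<in> ann n W0" "D lA = f * ?P1" and lB: "lB \<in> ann n W0" "D lB = f * ?P2"
          using ann_W0_ex by metis
        have amb: "lA \<in> amb n" "lB \<in> amb n" using lA lB by (auto simp: ann_def)
        have "lA \<in> A i1" unfolding A_def using lA amb by (intro CollectI conjI exI[of _ 1]) (simp_all only: smult_1_left)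
        moreover have "lB \<in> A i2" unfolding A_def using lB amb by (intro CollectI conjI exI[of _ 1]) (simp_all only: smult_1_left)
        ultimately have vAB: "dotp n v lA = 0" "dotp n v lB = 0" using v by (auto simp: ann_def)
        have "dotp n v l = 0" if l: "l \<in> U \<inter> ann n W0" for l
        proof -
          obtain a b where ab: "l = (\<lambda>x. a * g1 x + b * g2 x)" using g_span[OF l] by (auto simp: fun_eq_iff)
          obtain p s where ps: "smult a q1 + smult b q2 = smult p ?P1 + smult s ?P2" using squares by blast
          have "D l = D (\<lambda>x. p * lA x + s * lB x)"
            unfolding ab comb_D ps D_add_scaled lA lB by (simp only: distrib_left mult_smult_right)
          then have "l = (\<lambda>x. p * lA x + s * lB x)"
            using l by (intro amb_dehom_inject[of l n _ \<tau>] amb_add_scaled amb) (simp_all add: ann_W0_iff)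
          then have "dotp n l v = p * dotp n lA v + s * dotp n lB v" by (simp only: dotp_add_scaled)
          then show ?thesis using vAB by (simp add: dotp_commute)
        qed
        then show "v \<in> lspan (W \<union> W0)" unfolding LW using v by (auto simp: ann_def)
      qed
    qed
    ultimately show ?thesis
      unfolding A_lspan[OF i(1), symmetric] A_lspan[OF i(2), symmetric] using i(1-3) by blast
  next
    case False
    \<comment> \<open>This bad point is unique, so the full multiplicity survives at all the
      others.\<close>
    obtain i where i: "i < k" "bad i" using ex_bad by blast
    have "sch_span n (zsch k y (\<lambda>j. if j = i then 0 else r j)) \<subseteq> W"
      by (rule sch_W) (use False i in auto)
    moreover have "W \<subseteq> lspan (W0 \<union> sch_span n [(y i, r i + 2)])"
      unfolding A_lspan[OF i(1)] using A_sub[OF i] by (subst W_eq) (intro ann_antimono, blast)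
    ultimately show ?thesis using i(1) by blast
  qed
qed

end

theorem theorem4p3:
  fixes n k :: nat and y :: "nat \<Rightarrow> 'a::{alg_closed_field, field_char_0} \<times> 'a"
    and r :: "nat \<Rightarrow> nat" and W0 W :: "(nat \<Rightarrow> 'a) set"
  assumes "n \<ge> 1"
    and "in_G n W0"
    and "\<forall>i<k. y i \<noteq> (0,0)"
    and "\<forall>i<k. \<forall>j<k. i \<noteq> j \<longrightarrow> \<not> proj_eq (y i) (y j)"
    and "\<forall>i<k. r i \<ge> 1"
    and "(\<Sum>i<k. r i) = n"
    and "int_is n W0 (zsch k y r)"
    and "in_G n W"
    and "in_O2 n W0 W"
  shows
   "(vdim_eq (lspan (W \<union> W0)) (n+2) \<longrightarrow>
      (\<exists>i1<k. \<exists>i2<k. i1 \<noteq> i2 \<and>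
         int_is n W (zsch k y (\<lambda>j. if j = i1 \<or> j = i2 then r j - 1 else r j)) \<and>
         W \<inter> W0 = sch_span n (zsch k y (\<lambda>j. if j = i1 \<or> j = i2 then r j - 1 else r j)) \<and>
         (\<exists>q1 q2. q1 \<noteq> (\<lambda>_. 0) \<and> q1 \<in> sch_span n [(y i1, r i1 + 1)] \<and>
                  q2 \<noteq> (\<lambda>_. 0) \<and> q2 \<in> sch_span n [(y i2, r i2 + 1)] \<and>
                  sch_in n (lspan (W \<union> {q1})) [(y i1, r i1 + 1)] \<and>
                  sch_in n (lspan (W \<union> {q2})) [(y i2, r i2 + 1)])))
    \<and>
    (vdim_eq (lspan (W \<union> W0)) (n+1) \<longrightarrow>
      in_T n W0 W
      \<or> (\<exists>i1<k. \<exists>i2<k. i1 \<noteq> i2 \<and>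
           sch_span n (zsch k y (\<lambda>j. if j = i1 \<or> j = i2 then 0 else r j)) \<subseteq> W \<and>
           lspan (W \<union> W0) =
             lspan (W0 \<union> sch_span n [(y i1, r i1 + 2)]) \<inter>
             lspan (W0 \<union> sch_span n [(y i2, r i2 + 2)]))
      \<or> (\<exists>i<k. sch_span n (zsch k y (\<lambda>j. if j = i then 0 else r j)) \<subseteq> W \<and>
           W \<subseteq> lspan (W0 \<union> sch_span n [(y i, r i + 2)])))"
proof -
  obtain u u1 u2 u3 where u: "lf n u" "\<exists>i. u i \<noteq> 0" "W0 = phi n u"
    and cut: "cut_by n u1 u2 u3 W"
    and pl: "plk n u1 u2 u3 \<in> lspan {psi3 n u v w | v w. lf n v \<and> lf n w}"
    using assms(9) unfolding in_O2_def by blast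
  obtain i where "u i \<noteq> 0" using u(2) by blast
  then have "coeff (vpoly n u) i \<noteq> 0"
    using u(1) by (auto simp: coeff_vpoly lf_def not_le)
  then have "vpoly n u \<noteq> 0" by auto
  have "\<exists>i. u1 i \<noteq> 0"
  proof (rule ccontr)
    assume "\<not> ?thesis"
    then have "\<forall>x. 1 * u1 x + 0 * u2 x + 0 * u3 x = 0" by simp
    then show False using ann_cut_by(3)[OF cut] unfolding ind3_def by (metis zero_neq_one)
  qed
  then obtain j where j: "u1 j \<noteq> 0" by blast
  have "u1 \<in> amb n" using cut unfolding cut_by_def by (rule conjunct1)
  then have "j \<le> n + 2" using j unfolding amb_def by (cases "j \<le> n + 2") auto
  with j have "coeff (vpoly (n + 2) u1) j \<noteq> 0" by (simp add: coeff_vpoly)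
  then have "vpoly (n + 2) u1 \<noteq> 0" by auto
  with \<open>vpoly n u \<noteq> 0\<close> have "vpoly n u * vpoly (n + 2) u1 \<noteq> 0" by simp
  \<comment> \<open>A nonzero polynomial over an infinite field has a non-root; one \<tau> serves
    both forms because their product is taken.\<close>
  then obtain \<tau> where \<tau>: "poly (vpoly n u) \<tau> \<noteq> 0" "poly (vpoly (n + 2) u1) \<tau> \<noteq> 0"
    using poly_all_0_iff_0[of "vpoly n u * vpoly (n + 2) u1"] by auto
  interpret framed_osculation n k y r u W0 \<tau> W u1 u2 u3
    by unfold_locales (use assms u(1,3) \<tau> cut in_O2_osc[OF u(1) pl] in auto)
  show ?thesis
    using codim_one codim_two by blast
qed

end
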